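(* Let $n \geq 2$. There exists a compact subset $S \subseteq \mathbb{R}^{n}$ of Lebesgue measure $0$ such that every Lipschitz function $g\colon \mathbb{R}^{n} \to \mathbb{R}$ has a point of Fréchet differentiability in $S$; that is, for every Lipschitz $g\colon\mathbb{R}^n\to\mathbb{R}$ there is a point $x \in S$ at which $g$ is Fréchet differentiable.
   Context: $\mathbb{R}^n$ carries the Euclidean norm. A function is Lipschitz if $|g(x)-g(y)|\le L\|x-y\|$ for some $L\ge 0$ and all $x,y$. *)

theory Defs
  imports "HOL-Analysis.Analysis"
begin

end

theory Submission
  imports Defs
begin

text \<open>
  The null set is a member \<open>T 1\<close> of an increasing family of closed sets \<open>T l\<close>, cut down to a ball. Each \<open>T l\<close> is
  an intersection of thin neighbourhoods of finite unions of segments, arranged so that at a point of \<open>T l\<close> every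
  two-legged polygon of small diameter \<open>r\<close> is approximated within \<open>o(r)\<close> by a polygon inside \<open>T l'\<close>,
  for any \<open>l' > l\<close>.

  Following Preiss, one looks for a point \<open>x\<close> and a unit vector \<open>e\<close> at which the directional derivative of the
  Lipschitz function, tilted by a suitable linear functional, is almost maximal among all nearby directional
  derivatives at points \<open>x'\<close> whose increments along \<open>e\<close> are close to the increments at \<open>x\<close>. If the function
  were not differentiable at \<open>x\<close>, a flat wedge through the bad point \<open>x + h\<close> with end points on the line
  \<open>x + \<real>e\<close> would have a leg on which the average slope exceeds the derivative at \<open>x\<close>. A maximal function
  estimate then produces a point on the wedge with a larger derivative and with controlled increments at all scales, a contradiction.
\<close>

section \<open>A family of null sets approximating all wedges\<close>

text \<open>The wedge works because the Euclidean norm is smooth away from 0: the leg from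
  \<open>x - w *\<^sub>R e\<close> to \<open>x + h\<close> has length
  \<open>w + e \<bullet> h\<close> up to |h|^2 / (2 w). With r = |h|, w = s r and s large, bending
  the line thus costs only the order r / s in length, whereas a failure of the approximation by
  \<open>D * (e \<bullet> h)\<close> gains \<epsilon> r on one leg. Spread over a leg of length
  about s r this is an average excess of only \<epsilon> / s, so the precision of the maximality
  must beat 1 / s. Yet points with a larger excess may have increments further from those at
  \<open>x\<close>, and no single pair of tolerance and precision serves them all; hence the
  sequences \<open>\<sigma>seq\<close> and \<open>\<epsilon>seq\<close>, summed against the weak
  type estimate. The other obstacle is that wedges at a point of \<open>T l\<close> are found only
  in strictly larger sets. Maximality is therefore always tested at a level strictly above that of
  the candidate, and this slack has to survive the passage to the limit. The tilts are there because
  almost maximal slopes alone would not make the directions converge.\<close>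

definition segments :: "'a::real_vector set \<Rightarrow> 'a set" where
  "segments A = (\<Union>a\<in>A. \<Union>b\<in>A. closed_segment a b)"

section \<open>Segments spanned by a finite set and their thin closed neighbourhoods\<close>

lemma closed_segment_subset_segments: "a \<in> A \<Longrightarrow> b \<in> A \<Longrightarrow> closed_segment a b \<subseteq> segments A"
  unfolding segments_def by blast

lemma segments_mono: "A \<subseteq> B \<Longrightarrow> segments A \<subseteq> segments B"
  unfolding segments_def by blast

lemma compact_segments:
  fixes A :: "'a::real_normed_vector set"
  shows "finite A \<Longrightarrow> compact (segments A)"
  unfolding segments_def by (intro compact_UN) auto

lemma negligible_closed_segment:
  fixes a b :: "'a::euclidean_space"
  assumes "DIM('a) \<ge> 2"
  shows "negligible (closed_segment a b)"
proof -
  have "dim (closed_segment 0 (b - a)) \<le> dim {b - a}"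
    by (intro dim_mono) (auto simp: closed_segment_def span_singleton)
  also have "\<dots> \<le> 1"
    by (metis card.empty card_insert_disjoint dim_le_card' empty_iff finite.emptyI finite.insertI One_nat_def)
  finally have "negligible (closed_segment 0 (b - a))"
    using assms by (intro negligible_lowdim) auto
  then have "negligible ((+) a ` closed_segment 0 (b - a))"
    by (rule negligible_translation)
  then show ?thesis
    by (simp flip: closed_segment_translation)
qed

lemma negligible_segments:
  fixes A :: "'a::euclidean_space set"
  assumes "DIM('a) \<ge> 2" "finite A"
  shows "negligible (segments A)"
  unfolding segments_def using assms by (intro negligible_Union) (auto intro!: negligible_Union negligible_closed_segment)

text \<open>Outer regularity gives an open superset of small measure, and compactness leaves room in
  it for a closed neighbourhood of positive width.\<close>

lemma compact_negligible_small_neighbourhood: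
  fixes K :: "'a::euclidean_space set"
  assumes "compact K" "K \<noteq> {}" "negligible K" "e > 0"
  obtains w where "w > 0" "{x. infdist x K \<le> w} \<in> lmeasurable"
    "measure lebesgue {x. infdist x K \<le> w} \<le> e"
proof -
  have "K \<in> lmeasurable" "measure lebesgue K = 0"
    using assms(3) negligible_iff_measure by blast+
  then obtain T where T: "open T" "K \<subseteq> T" "T - K \<in> lmeasurable" "emeasure lebesgue (T - K) < ennreal e"
    using sets_lebesgue_outer_open[of K e, OF fmeasurableD] \<open>e > 0\<close> by auto
  have TK: "T = (T - K) \<union> K" using T(2) by blast
  have T3: "T \<in> lmeasurable"
    using fmeasurable.Un[OF T(3) \<open>K \<in> lmeasurable\<close>] TK by simp
  have "measure lebesgue T \<le> measure lebesgue (T - K) + measure lebesgue K"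
    using measure_Un_le[of "T - K" lebesgue K] T(3) \<open>K \<in> lmeasurable\<close> TK by (simp add: fmeasurableD)
  moreover have "measure lebesgue (T - K) < e"
    using T(3,4) \<open>e > 0\<close> by (simp add: emeasure_eq_measure2 ennreal_less_iff)
  ultimately have T4: "measure lebesgue T < e" using \<open>measure lebesgue K = 0\<close> by simp
  obtain d where d: "d > 0" "(\<Union>x\<in>K. ball x d) \<subseteq> T"
    using compact_subset_open_imp_ball_epsilon_subset[OF assms(1) T(1,2)] by blast
  have sub: "{x. infdist x K \<le> d/2} \<subseteq> T"
  proof
    fix x assume "x \<in> {x. infdist x K \<le> d/2}"
    then have "infdist x K \<le> d/2" by simp
    moreover obtain y where "y \<in> K" "infdist x K = dist x y"
      by (rule infdist_attains_inf[OF compact_imp_closed[OF assms(1)] assms(2)])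
    ultimately have "x \<in> ball y d" using \<open>d > 0\<close> by (simp add: dist_commute)
    then show "x \<in> T" using \<open>y \<in> K\<close> d by blast
  qed
  have "closed {x. infdist x K \<le> d/2}"
    by (intro closed_Collect_le continuous_intros)
  then have "{x. infdist x K \<le> d/2} \<in> lmeasurable"
    using sub T3 fmeasurableI2[of T] by (simp add: borel_closed)
  moreover have "measure lebesgue {x. infdist x K \<le> d/2} \<le> e"
    using measure_mono_fmeasurable[OF sub _ T3] calculation T4 by (simp add: fmeasurableD)
  ultimately show ?thesis using that[of "d/2"] \<open>d > 0\<close> by simp
qed

lemma finite_net_cball:
  fixes x :: "'a::euclidean_space"
  assumes "e > 0"
  obtains A where "finite A" "\<And>y. y \<in> cball x r \<Longrightarrow> \<exists>a\<in>A. dist y a \<le> e"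
proof -
  obtain k where k: "finite k" "cball x r \<subseteq> (\<Union>a\<in>k. ball a e)"
    using seq_compact_imp_totally_bounded[OF compact_imp_seq_compact[OF compact_cball[of x r]]] assms by auto
  have "\<exists>a\<in>k. dist y a \<le> e" if "y \<in> cball x r" for y
  proof -
    obtain a where "a \<in> k" "y \<in> ball a e" using k(2) \<open>y \<in> cball x r\<close> by blast
    then show ?thesis by (intro bexI[of _ a]) (simp_all add: dist_commute)
  qed
  with k(1) show ?thesis by (rule that)
qed

text \<open>\<open>p\<close> and \<open>u\<close> are the ends and \<open>q\<close> the corner of a
  wedge. One \<open>q'\<close> serves both legs, so the approximating polygon stays connected, and
  the error \<open>\<eta> * r\<close> is relative to the size of the wedge.\<close>

definition wedge_rich :: "'a::euclidean_space set \<Rightarrow> 'a \<Rightarrow> bool" where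
  "wedge_rich S x \<longleftrightarrow> (\<forall>\<eta>>0. \<exists>d>0. \<forall>r p q u. 0 < r \<longrightarrow> r < d \<longrightarrow>
     p \<in> cball x r \<longrightarrow> q \<in> cball x r \<longrightarrow> u \<in> cball x r \<longrightarrow>
     (\<exists>p' q' u'. dist p p' \<le> \<eta> * r \<and> dist q q' \<le> \<eta> * r \<and> dist u u' \<le> \<eta> * r \<and>
        closed_segment p' q' \<subseteq> S \<and> closed_segment q' u' \<subseteq> S))"

text \<open>Dependent choice: the new net is taken fine relative to the old width
  \<open>w m\<close>, and only then is the new width shrunk until the neighbourhood has small
  measure. The factor \<open>1 / (real m + 1)\<close> makes the net finer than any fixed multiple of
  \<open>w m\<close> for large m. The points 0 and \<open>b\<close> stay in every net, so that all
  the sets share a segment.\<close>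

lemma net_sequence:
  assumes "DIM('a::euclidean_space) \<ge> 2"
  obtains A :: "nat \<Rightarrow> 'a::euclidean_space set" and w :: "nat \<Rightarrow> real" and b :: "'a::euclidean_space" where
    "\<And>m. finite (A m)" "0 \<in> A 0" "b \<in> A 0" "b \<noteq> 0" "norm b = 1"
    "\<And>m. A m \<subseteq> A (Suc m)" "\<And>m. w m > 0" "\<And>m. w (Suc m) \<le> w m / 2"
    "\<And>m. {x. infdist x (segments (A m)) \<le> w m} \<in> lmeasurable"
    "\<And>m. measure lebesgue {x. infdist x (segments (A m)) \<le> w m} \<le> (1/2)^m"
    "\<And>m y. y \<in> cball 0 (real m) \<Longrightarrow> \<exists>a\<in>A (Suc m). dist y a \<le> w m / (real m + 1)"
proof -
  obtain b :: 'a where b: "b \<in> Basis" using nonempty_Basis by blast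
  define P :: "nat \<Rightarrow> 'a set \<times> real \<Rightarrow> bool" where
    "P = (\<lambda>m (A,w). finite A \<and> 0 \<in> A \<and> b \<in> A \<and> w > 0 \<and>
      {x. infdist x (segments A) \<le> w} \<in> lmeasurable \<and>
      measure lebesgue {x. infdist x (segments A) \<le> w} \<le> (1/2)^m)"
  define Q :: "nat \<Rightarrow> 'a set \<times> real \<Rightarrow> 'a set \<times> real \<Rightarrow> bool" where
    "Q = (\<lambda>m (A,w) (A',w'). A \<subseteq> A' \<and> w' \<le> w / 2 \<and>
      (\<forall>y\<in>cball 0 (real m). \<exists>a\<in>A'. dist y a \<le> w / (real m + 1)))"
  have shrink: "\<exists>w'. P m (A, w') \<and> w' \<le> v"
    if A: "finite A" "0 \<in> A" "b \<in> A" and v: "v > 0" for m A and v :: real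
  proof -
    have ne: "segments A \<noteq> {}"
      using closed_segment_subset_segments[OF A(2,3)] by auto
    obtain w where w: "w > 0" "{x. infdist x (segments A) \<le> w} \<in> lmeasurable"
      "measure lebesgue {x. infdist x (segments A) \<le> w} \<le> (1/2)^m"
      using compact_negligible_small_neighbourhood[OF compact_segments[OF A(1)] ne
          negligible_segments[OF assms A(1)], of "(1/2)^m"] by auto
    have sub: "{x. infdist x (segments A) \<le> min w v} \<subseteq> {x. infdist x (segments A) \<le> w}" by auto
    have "closed {x. infdist x (segments A) \<le> min w v}"
      by (intro closed_Collect_le continuous_intros)
    then have m: "{x. infdist x (segments A) \<le> min w v} \<in> lmeasurable"
      using sub w(2) fmeasurableI2[of "{x. infdist x (segments A) \<le> w}"] by (simp add: borel_closed)
    have "measure lebesgue {x. infdist x (segments A) \<le> min w v} \<le> (1/2)^m"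
      using measure_mono_fmeasurable[OF sub fmeasurableD[OF m] w(2)] w(3) by linarith
    then show ?thesis
      using A m w(1) v by (intro exI[of _ "min w v"]) (auto simp: P_def)
  qed
  have "\<exists>f. \<forall>n. P n (f n) \<and> Q n (f n) (f (Suc n))"
  proof (rule dependent_nat_choice)
    show "\<exists>s. P 0 s" using shrink[of "{0,b}" 1 0] by auto
  next
    fix s n assume Ps: "P n s"
    obtain A w where s: "s = (A, w)" by (cases s)
    have A: "finite A" "0 \<in> A" "b \<in> A" "w > 0" using Ps by (auto simp: P_def s)
    have wn: "w / (real n + 1) > 0" using A(4) by simp
    obtain N where N: "finite N" "\<And>y. y \<in> cball (0::'a) (real n) \<Longrightarrow> \<exists>a\<in>N. dist y a \<le> w / (real n + 1)"
      by (rule finite_net_cball[OF wn, where x=0 and r="real n"]) (rule that)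
    have "\<exists>w'. P (Suc n) (A \<union> N, w') \<and> w' \<le> w / 2"
      by (rule shrink) (use A N(1) in auto)
    then obtain w' where "P (Suc n) (A \<union> N, w')" "w' \<le> w / 2" by blast
    then show "\<exists>s'. P (Suc n) s' \<and> Q n s s'"
    proof (intro exI[of _ "(A \<union> N, w')"] conjI)
      have "\<exists>a\<in>A \<union> N. dist y a \<le> w / (real n + 1)" if "y \<in> cball 0 (real n)" for y
        using N(2)[OF that] by blast
      then show "Q n s (A \<union> N, w')"
        unfolding Q_def s using \<open>w' \<le> w / 2\<close> by blast
    qed
  qed
  then obtain f where f: "\<And>n. P n (f n)" "\<And>n. Q n (f n) (f (Suc n))" by blast
  show ?thesis
  proof (rule that[of "fst \<circ> f" b "snd \<circ> f"])
  qed (use f b in \<open>auto simp: P_def Q_def split_beta\<close>)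
qed

lemma wedge_rich_family:
  assumes "DIM('a::euclidean_space) \<ge> 2"
  obtains T :: "real \<Rightarrow> 'a::euclidean_space set" and b :: "'a::euclidean_space" where
    "\<And>l. closed (T l)" "\<And>l l'. 0 \<le> l \<Longrightarrow> l \<le> l' \<Longrightarrow> T l \<subseteq> T l'" "negligible (T 1)"
    "norm b = 1" "\<And>l. l \<ge> 0 \<Longrightarrow> closed_segment 0 b \<subseteq> T l"
    "\<And>l l' x. 0 \<le> l \<Longrightarrow> l < l' \<Longrightarrow> l' \<le> 1 \<Longrightarrow> x \<in> T l \<Longrightarrow> wedge_rich (T l') x"
proof -
  obtain A :: "nat \<Rightarrow> 'a set" and b and w where A:
    "\<And>m. finite (A m)" "0 \<in> A 0" "b \<in> A 0" "b \<noteq> 0" "norm b = 1"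
    "\<And>m. A m \<subseteq> A (Suc m)" "\<And>m. w m > 0" "\<And>m. w (Suc m) \<le> w m / 2"
    "\<And>m. {x. infdist x (segments (A m)) \<le> w m} \<in> lmeasurable"
    "\<And>m. measure lebesgue {x. infdist x (segments (A m)) \<le> w m} \<le> (1/2)^m"
    "\<And>m y. y \<in> cball 0 (real m) \<Longrightarrow> \<exists>a\<in>A (Suc m). dist y a \<le> w m / (real m + 1)"
    by (rule net_sequence[OF assms]) (rule that)
  define F where "F m = segments (A m)" for m
  txt \<open>The window \<open>k \<le> m \<le> (1 + l) k\<close> grows with \<open>l\<close>: at the level where the thickness of the neighbourhoods
    drops below \<open>r\<close>, the larger window of \<open>T l'\<close> admits one more generation of segments, which contains
    a fine net of polygons at scale \<open>r\<close>.\<close>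
  define T where "T l = {x. \<forall>k\<ge>1. \<exists>m. k \<le> m \<and> real m \<le> (1 + l) * real k \<and> infdist x (F m) \<le> l * w m}" for l :: real
  have A_mono: "A m \<subseteq> A n" if "m \<le> n" for m n
    using that by (rule lift_Suc_mono_le[of A, OF A(6)])
  have F_mono: "F m \<subseteq> F n" if "m \<le> n" for m n
    unfolding F_def by (rule segments_mono[OF A_mono[OF that]])
  have w_Suc: "w (Suc m) \<le> w m" for m
    using A(7)[of m] A(8)[of m] by linarith
  have w_mono: "w n \<le> w m" if "m \<le> n" for m n
    using that by (rule lift_Suc_antimono_le[of w, OF w_Suc])
  have F_ne: "F m \<noteq> {}" for m
    using closed_segment_subset_segments[of 0 "A m" b] A_mono[of 0 m] A(2,3) by (auto simp: F_def)
  have w_pow: "w m \<le> w 0 * (1/2)^m" for m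
  proof (induction m)
    case (Suc m) then show ?case using A(8)[of m] by simp
  qed simp
  have w_lim: "\<exists>m\<ge>k. w m < e" if "e > 0" for e k
  proof -
    have "(\<lambda>m. w 0 * (1/2)^m) \<longlonglongrightarrow> w 0 * 0"
      by (intro tendsto_intros LIMSEQ_realpow_zero) auto
    then have "\<forall>\<^sub>F m in sequentially. w 0 * (1/2)^m < e"
      using that by (auto dest: order_tendstoD(2))
    then obtain N where N: "\<And>m. m \<ge> N \<Longrightarrow> w 0 * (1/2)^m < e"
      by (auto simp: eventually_sequentially)
    show ?thesis using N[of "max N k"] w_pow[of "max N k"] by (intro exI[of _ "max N k"]) auto
  qed
  have cl: "closed (T l)" for l
  proof -
    have "T l = (\<Inter>k\<in>{1..}. \<Union>m\<in>{m. k \<le> m \<and> real m \<le> (1 + l) * real k}. {x. infdist x (F m) \<le> l * w m})"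
      unfolding T_def by auto
    moreover have "finite {m. k \<le> m \<and> real m \<le> (1 + l) * real k}" for k
      by (rule finite_subset[OF _ finite_atMost[of "nat \<lfloor>(1 + l) * real k\<rfloor>"]]) (auto simp: le_nat_floor)
    ultimately show ?thesis
      by (auto intro!: closed_INT closed_UN closed_Collect_le continuous_intros)
  qed
  have mono: "T l \<subseteq> T l'" if "0 \<le> l" "l \<le> l'" for l l'
  proof
    fix x assume x: "x \<in> T l"
    show "x \<in> T l'" unfolding T_def
    proof (intro CollectI allI impI)
      fix k :: nat assume "1 \<le> k"
      then obtain m where m: "k \<le> m" "real m \<le> (1 + l) * real k" "infdist x (F m) \<le> l * w m"
        using x unfolding T_def by blast
      have "(1 + l) * real k \<le> (1 + l') * real k" "l * w m \<le> l' * w m"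
        using that A(7)[of m] by (auto intro!: mult_right_mono)
      then show "\<exists>m\<ge>k. real m \<le> (1 + l') * real k \<and> infdist x (F m) \<le> l' * w m"
        using m by (intro exI[of _ m]) linarith
    qed
  qed
  have null: "negligible (T 1)"
    unfolding negligible_outer_le
  proof (intro allI impI)
    fix e :: real assume "e > 0"
    define N where "N m = {x. infdist x (F m) \<le> w m}" for m
    obtain k where k: "2 * (1/2)^Suc k < e"
      using real_arch_pow_inv[of e "1/2"] \<open>e > 0\<close> by auto
    define j where "j = Suc k"
    have j: "j \<ge> 1" "2 * (1/2)^j < e" using k by (auto simp: j_def)
    \<comment> \<open>The condition for the single window k = j already confines \<open>T 1\<close>
      to the neighbourhoods numbered j to 2 j, a tail of a geometric series.\<close>
    have "T 1 \<subseteq> (\<Union>m\<in>{j..2*j}. N m)"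
    proof
      fix x assume "x \<in> T 1"
      then obtain m where m: "j \<le> m" "real m \<le> (1 + 1) * real j" "infdist x (F m) \<le> 1 * w m"
        using j(1) unfolding T_def by blast
      have "m \<in> {j..2*j}" using m(1,2) by simp
      moreover have "x \<in> N m" using m(3) by (simp add: N_def)
      ultimately show "x \<in> (\<Union>m\<in>{j..2*j}. N m)" by blast
    qed
    moreover have "(\<Union>m\<in>{j..2*j}. N m) \<in> lmeasurable"
      using A(9) by (intro fmeasurable.finite_UN) (auto simp: N_def F_def)
    moreover have "measure lebesgue (\<Union>m\<in>{j..2*j}. N m) \<le> e"
    proof -
      have "measure lebesgue (\<Union>m\<in>{j..2*j}. N m) \<le> (\<Sum>m\<in>{j..2*j}. measure lebesgue (N m))"
        using A(9) by (intro measure_UNION_le) (auto simp: N_def F_def fmeasurableD)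
      also have "\<dots> \<le> (\<Sum>m\<in>{j..2*j}. (1/2)^m)"
        using A(10) by (intro sum_mono) (auto simp: N_def F_def)
      also have "\<dots> \<le> 2 * (1/2)^j"
        by (subst sum_gp) (auto simp: field_simps)
      finally show ?thesis using j(2) by linarith
    qed
    ultimately show "\<exists>U. T 1 \<subseteq> U \<and> U \<in> lmeasurable \<and> measure lebesgue U \<le> e" by blast
  qed
  have seg: "closed_segment 0 b \<subseteq> T l" if "l \<ge> 0" for l
  proof
    fix x assume "x \<in> closed_segment 0 b"
    then have "x \<in> F 0" using closed_segment_subset_segments[OF A(2,3)] by (auto simp: F_def)
    then have "x \<in> F k" for k using F_mono[of 0 k] by blast
    then have "infdist x (F k) \<le> l * w k" for k using that A(7)[of k] by simp
    moreover have "real k \<le> (1 + l) * real k" for k using that by (simp add: mult_right_mono algebra_simps)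
    ultimately show "x \<in> T l" unfolding T_def by blast
  qed
  have rich: "wedge_rich (T l') x" if l: "0 \<le> l" "l < l'" "l' \<le> 1" and x: "x \<in> T l" for l l' x
    unfolding wedge_rich_def
  proof (intro allI impI)
    fix \<eta>0 :: real assume "\<eta>0 > 0"
    define \<eta> where "\<eta> = min \<eta>0 1"
    have \<eta>: "0 < \<eta>" "\<eta> \<le> 1" "\<eta> \<le> \<eta>0" using \<open>\<eta>0 > 0\<close> by (auto simp: \<eta>_def)
    define c where "c = l' - l"
    have c: "c > 0" using l by (simp add: c_def)
    \<comment> \<open>The bounds on the critical level K below: 1 / c gives the larger window one
      more index, 2 / (c \<eta>) makes the net finer than \<eta> r, and norm x + 1 puts the ball
      around \<open>x\<close> into the region covered by the net.\<close>
    obtain K0 :: nat where K0: "real K0 \<ge> 1 / c" "real K0 \<ge> 2 / (c * \<eta>)" "real K0 \<ge> norm x + 1" "K0 \<ge> 1"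
    proof -
      obtain K0 :: nat where "real K0 \<ge> max (max (1 / c) (2 / (c * \<eta>))) (norm x + 1)"
        using real_arch_simple by blast
      then show ?thesis using that[of K0] norm_ge_zero[of x] by simp
    qed
    \<comment> \<open>Since \<open>M K0\<close> is at most 2 \<open>K0\<close>, this bound on r
      forces the critical level to exceed \<open>K0\<close>.\<close>
    define d where "d = min 1 (c * w (2 * K0) / 2)"
    have d: "d > 0" "d \<le> 1" "2 * d \<le> c * w (2 * K0)" using c A(7)[of "2*K0"] by (auto simp: d_def)
    show "\<exists>d>0. \<forall>r p q u. 0 < r \<longrightarrow> r < d \<longrightarrow> p \<in> cball x r \<longrightarrow> q \<in> cball x r \<longrightarrow> u \<in> cball x r \<longrightarrow>
      (\<exists>p' q' u'. dist p p' \<le> \<eta>0 * r \<and> dist q q' \<le> \<eta>0 * r \<and> dist u u' \<le> \<eta>0 * r \<and>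
        closed_segment p' q' \<subseteq> T l' \<and> closed_segment q' u' \<subseteq> T l')"
    proof (intro exI[of _ d] conjI allI impI)
      fix r p q u assume r: "0 < r" "r < d" and pqu: "p \<in> cball x r" "q \<in> cball x r" "u \<in> cball x r"
      define M where "M k = nat \<lfloor>(1 + l) * real k\<rfloor>" for k
      have M: "real (M k) \<le> (1 + l) * real k" for k
        using of_nat_floor[of "(1 + l) * real k"] l by (simp add: M_def)
      have M_ge: "k \<le> M k" for k
        unfolding M_def using l by (intro le_nat_floor) (simp add: algebra_simps)
      have M_max: "m \<le> M k" if "real m \<le> (1 + l) * real k" for m k
        unfolding M_def using that by (rule le_nat_floor)
      have ex: "\<exists>k\<ge>1. c * w (M k) < 2 * r"
      proof -
        obtain m where "m \<ge> 1" "w m < 2 * r / c" using w_lim[of "2 * r / c" 1] r c by auto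
        moreover have "c * w (M m) \<le> c * w m"
          using w_mono[OF M_ge[of m]] c by simp
        moreover have "c * w m < 2 * r" using \<open>w m < 2 * r / c\<close> c by (simp add: field_simps)
        ultimately have "c * w (M m) < 2 * r" by linarith
        then show ?thesis using \<open>m \<ge> 1\<close> by blast
      qed
      \<comment> \<open>The first window whose thinnest neighbourhood, the one with the last
        admissible index \<open>M k\<close>, can no longer absorb a displacement of 2 r into the
        slack c.\<close>
      define K where "K = (LEAST k. k \<ge> 1 \<and> c * w (M k) < 2 * r)"
      have K: "K \<ge> 1" "c * w (M K) < 2 * r"
      proof -
        have "K \<ge> 1 \<and> c * w (M K) < 2 * r" unfolding K_def by (rule LeastI_ex[OF ex])
        then show "K \<ge> 1" "c * w (M K) < 2 * r" by blast+
      qed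
      have K_least: "c * w (M k) \<ge> 2 * r" if "k \<ge> 1" "k < K" for k
      proof -
        have "\<not> (k \<ge> 1 \<and> c * w (M k) < 2 * r)" using that(2) unfolding K_def by (rule not_less_Least)
        then show ?thesis using that(1) by linarith
      qed
      have "K > K0"
      proof (rule ccontr)
        assume "\<not> K > K0"
        then have "M K \<le> 2 * K0"
        proof -
          have "real (M K) \<le> (1 + l) * real K" by (rule M)
          also have "\<dots> \<le> 2 * real K0" using l \<open>\<not> K > K0\<close> by (intro mult_mono) auto
          finally show ?thesis by linarith
        qed
        then have "c * w (2 * K0) \<le> c * w (M K)" using w_mono c by (intro mult_left_mono) auto
        then show False using d(3) r K(2) by linarith
      qed
      define m where "m = M K"
      have "m \<ge> K" unfolding m_def by (rule M_ge)
      have net: "\<exists>a\<in>A (Suc m). dist y a \<le> \<eta> * r" if "y \<in> cball x r" for y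
      proof -
        have "dist 0 y \<le> norm x + 1"
          using that r d(2) norm_triangle_ineq2[of y x] by (auto simp: dist_norm norm_minus_commute)
        also have "\<dots> \<le> real m" using K0(3) \<open>K > K0\<close> \<open>m \<ge> K\<close> by linarith
        finally obtain a where a: "a \<in> A (Suc m)" "dist y a \<le> w m / (real m + 1)" using A(11)[of y m] by auto
        have "w m / (real m + 1) \<le> \<eta> * r"
        proof -
          have "2 / (c * \<eta>) \<le> real m + 1" using K0(2) \<open>K > K0\<close> \<open>m \<ge> K\<close> by linarith
          then have "2 \<le> (real m + 1) * c * \<eta>" using c \<eta> by (simp add: field_simps)
          then have "2 * r \<le> (real m + 1) * c * \<eta> * r" using r by (intro mult_right_mono) auto
          then have "c * w m \<le> c * ((real m + 1) * \<eta> * r)" using K(2) by (simp add: m_def algebra_simps)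
          then have "w m \<le> (real m + 1) * \<eta> * r" using c by simp
          then show ?thesis by (simp add: field_simps)
        qed
        then show ?thesis using a by (meson order_trans)
      qed
      have inT: "closed_segment p' q' \<subseteq> T l'"
        if p': "p' \<in> A (Suc m)" "p' \<in> cball x (2*r)" and q': "q' \<in> A (Suc m)" "q' \<in> cball x (2*r)" for p' q'
      proof
        fix y assume y: "y \<in> closed_segment p' q'"
        then have "y \<in> cball x (2*r)"
          using closed_segment_subset[OF p'(2) q'(2) convex_cball] by blast
        then have yx: "dist y x \<le> 2 * r" by (simp add: dist_commute)
        have yF: "y \<in> F (Suc m)"
          using y closed_segment_subset_segments[OF p'(1) q'(1)] by (auto simp: F_def)
        show "y \<in> T l'" unfolding T_def
        proof (intro CollectI allI impI)
          fix k :: nat assume "1 \<le> k"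
          show "\<exists>i\<ge>k. real i \<le> (1 + l') * real k \<and> infdist y (F i) \<le> l' * w i"
          proof (cases "k < K")
            case True
            \<comment> \<open>Below the critical level the witness of \<open>x\<close> is reused: i
              is at most \<open>M k\<close>, so the displacement 2 r is at most c times
              \<open>w i\<close>.\<close>
            obtain i where i: "k \<le> i" "real i \<le> (1 + l) * real k" "infdist x (F i) \<le> l * w i"
              using x \<open>1 \<le> k\<close> unfolding T_def by blast
            have "infdist y (F i) \<le> infdist x (F i) + dist y x" by (rule infdist_triangle)
            also have "\<dots> \<le> l * w i + c * w (M k)" using i(3) yx K_least[OF \<open>1 \<le> k\<close> True] by linarith
            also have "\<dots> \<le> l * w i + c * w i"
              using w_mono[OF M_max[OF i(2)]] c by simp
            finally have "infdist y (F i) \<le> l' * w i" by (simp add: c_def algebra_simps)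
            moreover have "(1 + l) * real k \<le> (1 + l') * real k" using l by (intro mult_right_mono) auto
            ultimately show ?thesis using i by (intro exI[of _ i]) linarith
          next
            case False
            \<comment> \<open>From the critical level on, \<open>y\<close> lies exactly on the
              segments of generation \<open>Suc m\<close>; the one index beyond the window of
              \<open>T l\<close> is paid for by c K being at least 1.\<close>
            define i where "i = max k (Suc m)"
            have "y \<in> F i" using yF F_mono[of "Suc m" i] by (auto simp: i_def)
            then have "infdist y (F i) \<le> l' * w i" using l A(7)[of i] by simp
            moreover have "real i \<le> (1 + l') * real k"
            proof -
              have "1 \<le> c * real K"
              proof -
                have "1 / c \<le> real K" using K0(1) \<open>K > K0\<close> by linarith
                then show ?thesis using c by (simp add: field_simps)
              qed
              then have "real (Suc m) \<le> (1 + l) * real K + c * real K" using M[of K] by (simp add: m_def)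
              also have "\<dots> = (1 + l') * real K" by (simp add: c_def algebra_simps)
              also have "\<dots> \<le> (1 + l') * real k" using l False by (intro mult_left_mono) auto
              finally have "real (Suc m) \<le> (1 + l') * real k" .
              moreover have "real k \<le> (1 + l') * real k" using l by (simp add: algebra_simps)
              ultimately show ?thesis by (simp add: i_def max_def)
            qed
            ultimately show ?thesis by (intro exI[of _ i]) (auto simp: i_def)
          qed
        qed
      qed
      have near: "a \<in> cball x (2*r)" if "y \<in> cball x r" "dist y a \<le> \<eta> * r" for y a
      proof -
        have "\<eta> * r \<le> r" using \<eta> r by simp
        then show ?thesis using that dist_triangle[of x a y] by simp
      qed
      obtain p' q' u' where "p' \<in> A (Suc m)" "dist p p' \<le> \<eta> * r" "q' \<in> A (Suc m)" "dist q q' \<le> \<eta> * r"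
         "u' \<in> A (Suc m)" "dist u u' \<le> \<eta> * r"
        using net pqu by meson
      moreover have "\<eta> * r \<le> \<eta>0 * r" using \<eta> r by simp
      ultimately show "\<exists>p' q' u'. dist p p' \<le> \<eta>0 * r \<and> dist q q' \<le> \<eta>0 * r \<and> dist u u' \<le> \<eta>0 * r \<and>
        closed_segment p' q' \<subseteq> T l' \<and> closed_segment q' u' \<subseteq> T l'"
        using inT near pqu by (meson order_trans)
    qed (use d in auto)
  qed
  show ?thesis by (rule that[of T b]) (fact cl mono null A(5) seg rich)+
qed

section \<open>Lipschitz functions on the line\<close>

lemma lipschitz_real_bound:
  assumes "L-lipschitz_on UNIV (\<phi> :: real \<Rightarrow> real)"
  shows "\<bar>\<phi> x - \<phi> y\<bar> \<le> L * \<bar>x - y\<bar>"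
  using lipschitz_onD[OF assms, of x y] by (simp add: dist_real_def)

text \<open>The density is the Radon-Nikodym derivative of the pushforward of Lebesgue measure under the inverse of \<open>F\<close>.\<close>
lemma expanding_lipschitz_has_integral_density:
  fixes F :: "real \<Rightarrow> real"
  assumes lower: "\<And>x y. x \<le> y \<Longrightarrow> F y - F x \<ge> y - x"
    and upper: "\<And>x y. x \<le> y \<Longrightarrow> F y - F x \<le> C * (y - x)"
  obtains h where "h \<in> borel_measurable borel"
    "\<And>a b. a \<le> b \<Longrightarrow> (h has_integral (F b - F a)) {a..b}"
proof -
  have abs_upper: "\<bar>F y - F x\<bar> \<le> C * \<bar>y - x\<bar>" for x y
    using lower[of x y] upper[of x y] lower[of y x] upper[of y x]
    by (cases "x \<le> y") (simp_all add: abs_of_nonneg abs_of_nonpos)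
  have abs_lower: "\<bar>F y - F x\<bar> \<ge> \<bar>y - x\<bar>" for x y
    using lower[of x y] lower[of y x] by linarith
  have C: "C \<ge> 0" using abs_upper[of 1 0] by simp
  have F_less: "F x < F y \<longleftrightarrow> x < y" for x y
    using lower[of x y] lower[of y x] by linarith
  have F_le: "F x \<le> F y \<longleftrightarrow> x \<le> y" for x y
    using lower[of x y] lower[of y x] F_less[of x y] by linarith
  have contF: "continuous_on S F" for S
    using abs_upper C by (intro lipschitz_on_continuous_on[of C] lipschitz_onI) (auto simp: dist_real_def abs_minus_commute)
  have "\<exists>x. F x = y" for y
  proof -
    have "F (- (\<bar>y\<bar> + \<bar>F 0\<bar>)) \<le> y" "y \<le> F (\<bar>y\<bar> + \<bar>F 0\<bar>)"
      using lower[of "- (\<bar>y\<bar> + \<bar>F 0\<bar>)" 0] lower[of 0 "\<bar>y\<bar> + \<bar>F 0\<bar>"] by linarith+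
    moreover have "- (\<bar>y\<bar> + \<bar>F 0\<bar>) \<le> \<bar>y\<bar> + \<bar>F 0\<bar>" by simp
    ultimately show ?thesis using IVT'[OF _ _ _ contF] by blast
  qed
  then obtain \<psi> where \<psi>: "\<And>y. F (\<psi> y) = y" by metis
  have \<psi>F: "\<psi> (F x) = x" for x
    using abs_lower[of "\<psi> (F x)" x] \<psi>[of "F x"] by simp
  have "1-lipschitz_on UNIV \<psi>"
    using abs_lower[of "\<psi> x" "\<psi> y" for x y] \<psi> by (intro lipschitz_onI) (auto simp: dist_real_def)
  then have "continuous_on UNIV \<psi>" by (rule lipschitz_on_continuous_on)
  then have \<psi>_meas [measurable]: "\<psi> \<in> borel_measurable borel" by (rule borel_measurable_continuous_onI)
  define N where "N = distr lborel borel \<psi>"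
  \<comment> \<open>Preimages under \<psi> are images under \<open>F\<close>, so \<open>N\<close>
    measures a set by the length of its image. Absolute continuity then says that the Lipschitz map
    \<open>F\<close> preserves null sets.\<close>
  have vimage: "\<psi> -` A = F ` A" for A
  proof (intro set_eqI iffI)
    fix x assume "x \<in> \<psi> -` A"
    then show "x \<in> F ` A" by (metis \<psi> image_eqI vimageD)
  qed (auto simp: \<psi>F)
  have "absolutely_continuous lborel N"
    unfolding absolutely_continuous_def
  proof
    fix A :: "real set" assume A: "A \<in> null_sets lborel"
    then have "negligible A" unfolding negligible_iff_null_sets by (rule null_sets_completionI)
    then have "negligible (F ` A)"
      using abs_upper by (intro negligible_locally_Lipschitz_image) (auto intro!: exI[of _ UNIV])
    moreover have "A \<in> sets borel" using A by auto
    ultimately show "A \<in> null_sets N"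
      using measurable_sets_borel[OF \<psi>_meas, of A]
      by (simp add: N_def null_sets_distr_iff negligible_iff_null_sets null_sets_completion_iff flip: vimage)
  qed
  moreover have "sets N = sets lborel" by (simp add: N_def)
  ultimately obtain g where g: "g \<in> borel_measurable lborel" "density lborel g = N"
    using sigma_finite_measure.Radon_Nikodym[OF sigma_finite_lborel] by blast
  have Ioc: "(\<integral>\<^sup>+x. g x * indicator {a<..b} x \<partial>lborel) = ennreal (F b - F a)" if "a \<le> b" for a b
  proof -
    have "F ` {a<..b} = {F a<..F b}"
    proof
      show "F ` {a<..b} \<subseteq> {F a<..F b}" by (auto simp: F_less F_le)
      show "{F a<..F b} \<subseteq> F ` {a<..b}"
      proof
        fix y assume "y \<in> {F a<..F b}"
        then have "\<psi> y \<in> {a<..b}" using F_less[of a "\<psi> y"] F_le[of "\<psi> y" b] \<psi> by simp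
        then show "y \<in> F ` {a<..b}" using \<psi>[of y] by (metis image_eqI)
      qed
    qed
    then have "emeasure N {a<..b} = ennreal (F b - F a)"
      using that F_le by (simp add: N_def emeasure_distr vimage)
    moreover have "emeasure N {a<..b} = (\<integral>\<^sup>+x. g x * indicator {a<..b} x \<partial>lborel)"
      unfolding g(2)[symmetric] by (rule emeasure_density[OF g(1)]) simp
    ultimately show ?thesis by simp
  qed
  define h where "h = (\<lambda>x. enn2real (g x))"
  have h_meas [measurable]: "h \<in> borel_measurable borel" using g(1) unfolding h_def by simp
  \<comment> \<open>The density takes values in the extended reals; it is finite almost everywhere
    because its integrals over an exhausting sequence of bounded intervals are.\<close>
  have "AE x in lborel. g x * indicator {-real n<..real n} x \<noteq> \<infinity>" for n
    using g(1) Ioc[of "-real n" "real n"] by (intro nn_integral_PInf_AE) auto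
  then have "AE x in lborel. \<forall>n. g x * indicator {-real n<..real n} x \<noteq> \<infinity>"
    by (simp add: AE_all_countable)
  then have fin: "AE x in lborel. g x \<noteq> \<infinity>"
  proof (rule AE_mp, intro AE_I2 impI)
    fix x assume *: "\<forall>n. g x * indicator {-real n<..real n} x \<noteq> \<infinity>"
    obtain n where "\<bar>x\<bar> < real n" using reals_Archimedean2 by blast
    then have "indicator {-real n<..real n} x = (1::ennreal)" by (auto simp: indicator_def)
    then show "g x \<noteq> \<infinity>" using *[rule_format, of n] by simp
  qed
  have "(h has_integral (F b - F a)) {a..b}" if ab: "a \<le> b" for a b
  proof -
    have "(\<integral>\<^sup>+x. ennreal (h x * indicator {a<..b} x) \<partial>lborel) = (\<integral>\<^sup>+x. g x * indicator {a<..b} x \<partial>lborel)"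
      using fin by (intro nn_integral_cong_AE) (auto simp: h_def indicator_def less_top split: if_splits elim!: eventually_mono)
    then have "((\<lambda>x. h x * indicator {a<..b} x) has_integral (F b - F a)) UNIV"
    proof (intro nn_integral_has_integral)
      show "(\<lambda>x. h x * indicator {a<..b} x) \<in> borel_measurable borel" by measurable
    qed (use Ioc[OF ab] lower[OF ab] ab in \<open>auto simp: h_def\<close>)
    moreover have "(\<lambda>x. h x * indicator {a<..b} x) = (\<lambda>x. if x \<in> {a<..b} then h x else 0)"
      by (auto simp: indicator_def)
    ultimately have "((\<lambda>x. if x \<in> {a<..b} then h x else 0) has_integral (F b - F a)) UNIV"
      by simp
    then have "((\<lambda>x. if x \<in> {a..b} then h x else 0) has_integral (F b - F a)) UNIV"
      by (rule has_integral_spike[OF negligible_sing[of a], rotated]) auto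
    then show ?thesis by (simp only: has_integral_restrict_UNIV)
  qed
  with h_meas show ?thesis by (rule that)
qed

text \<open>Lebesgue differentiation along the intervals from x to x + k controls only the right
  difference quotients. The left ones come from the same statement for the reflected function, whose
  primitive is x \<mapsto> - \<phi> (- x).\<close>

lemma has_real_derivative_indefinite_integral:
  fixes h \<phi> :: "real \<Rightarrow> real"
  assumes int: "\<And>a b. a \<le> b \<Longrightarrow> (h has_integral (\<phi> b - \<phi> a)) {a..b}"
  obtains N where "negligible N" "\<And>x. x \<notin> N \<Longrightarrow> (\<phi> has_real_derivative h x) (at x)"
proof -
  have right: "\<exists>N. negligible N \<and> (\<forall>x e. x \<notin> N \<longrightarrow> 0 < e \<longrightarrow>
      (\<exists>d>0. \<forall>k. 0 < k \<and> k < d \<longrightarrow> \<bar>(\<phi> (x + k) - \<phi> x) / k - h x\<bar> < e))"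
    if int: "\<And>a b. a \<le> b \<Longrightarrow> (h has_integral (\<phi> b - \<phi> a)) {a..b}" for h \<phi> :: "real \<Rightarrow> real"
  proof -
    have "h integrable_on cbox a b" for a b
    proof (cases "a \<le> b")
      case True then show ?thesis using int[OF True] by (auto simp: integrable_on_def)
    qed auto
    then obtain N where N: "negligible N" "\<And>x e. \<lbrakk>x \<notin> N; 0 < e\<rbrakk> \<Longrightarrow>
        \<exists>d>0. \<forall>k. 0 < k \<and> k < d \<longrightarrow> norm (integral (cbox x (x + k *\<^sub>R One)) h /\<^sub>R k ^ DIM(real) - h x) < e"
      using integrable_ccontinuous_explicit[of h] by blast
    have "\<exists>d>0. \<forall>k. 0 < k \<and> k < d \<longrightarrow> \<bar>(\<phi> (x + k) - \<phi> x) / k - h x\<bar> < e" if xe: "x \<notin> N" "0 < e" for x e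
    proof -
      obtain d where d: "d > 0" "\<And>k. 0 < k \<and> k < d \<Longrightarrow> norm (integral (cbox x (x + k *\<^sub>R One)) h /\<^sub>R k ^ DIM(real) - h x) < e"
        using N(2)[OF xe] by blast
      have "\<bar>(\<phi> (x + k) - \<phi> x) / k - h x\<bar> < e" if "0 < k \<and> k < d" for k
        using d(2)[OF that] integral_unique[OF int[of x "x + k"]] that
        by (simp add: divide_inverse mult.commute)
      then show ?thesis using d(1) by blast
    qed
    then show ?thesis using N(1) by blast
  qed
  obtain N1 where N1: "negligible N1" "\<And>x e. \<lbrakk>x \<notin> N1; 0 < e\<rbrakk> \<Longrightarrow>
      \<exists>d>0. \<forall>k. 0 < k \<and> k < d \<longrightarrow> \<bar>(\<phi> (x + k) - \<phi> x) / k - h x\<bar> < e"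
    using right[OF int] by blast
  have "((\<lambda>x. h (- x)) has_integral (- \<phi> (- b) - - \<phi> (- a))) {a..b}" if "a \<le> b" for a b
    using int[of "-b" "-a"] that has_integral_reflect_real[of h _ "-a" "-b"] by simp
  then obtain N2 where N2: "negligible N2" "\<And>x e. \<lbrakk>x \<notin> N2; 0 < e\<rbrakk> \<Longrightarrow>
      \<exists>d>0. \<forall>k. 0 < k \<and> k < d \<longrightarrow> \<bar>(- \<phi> (- (x + k)) - - \<phi> (- x)) / k - h (- x)\<bar> < e"
     using right[of "\<lambda>x. h (- x)" "\<lambda>x. - \<phi> (- x)"] by blast
  have "negligible (uminus ` N2)"
    using N2(1) by (intro negligible_locally_Lipschitz_image) (auto intro!: exI[of _ UNIV] exI[of _ "1::real"])
  then have neg: "negligible (N1 \<union> uminus ` N2)" using N1(1) by (intro negligible_Un)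
  have "(\<phi> has_real_derivative h x) (at x)" if x: "x \<notin> N1 \<union> uminus ` N2" for x
    unfolding DERIV_def LIM_eq
  proof (intro allI impI)
    fix e :: real assume "e > 0"
    have "x \<notin> N1" "- x \<notin> N2" using x by (auto simp: image_iff)
    obtain d1 where d1: "d1 > 0" "\<And>k. 0 < k \<and> k < d1 \<Longrightarrow> \<bar>(\<phi> (x + k) - \<phi> x) / k - h x\<bar> < e"
      using N1(2)[OF \<open>x \<notin> N1\<close> \<open>e > 0\<close>] by blast
    obtain d2 where d2: "d2 > 0"
      "\<And>k. 0 < k \<and> k < d2 \<Longrightarrow> \<bar>(- \<phi> (- (- x + k)) - - \<phi> (- (- x))) / k - h (- (- x))\<bar> < e"
      using N2(2)[OF \<open>- x \<notin> N2\<close> \<open>e > 0\<close>] by blast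
    have "norm ((\<phi> (x + k) - \<phi> x) / k - h x) < e" if "k \<noteq> 0 \<and> norm (k - 0) < min d1 d2" for k
    proof (cases "k > 0")
      case True then show ?thesis using d1(2)[of k] that by simp
    next
      case False
      then have "\<bar>(- \<phi> (- (- x + - k)) - - \<phi> (- (- x))) / - k - h (- (- x))\<bar> < e"
        using that by (intro d2(2)) auto
      moreover have "(- \<phi> (- (- x + - k)) - - \<phi> (- (- x))) / - k = (\<phi> (x + k) - \<phi> x) / k"
        by (simp add: divide_simps add.commute)
      ultimately show ?thesis by simp
    qed
    then show "\<exists>s>0. \<forall>k. k \<noteq> 0 \<and> norm (k - 0) < s \<longrightarrow> norm ((\<phi> (x + k) - \<phi> x) / k - h x) < e"
      using d1(1) d2(1) by (intro exI[of _ "min d1 d2"]) auto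
  qed
  with neg show ?thesis by (rule that)
qed

text \<open>Adding (L + 1) x makes \<phi> expanding, so that it has a density. Clamping the density
  to [-L, L] changes it only on the exceptional null set, keeps it Borel and makes the bound hold
  everywhere.\<close>

lemma lipschitz_real_density:
  fixes \<phi> :: "real \<Rightarrow> real"
  assumes "L-lipschitz_on UNIV \<phi>"
  obtains h N where "negligible N" "h \<in> borel_measurable borel" "\<And>x. \<bar>h x\<bar> \<le> L"
    "\<And>x. x \<notin> N \<Longrightarrow> (\<phi> has_real_derivative h x) (at x)"
    "\<And>a b. a \<le> b \<Longrightarrow> (h has_integral (\<phi> b - \<phi> a)) {a..b}"
proof -
  have L: "L \<ge> 0" using lipschitz_on_nonneg[OF assms] .
  note bd = lipschitz_real_bound[OF assms]
  define F where "F x = \<phi> x + (L + 1) * x" for x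
  have 1: "F y - F x \<ge> y - x" if "x \<le> y" for x y
    using bd[of y x] that by (simp add: F_def algebra_simps abs_le_iff)
  have 2: "F y - F x \<le> (2 * L + 1) * (y - x)" if "x \<le> y" for x y
    using bd[of y x] that by (simp add: F_def algebra_simps abs_le_iff)
  obtain h0 where h0: "h0 \<in> borel_measurable borel" "\<And>a b. a \<le> b \<Longrightarrow> (h0 has_integral (F b - F a)) {a..b}"
    by (rule expanding_lipschitz_has_integral_density[of F "2 * L + 1", OF 1 2]) (auto intro: that)
  define h1 where "h1 = (\<lambda>x. h0 x - (L + 1))"
  have h1: "(h1 has_integral (\<phi> b - \<phi> a)) {a..b}" if "a \<le> b" for a b
  proof -
    have "((\<lambda>x. h0 x - (L + 1)) has_integral ((F b - F a) - (b - a) * (L + 1))) {a..b}"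
      using has_integral_diff[OF h0(2)[OF that] has_integral_const_real[of "L + 1" a b]] that by simp
    moreover have "(F b - F a) - (b - a) * (L + 1) = \<phi> b - \<phi> a" by (simp add: F_def algebra_simps)
    ultimately show ?thesis by (simp add: h1_def)
  qed
  obtain N where N: "negligible N" "\<And>x. x \<notin> N \<Longrightarrow> (\<phi> has_real_derivative h1 x) (at x)"
    by (rule has_real_derivative_indefinite_integral[OF h1], assumption, rule that)
  have h1_bd: "\<bar>h1 x\<bar> \<le> L" if "x \<notin> N" for x
  proof -
    have "((\<lambda>k. \<bar>(\<phi> (x + k) - \<phi> x) / k\<bar>) \<longlongrightarrow> \<bar>h1 x\<bar>) (at 0)"
      using N(2)[OF that] unfolding DERIV_def by (rule tendsto_rabs)
    moreover have "\<forall>\<^sub>F k in at 0. \<bar>(\<phi> (x + k) - \<phi> x) / k\<bar> \<le> L"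
    proof (rule eventually_mono[OF eventually_at_ball'[of 1]])
      fix k :: real assume "k \<in> ball 0 1 \<and> k \<noteq> 0 \<and> k \<in> UNIV"
      then show "\<bar>(\<phi> (x + k) - \<phi> x) / k\<bar> \<le> L"
        using bd[of "x + k" x] by (simp add: abs_divide divide_le_eq)
    qed auto
    ultimately show ?thesis by (rule tendsto_upperbound) simp
  qed
  define h where "h = (\<lambda>x. max (- L) (min L (h1 x)))"
  have eq: "h x = h1 x" if "x \<notin> N" for x
    using h1_bd[OF that] by (auto simp: h_def)
  show ?thesis
  proof (rule that)
    show "negligible N" by (fact N)
    show "h \<in> borel_measurable borel" using h0(1) unfolding h_def h1_def by measurable
    show "\<bar>h x\<bar> \<le> L" for x using L by (auto simp: h_def)
    show "(\<phi> has_real_derivative h x) (at x)" if "x \<notin> N" for x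
      using N(2)[OF that] eq[OF that] by simp
    show "(h has_integral (\<phi> b - \<phi> a)) {a..b}" if "a \<le> b" for a b
      by (rule has_integral_spike[OF N(1) _ h1[OF that]]) (use eq in auto)
  qed
qed

text \<open>Vitali covering: a bad x and its u span an interval shorter than 1 / s times the
  integral of |f| over it. A disjoint subfamily, enlarged five times, covers \<open>E\<close>, and
  the integrals over the disjoint intervals add up to at most \<open>M\<close>. The intervals are
  written as balls about the midpoint of x and u to fit the covering lemma.\<close>

lemma maximal_function_weak_type:
  fixes f \<Phi> :: "real \<Rightarrow> real"
  assumes int: "\<And>u v. a \<le> u \<Longrightarrow> u \<le> v \<Longrightarrow> v \<le> b \<Longrightarrow> (f has_integral (\<Phi> v - \<Phi> u)) {u..v}"
    and abs_int: "((\<lambda>x. \<bar>f x\<bar>) has_integral M) {a..b}"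
    and cont: "continuous_on {a..b} \<Phi>" and s: "s > 0"
  defines "E \<equiv> {x\<in>{a<..<b}. \<exists>u\<in>{a..b}. \<bar>\<Phi> u - \<Phi> x\<bar> > s * \<bar>u - x\<bar>}"
  shows "E \<in> lmeasurable" "measure lebesgue E \<le> 5 / s * M"
proof -
  have abs_sub: "(\<lambda>x. \<bar>f x\<bar>) integrable_on {u..v}" if "a \<le> u" "v \<le> b" for u v
    using integrable_on_subinterval[OF has_integral_integrable[OF abs_int], of u v] that by simp
  have incr: "\<bar>\<Phi> u - \<Phi> x\<bar> \<le> integral {min x u..max x u} (\<lambda>x. \<bar>f x\<bar>)" if "x \<in> {a..b}" "u \<in> {a..b}" for x u
  proof -
    have mm: "a \<le> min x u" "min x u \<le> max x u" "max x u \<le> b" using that by auto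
    have "\<bar>\<Phi> u - \<Phi> x\<bar> = \<bar>\<Phi> (max x u) - \<Phi> (min x u)\<bar>" by (auto simp: min_def max_def)
    also have "\<dots> = norm (integral {min x u..max x u} f)" using integral_unique[OF int[OF mm]] by simp
    also have "\<dots> \<le> integral {min x u..max x u} (\<lambda>x. \<bar>f x\<bar>)"
      using has_integral_integrable[OF int[OF mm]] abs_sub[OF mm(1,3)] by (intro integral_norm_bound_integral) auto
    finally show ?thesis .
  qed
  \<comment> \<open>As a union over u of open sets, \<open>E\<close> is open; this settles its
    measurability.\<close>
  have E_eq: "E = (\<Union>u\<in>{a..b}. {x\<in>{a<..<b}. \<bar>\<Phi> u - \<Phi> x\<bar> > s * \<bar>u - x\<bar>})"
    unfolding E_def by blast
  have "open {x\<in>{a<..<b}. \<bar>\<Phi> u - \<Phi> x\<bar> > s * \<bar>u - x\<bar>}" for u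
  proof -
    have "continuous_on {a<..<b} \<Phi>" by (rule continuous_on_subset[OF cont]) auto
    then have "continuous_on {a<..<b} (\<lambda>x. \<bar>\<Phi> u - \<Phi> x\<bar> - s * \<bar>u - x\<bar>)"
      by (intro continuous_intros)
    then have "open ((\<lambda>x. \<bar>\<Phi> u - \<Phi> x\<bar> - s * \<bar>u - x\<bar>) -` {0<..} \<inter> {a<..<b})"
      by (rule continuous_on_open_vimage[THEN iffD1, rule_format, rotated]) auto
    moreover have "(\<lambda>x. \<bar>\<Phi> u - \<Phi> x\<bar> - s * \<bar>u - x\<bar>) -` {0<..} \<inter> {a<..<b} =
        {x\<in>{a<..<b}. \<bar>\<Phi> u - \<Phi> x\<bar> > s * \<bar>u - x\<bar>}" by auto
    ultimately show ?thesis by simp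
  qed
  then have "open E" unfolding E_eq by blast
  moreover have "bounded E" unfolding E_def by (rule bounded_subset[of "{a<..<b}"]) auto
  ultimately show Em: "E \<in> lmeasurable" by (rule lmeasurable_open[rotated])
  define K where "K = {(x,u). x \<in> {a<..<b} \<and> u \<in> {a..b} \<and> \<bar>\<Phi> u - \<Phi> x\<bar> > s * \<bar>u - x\<bar>}"
  define c where "c = (\<lambda>(x::real,u::real). (x + u) / 2)"
  define r where "r = (\<lambda>(x::real,u::real). \<bar>u - x\<bar> / 2)"
  have r: "0 < r i \<and> r i \<le> b - a" if "i \<in> K" for i
  proof -
    obtain x u where i: "i = (x, u)" by (cases i)
    have xu: "a < x" "x < b" "a \<le> u" "u \<le> b" "\<bar>\<Phi> u - \<Phi> x\<bar> > s * \<bar>u - x\<bar>"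
      using that by (auto simp: K_def i)
    have "u \<noteq> x" using xu(5) by auto
    then show ?thesis using xu(1-4) by (simp add: r_def i)
  qed
  have cball: "cball (c (x,u)) (r (x,u)) = {min x u..max x u}" for x u
    unfolding cball_eq_atLeastAtMost by (cases "x \<le> u") (simp_all add: c_def r_def field_simps)
  obtain C where C: "countable C" "C \<subseteq> K"
     "pairwise (\<lambda>i j. disjnt (cball (c i) (r i)) (cball (c j) (r j))) C"
     "\<And>i. i \<in> K \<Longrightarrow> \<exists>j. j \<in> C \<and> \<not> disjnt (cball (c i) (r i)) (cball (c j) (r j)) \<and>
                        cball (c i) (r i) \<subseteq> ball (c j) (5 * r j)"
    by (rule Vitali_covering_lemma_cballs_balls[of K r "b - a" c, OF r], assumption, rule that)
  have sub: "E \<subseteq> (\<Union>j\<in>C. ball (c j) (5 * r j))"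
  proof
    fix x assume "x \<in> E"
    then obtain u where "(x,u) \<in> K" by (auto simp: E_def K_def)
    then obtain j where "j \<in> C" "cball (c (x,u)) (r (x,u)) \<subseteq> ball (c j) (5 * r j)" using C(4) by blast
    moreover have "x \<in> cball (c (x,u)) (r (x,u))" unfolding cball by simp
    ultimately show "x \<in> (\<Union>j\<in>C. ball (c j) (5 * r j))" by blast
  qed
  have fin: "measure lebesgue (\<Union>j\<in>J. ball (c j) (5 * r j)) \<le> 5 / s * M" if J: "J \<subseteq> C" "finite J" for J
  proof -
    have JK: "j \<in> K" if "j \<in> J" for j using that J C(2) by blast
    have "measure lebesgue (\<Union>j\<in>J. ball (c j) (5 * r j)) \<le> (\<Sum>j\<in>J. measure lebesgue (ball (c j) (5 * r j)))"
      using J by (intro measure_UNION_le) auto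
    also have "\<dots> \<le> (\<Sum>j\<in>J. 5 / s * integral (cball (c j) (r j)) (\<lambda>x. \<bar>f x\<bar>))"
    proof (rule sum_mono)
      fix j assume "j \<in> J"
      obtain x u where j: "j = (x, u)" by (cases j)
      have xu: "x \<in> {a..b}" "u \<in> {a..b}" "\<bar>\<Phi> u - \<Phi> x\<bar> > s * \<bar>u - x\<bar>"
        using JK[OF \<open>j \<in> J\<close>] by (auto simp: K_def j)
      have "measure lebesgue (ball (c j) (5 * r j)) = 10 * r j"
        using r[OF JK[OF \<open>j \<in> J\<close>]] by (simp add: ball_eq_greaterThanLessThan)
      also have "\<dots> = 5 / s * (s * \<bar>u - x\<bar>)" using s by (simp add: j r_def)
      also have "\<dots> \<le> 5 / s * integral {min x u..max x u} (\<lambda>x. \<bar>f x\<bar>)"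
        using incr[OF xu(1,2)] xu(3) s by (intro mult_left_mono) auto
      finally show "measure lebesgue (ball (c j) (5 * r j)) \<le> 5 / s * integral (cball (c j) (r j)) (\<lambda>x. \<bar>f x\<bar>)"
        unfolding j cball .
    qed
    also have "\<dots> = 5 / s * (\<Sum>j\<in>J. integral (cball (c j) (r j)) (\<lambda>x. \<bar>f x\<bar>))"
      by (simp add: sum_distrib_left)
    also have "\<dots> \<le> 5 / s * M"
    proof (rule mult_left_mono)
      have "((\<lambda>x. \<bar>f x\<bar>) has_integral (\<Sum>j\<in>J. integral (cball (c j) (r j)) (\<lambda>x. \<bar>f x\<bar>))) (\<Union>j\<in>J. cball (c j) (r j))"
      proof (rule has_integral_UN[OF J(2)])
        fix j assume "j \<in> J"
        obtain x u where j: "j = (x, u)" by (cases j)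
        have "x \<in> {a..b}" "u \<in> {a..b}" using JK[OF \<open>j \<in> J\<close>] by (auto simp: K_def j)
        then show "((\<lambda>x. \<bar>f x\<bar>) has_integral integral (cball (c j) (r j)) (\<lambda>x. \<bar>f x\<bar>)) (cball (c j) (r j))"
          unfolding j cball by (intro integrable_integral abs_sub) auto
      next
        show "pairwise (\<lambda>i j. negligible (cball (c i) (r i) \<inter> cball (c j) (r j))) J"
          using pairwise_subset[OF C(3) J(1)] by (auto simp: pairwise_def disjnt_def)
      qed
      moreover have "(\<Union>j\<in>J. cball (c j) (r j)) \<subseteq> {a..b}"
      proof (rule UN_least)
        fix j assume "j \<in> J"
        obtain x u where j: "j = (x, u)" by (cases j)
        show "cball (c j) (r j) \<subseteq> {a..b}" unfolding j cball using JK[OF \<open>j \<in> J\<close>] by (auto simp: K_def j)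
      qed
      ultimately show "(\<Sum>j\<in>J. integral (cball (c j) (r j)) (\<lambda>x. \<bar>f x\<bar>)) \<le> M"
        using has_integral_subset_le[OF _ _ abs_int] by auto
    qed (use s in auto)
    finally show ?thesis .
  qed
  have "measure lebesgue E \<le> measure lebesgue (\<Union>j\<in>C. ball (c j) (5 * r j))"
    using sub Em fmeasurable_UN_bound[OF C(1) _ fin] by (intro measure_mono_fmeasurable) auto
  also have "\<dots> \<le> 5 / s * M"
    by (rule measure_UN_bound[OF C(1) _ fin]) auto
  finally show "measure lebesgue E \<le> 5 / s * M" .
qed

text \<open>A point of \<open>{A<..<B}\<close> at which the excess slope \<open>\<phi>' - D\<close> is larger than \<open>eps j\<close> has a maximal function larger than
  \<open>s j\<close>, so by the weak type inequality such large excess slopes contribute little to the integral.\<close>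
lemma lipschitz_derivative_selection:
  fixes \<phi> :: "real \<Rightarrow> real" and s eps :: "nat \<Rightarrow> real"
  assumes lip: "L-lipschitz_on UNIV \<phi>" and D: "\<bar>D\<bar> \<le> L" and AB: "A \<le> B" and \<theta>: "\<theta> \<ge> 0"
    and negZ: "negligible Z"
    and sel: "\<And>\<tau> j v. j \<le> k \<Longrightarrow> A + \<theta> < \<tau> \<Longrightarrow> \<tau> < B - \<theta> \<Longrightarrow> \<tau> \<notin> Z \<Longrightarrow> (\<phi> has_real_derivative v) (at \<tau>) \<Longrightarrow>
       (\<And>u. u \<in> {A..B} \<Longrightarrow> \<bar>\<phi> u - \<phi> \<tau> - D * (u - \<tau>)\<bar> \<le> s j * \<bar>u - \<tau>\<bar>) \<Longrightarrow> v - D \<le> eps j"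
    and s0: "s 0 \<ge> 2 * L" and s: "\<And>j. s j > 0" and eps: "\<And>j. eps j \<ge> 0"
    and sum: "(\<Sum>j<k. eps j / s (Suc j)) \<le> 1 / 30"
    and total: "\<phi> B - \<phi> A - D * (B - A) \<ge> - G"
    and c: "A \<le> c" "c \<le> B"
    and gain: "\<phi> c - \<phi> A - D * (c - A) \<ge> G \<or> \<phi> B - \<phi> c - D * (B - c) \<ge> G"
  shows "G \<le> 8 * L * \<theta> + 2 * eps k * (B - A)"
proof -
  have L: "L \<ge> 0" using lipschitz_on_nonneg[OF lip] .
  obtain h N where h: "negligible N" "h \<in> borel_measurable borel" "\<And>x. \<bar>h x\<bar> \<le> L"
    "\<And>x. x \<notin> N \<Longrightarrow> (\<phi> has_real_derivative h x) (at x)"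
    "\<And>a b. a \<le> b \<Longrightarrow> (h has_integral (\<phi> b - \<phi> a)) {a..b}"
    by (rule lipschitz_real_density[OF lip]) (rule that)
  define f where "f = (\<lambda>x. h x - D)"
  define \<Phi> where "\<Phi> = (\<lambda>x. \<phi> x - D * x)"
  have f_bd: "\<bar>f x\<bar> \<le> 2 * L" for x using h(3)[of x] D unfolding f_def by linarith
  have f_int: "(f has_integral (\<Phi> v - \<Phi> u)) {u..v}" if "u \<le> v" for u v
    using has_integral_diff[OF h(5)[OF that] has_integral_const_real[of D u v]] that
    by (simp add: f_def \<Phi>_def algebra_simps)
  have f_meas: "f \<in> borel_measurable borel" using h(2) unfolding f_def by measurable
  have bd_int: "g integrable_on {u..v}" if "g \<in> borel_measurable borel" "\<And>x. \<bar>g x\<bar> \<le> 2 * L" for g :: "real \<Rightarrow> real" and u v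
  proof (rule measurable_bounded_by_integrable_imp_integrable_real)
    show "g \<in> borel_measurable (lebesgue_on {u..v})"
      using that(1) by (simp add: measurable_completion measurable_restrict_space1)
    show "(\<lambda>x. 2 * L) integrable_on {u..v}" by (rule integrable_const_ivl)
  qed (use that(2) in auto)
  define p where "p = (\<lambda>x. max 0 (f x))"
  have p_meas: "p \<in> borel_measurable borel" using f_meas unfolding p_def by measurable
  have p_bd: "\<bar>p x\<bar> \<le> 2 * L" for x using f_bd[of x] L by (auto simp: p_def)
  define P where "P = integral {A..B} p"
  define M where "M = integral {A..B} (\<lambda>x. \<bar>f x\<bar>)"
  have absf_meas: "(\<lambda>x. \<bar>f x\<bar>) \<in> borel_measurable borel" using f_meas by measurable
  have p_int: "p integrable_on {u..v}" for u v by (rule bd_int[OF p_meas p_bd])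
  have M: "((\<lambda>x. \<bar>f x\<bar>) has_integral M) {A..B}"
    unfolding M_def using bd_int[OF absf_meas] f_bd by (intro integrable_integral) auto
  have sub_le: "\<Phi> v - \<Phi> u \<le> P" if uv: "A \<le> u" "u \<le> v" "v \<le> B" for u v
  proof -
    have "\<Phi> v - \<Phi> u \<le> integral {u..v} p"
      by (rule has_integral_le[OF f_int[OF uv(2)] integrable_integral[OF p_int]]) (simp add: p_def)
    also have "\<dots> \<le> P"
      unfolding P_def using uv p_int by (intro integral_subset_le) (auto simp: p_def)
    finally show ?thesis .
  qed
  have GP: "G \<le> P"
    using gain sub_le[of A c] sub_le[of c B] c by (auto simp: \<Phi>_def algebra_simps)
  \<comment> \<open>|f| is twice the positive part minus f. As the total is at least -G and G is at
    most P, this gives M \<le> 3 P: the negative part cannot outweigh the gain.\<close>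
  have "M = 2 * P - (\<Phi> B - \<Phi> A)"
  proof -
    have "((\<lambda>x. 2 * p x - f x) has_integral (2 * P - (\<Phi> B - \<Phi> A))) {A..B}"
      unfolding P_def by (intro has_integral_diff has_integral_mult_right integrable_integral p_int f_int AB)
    moreover have "(\<lambda>x. 2 * p x - f x) = (\<lambda>x. \<bar>f x\<bar>)" by (auto simp: p_def)
    ultimately have "((\<lambda>x. \<bar>f x\<bar>) has_integral (2 * P - (\<Phi> B - \<Phi> A))) {A..B}" by simp
    with M show ?thesis by (rule has_integral_unique)
  qed
  then have M3: "M \<le> 3 * P" using total GP by (simp add: \<Phi>_def algebra_simps)
  define E where "E j = {x\<in>{A<..<B}. \<exists>u\<in>{A..B}. \<bar>\<Phi> u - \<Phi> x\<bar> > s j * \<bar>u - x\<bar>}" for j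
  have cont: "continuous_on {A..B} \<Phi>"
    unfolding \<Phi>_def by (intro continuous_intros continuous_on_subset[OF lipschitz_on_continuous_on[OF lip]]) auto
  have E: "E j \<in> lmeasurable" "measure lebesgue (E j) \<le> 5 / s j * M" for j
    unfolding E_def using maximal_function_weak_type[OF f_int M cont s[of j]] by auto
  \<comment> \<open>A majorant of the positive excess: the trivial bound 2 L on the end strips,
    where \<open>sel\<close> gives no information, \<open>eps j\<close> on the set where the maximal
    function exceeds \<open>s (Suc j)\<close>, and \<open>eps k\<close> everywhere.\<close>
  define q where "q = (\<lambda>x. 2 * L * (indicat_real {A..A+\<theta>} x + indicat_real {B-\<theta>..B} x) +
    (\<Sum>j<k. eps j * indicat_real (E (Suc j)) x) + eps k * indicat_real {A..B} x)"
  have ind_int: "(indicat_real S has_integral measure lebesgue S) UNIV" if "S \<in> lmeasurable" for S :: "real set"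
    using that lmeasurable_iff_has_integral by blast
  have q_int: "(q has_integral (2 * L * (\<theta> + \<theta>) + (\<Sum>j<k. eps j * measure lebesgue (E (Suc j))) + eps k * (B - A))) UNIV"
  proof -
    have "(indicat_real {A..A+\<theta>} has_integral \<theta>) UNIV" "(indicat_real {B-\<theta>..B} has_integral \<theta>) UNIV"
      "(indicat_real {A..B} has_integral (B - A)) UNIV"
      using ind_int[of "{A..A+\<theta>}"] ind_int[of "{B-\<theta>..B}"] ind_int[of "{A..B}"] \<theta> AB by simp_all
    then show ?thesis
      unfolding q_def using ind_int[OF E(1)]
      by (intro has_integral_add has_integral_mult_right has_integral_sum) auto
  qed
  have pw: "p x \<le> q x" if x: "x \<notin> N" "x \<notin> Z" "x \<in> {A..B}" for x
  proof -
    have sum0: "0 \<le> (\<Sum>j<k. eps j * indicat_real (E (Suc j)) x)" using eps by (intro sum_nonneg) auto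
    show ?thesis
    proof (cases "x \<le> A + \<theta> \<or> x \<ge> B - \<theta>")
      case True
      then have "1 \<le> indicat_real {A..A+\<theta>} x + indicat_real {B-\<theta>..B} x" using x(3) by (auto simp: indicator_def)
      then have "2 * L * 1 \<le> 2 * L * (indicat_real {A..A+\<theta>} x + indicat_real {B-\<theta>..B} x)"
        using L by (intro mult_left_mono) auto
      moreover have "0 \<le> eps k * indicat_real {A..B} x" using eps by simp
      ultimately show ?thesis using p_bd[of x] sum0 unfolding q_def by linarith
    next
      case False
      \<comment> \<open>\<open>E 0\<close> is empty because f is bounded by 2 L \<le>
        \<open>s 0\<close>. So there is a largest j with \<open>x \<notin> E j\<close>; if it is
        below k, membership of x in \<open>E (Suc j)\<close> pays for the bound
        \<open>eps j\<close>.\<close>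
      have "\<exists>j\<le>k. x \<notin> E j"
      proof (intro exI conjI)
        have "\<bar>\<Phi> u - \<Phi> x\<bar> \<le> s 0 * \<bar>u - x\<bar>" for u
        proof -
          have "\<bar>\<Phi> u - \<Phi> x\<bar> \<le> \<bar>\<phi> u - \<phi> x\<bar> + \<bar>D\<bar> * \<bar>u - x\<bar>"
            unfolding \<Phi>_def using abs_triangle_ineq4[of "\<phi> u - \<phi> x" "D * (u - x)"]
            unfolding abs_mult by (simp add: algebra_simps)
          also have "\<dots> \<le> L * \<bar>u - x\<bar> + L * \<bar>u - x\<bar>"
            using lipschitz_real_bound[OF lip, of u x] D by (intro add_mono mult_right_mono) auto
          also have "\<dots> \<le> s 0 * \<bar>u - x\<bar>" using mult_right_mono[OF s0, of "\<bar>u - x\<bar>"] by simp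
          finally show ?thesis .
        qed
        then show "x \<notin> E 0" by (auto simp: E_def not_less)
      qed simp
      then have J: "finite {j. j \<le> k \<and> x \<notin> E j}" "{j. j \<le> k \<and> x \<notin> E j} \<noteq> {}" by auto
      define j where "j = Max {j. j \<le> k \<and> x \<notin> E j}"
      have j: "j \<le> k" "x \<notin> E j" "\<And>i. i \<le> k \<Longrightarrow> x \<notin> E i \<Longrightarrow> i \<le> j"
        using Max_in[OF J] Max_ge[OF J(1)] unfolding j_def by auto
      have "h x - D \<le> eps j"
      proof (rule sel[OF j(1) _ _ x(2) h(4)[OF x(1)]])
        show "A + \<theta> < x" "x < B - \<theta>" using False by auto
        fix u assume "u \<in> {A..B}"
        moreover have "x \<in> {A<..<B}" using False \<theta> by auto
        ultimately have "\<bar>\<Phi> u - \<Phi> x\<bar> \<le> s j * \<bar>u - x\<bar>" using j(2) by (auto simp: E_def not_less)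
        then show "\<bar>\<phi> u - \<phi> x - D * (u - x)\<bar> \<le> s j * \<bar>u - x\<bar>" by (simp add: \<Phi>_def algebra_simps)
      qed
      then have "p x \<le> eps j" using eps[of j] by (simp add: p_def f_def)
      also have "eps j \<le> (\<Sum>j<k. eps j * indicat_real (E (Suc j)) x) + eps k * indicat_real {A..B} x"
      proof (cases "j = k")
        case True then show ?thesis using sum0 x(3) by simp
      next
        case False
        then have "j < k" using j(1) by simp
        then have "x \<in> E (Suc j)" using j(3)[of "Suc j"] by auto
        then have "eps j = eps j * indicat_real (E (Suc j)) x" by simp
        also have "\<dots> \<le> (\<Sum>j<k. eps j * indicat_real (E (Suc j)) x)"
          using \<open>j < k\<close> eps by (intro member_le_sum) auto
        finally show ?thesis using eps[of k] by (simp add: add_increasing2)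
      qed
      also have "\<dots> \<le> q x" unfolding q_def using L by (auto intro!: mult_nonneg_nonneg)
      finally show ?thesis .
    qed
  qed
  have "P \<le> 2 * L * (\<theta> + \<theta>) + (\<Sum>j<k. eps j * measure lebesgue (E (Suc j))) + eps k * (B - A)"
  proof (rule has_integral_le[OF _ q_int])
    define p' where "p' = (\<lambda>x. if x \<in> N \<union> Z then 0 else if x \<in> {A..B} then p x else 0)"
    have "((\<lambda>x. if x \<in> {A..B} then p x else 0) has_integral P) UNIV"
      unfolding P_def has_integral_restrict_UNIV by (rule integrable_integral[OF p_int])
    then show "(p' has_integral P) UNIV"
      by (rule has_integral_spike[OF negligible_Un[OF h(1) negZ], rotated]) (auto simp: p'_def)
    have q0: "q x \<ge> 0" for x
      unfolding q_def using L eps by (intro add_nonneg_nonneg mult_nonneg_nonneg sum_nonneg) auto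
    show "p' x \<le> q x" for x using pw[of x] q0[of x] by (auto simp: p'_def)
  qed
  also have "(\<Sum>j<k. eps j * measure lebesgue (E (Suc j))) \<le> (\<Sum>j<k. eps j * (5 / s (Suc j) * (3 * P)))"
  proof (intro sum_mono mult_left_mono eps)
    fix j
    have "measure lebesgue (E (Suc j)) \<le> 5 / s (Suc j) * M" by (rule E)
    also have "\<dots> \<le> 5 / s (Suc j) * (3 * P)" using M3 s[of "Suc j"] by (intro mult_left_mono) auto
    finally show "measure lebesgue (E (Suc j)) \<le> 5 / s (Suc j) * (3 * P)" .
  qed
  also have "\<dots> = 15 * P * (\<Sum>j<k. eps j / s (Suc j))"
    unfolding sum_distrib_left by (intro sum.cong) auto
  \<comment> \<open>The 15 combines the covering constant 5 with M \<le> 3 P. The hypothesis on the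
    sum turns this term into P / 2, which is absorbed by the left-hand side.\<close>
  also have "\<dots> \<le> 15 * P * (1 / 30)"
  proof (rule mult_left_mono[OF sum])
    have "0 \<le> P" unfolding P_def by (rule integral_nonneg[OF p_int]) (simp add: p_def)
    then show "0 \<le> 15 * P" by simp
  qed
  finally have "P \<le> 8 * L * \<theta> + 2 * eps k * (B - A)" by (simp add: algebra_simps)
  with GP show ?thesis by linarith
qed

section \<open>Increments and directional derivatives\<close>

definition incr :: "('a::real_vector \<Rightarrow> real) \<Rightarrow> 'a \<Rightarrow> 'a \<Rightarrow> real \<Rightarrow> real" where
  "incr f x e t = f (x + t *\<^sub>R e) - f x"

definition has_dir_deriv :: "('a::real_vector \<Rightarrow> real) \<Rightarrow> 'a \<Rightarrow> 'a \<Rightarrow> real \<Rightarrow> bool" where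
  "has_dir_deriv f x e v \<longleftrightarrow> (\<forall>\<kappa>>0. \<exists>\<rho>>0. \<forall>t. \<bar>t\<bar> < \<rho> \<longrightarrow> \<bar>incr f x e t - v * t\<bar> \<le> \<kappa> * \<bar>t\<bar>)"

lemma has_dir_derivD:
  assumes "has_dir_deriv f x e v" "\<kappa> > 0"
  obtains \<rho> where "\<rho> > 0" "\<And>t. \<bar>t\<bar> < \<rho> \<Longrightarrow> \<bar>incr f x e t - v * t\<bar> \<le> \<kappa> * \<bar>t\<bar>"
  using assms unfolding has_dir_deriv_def by blast

lemma has_dir_deriv_iff_has_real_derivative:
  "has_dir_deriv f x e v \<longleftrightarrow> ((\<lambda>t. f (x + t *\<^sub>R e)) has_real_derivative v) (at 0)"
  unfolding has_field_derivative_def has_derivative_at_alt has_dir_deriv_def incr_def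
  by (simp add: bounded_linear_mult_right)

lemma lipschitz_real_valued_bound:
  fixes f :: "'a::real_normed_vector \<Rightarrow> real"
  assumes "L-lipschitz_on UNIV f"
  shows "\<bar>f x - f y\<bar> \<le> L * norm (x - y)"
  using lipschitz_onD[OF assms, of x y] by (simp add: dist_norm)

lemma incr_direction_bound:
  fixes f :: "'a::real_normed_vector \<Rightarrow> real"
  assumes "L-lipschitz_on UNIV f"
  shows "\<bar>incr f x e t - incr f x e' t\<bar> \<le> L * norm (e - e') * \<bar>t\<bar>"
  using lipschitz_real_valued_bound[OF assms, of "x + t *\<^sub>R e" "x + t *\<^sub>R e'"]
  by (simp add: incr_def mult_ac flip: scaleR_diff_right)

text \<open>The bound does not grow with t, so relative to |t| it becomes negligible beyond the
  range in which the increments are almost linear.\<close>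

lemma incr_base_bound:
  fixes f :: "'a::real_normed_vector \<Rightarrow> real"
  assumes "L-lipschitz_on UNIV f"
  shows "\<bar>incr f x e t - incr f y e t\<bar> \<le> 2 * L * norm (x - y)"
  using lipschitz_real_valued_bound[OF assms, of "x + t *\<^sub>R e" "y + t *\<^sub>R e"]
    lipschitz_real_valued_bound[OF assms, of x y]
  by (simp add: incr_def)

lemma has_dir_deriv_bound:
  fixes f :: "'a::real_normed_vector \<Rightarrow> real"
  assumes "L-lipschitz_on UNIV f" "has_dir_deriv f x e v"
  shows "\<bar>v\<bar> \<le> L * norm e"
proof (rule field_le_epsilon)
  fix \<kappa> :: real assume "\<kappa> > 0"
  then obtain \<rho> where \<rho>: "\<rho> > 0" "\<And>t. \<bar>t\<bar> < \<rho> \<Longrightarrow> \<bar>incr f x e t - v * t\<bar> \<le> \<kappa> * \<bar>t\<bar>"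
    using has_dir_derivD[OF assms(2)] by metis
  define t where "t = \<rho> / 2"
  have t: "t > 0" "\<bar>t\<bar> < \<rho>" using \<rho>(1) by (auto simp: t_def)
  have "\<bar>incr f x e t\<bar> \<le> L * norm e * t"
    using lipschitz_real_valued_bound[OF assms(1), of "x + t *\<^sub>R e" x] t by (simp add: incr_def mult_ac)
  then have "\<bar>v * t\<bar> \<le> L * norm e * t + \<kappa> * t" using \<rho>(2)[OF t(2)] t(1) by linarith
  then have "\<bar>v\<bar> * t \<le> (L * norm e + \<kappa>) * t" using t(1) by (simp add: abs_mult algebra_simps)
  then show "\<bar>v\<bar> \<le> L * norm e + \<kappa>" using t(1) by simp
qed

text \<open>Otherwise every piece of a subdivision of [a, b] would allow a gain of more than
  \<epsilon>, and enough pieces would carry the value beyond c. Unlike a supremum over one set, this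
  tests the point of \<open>S a'\<close> against a strictly larger parameter.\<close>

lemma monotone_family_near_maximum:
  fixes S :: "real \<Rightarrow> 'z set" and val :: "'z \<Rightarrow> real"
  assumes "a < b" "z0 \<in> S a" "\<And>l l'. a \<le> l \<Longrightarrow> l \<le> l' \<Longrightarrow> l' \<le> b \<Longrightarrow> S l \<subseteq> S l'"
    and bd: "\<And>z. z \<in> S b \<Longrightarrow> val z \<le> c" and "\<epsilon> > 0"
  shows "\<exists>a' b'. a \<le> a' \<and> a' < b' \<and> b' \<le> b \<and> (\<exists>z\<in>S a'. \<forall>z'\<in>S b'. val z' \<le> val z + \<epsilon>)"
proof (rule ccontr)
  assume "\<not> ?thesis"
  then have *: "\<exists>z'\<in>S b'. val z' > val z + \<epsilon>" if "a \<le> a'" "a' < b'" "b' \<le> b" "z \<in> S a'" for a' b' z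
    using that by (meson not_le)
  obtain N :: nat where N: "real N * \<epsilon> > c - val z0" using ex_less_of_nat_mult[OF \<open>\<epsilon> > 0\<close>] by blast
  define g where "g i = a + (b - a) * (real i / real (Suc N))" for i
  have g: "a \<le> g i" "g i < g (Suc i)" for i
    using \<open>a < b\<close> by (auto simp: g_def divide_strict_right_mono)
  have g_le: "g i \<le> b" if "i \<le> Suc N" for i
  proof -
    have "real i / real (Suc N) \<le> 1" using that by (simp add: divide_le_eq)
    then have "(b - a) * (real i / real (Suc N)) \<le> (b - a) * 1" using \<open>a < b\<close> by (intro mult_left_mono) auto
    then show ?thesis by (simp add: g_def)
  qed
  have "\<exists>z\<in>S (g i). val z \<ge> val z0 + real i * \<epsilon>" if "i \<le> Suc N" for i
    using that
  proof (induction i)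
    case 0 then show ?case using assms(2) by (auto simp: g_def)
  next
    case (Suc i)
    then obtain z where z: "z \<in> S (g i)" "val z \<ge> val z0 + real i * \<epsilon>" by auto
    then obtain z' where "z' \<in> S (g (Suc i))" "val z' > val z + \<epsilon>"
      using *[OF g(1) g(2) g_le[OF Suc.prems]] by blast
    then show ?case using z(2) by (intro bexI[of _ z']) (auto simp: algebra_simps)
  qed
  from this[of N] obtain z where z: "z \<in> S (g N)" "val z \<ge> val z0 + real N * \<epsilon>" by auto
  then have "z \<in> S b" using assms(3)[OF g(1)[of N] g_le[of N]] by auto
  then show False using bd[of z] z(2) N by linarith
qed

text \<open>The single parameter \<open>lam\<close> relaxes all constraints at once (the set, the distance and the tolerance for increments),
  so one near-maximality argument in \<open>lam\<close> creates slack in each of them.\<close>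
definition competes where
  "competes f T \<sigma> x e v l \<delta> lam x' e' v' \<longleftrightarrow> x' \<in> T lam \<and> norm e' = 1 \<and> has_dir_deriv f x' e' v' \<and>
     v + l \<bullet> e \<le> v' + l \<bullet> e' \<and> norm (x' - x) \<le> lam * \<delta> \<and>
     (\<forall>t. \<bar>incr f x' e t - incr f x e t\<bar> \<le> lam * \<sigma> * \<bar>t\<bar>)"

lemma competes_mono:
  assumes "competes f T \<sigma> x e v l \<delta> lam x' e' v'" "lam \<le> lam'" "T lam \<subseteq> T lam'" "\<sigma> \<ge> 0" "\<delta> \<ge> 0"
  shows "competes f T \<sigma> x e v l \<delta> lam' x' e' v'"
proof -
  have "lam * \<delta> \<le> lam' * \<delta>" "\<And>t. lam * \<sigma> * \<bar>t\<bar> \<le> lam' * \<sigma> * \<bar>t\<bar>"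
    using assms(2,4,5) by (auto intro!: mult_right_mono)
  then show ?thesis using assms(1,3) unfolding competes_def by (meson order_trans subsetD)
qed

text \<open>Increments transfer through an intermediate point \<open>y\<close> without adding up the tolerances: at small scales
  every increment is almost linear, and at large scales moving the base point a little is harmless.\<close>
lemma increments_transfer:
  fixes f :: "'a::real_normed_vector \<Rightarrow> real"
  assumes lip: "L-lipschitz_on UNIV f"
    and x: "has_dir_deriv f x e v" and y: "has_dir_deriv f y d w"
    and close: "L * norm (d - e) + \<bar>w - v\<bar> \<le> \<sigma> / 8"
    and tol: "\<And>t. \<bar>incr f y e t - incr f x e t\<bar> \<le> a * \<sigma> * \<bar>t\<bar>"
    and ab: "1/2 \<le> a" "a < b" and \<sigma>: "\<sigma> > 0"
  shows "\<exists>\<delta>>0. \<forall>x'. norm (x' - y) \<le> \<delta> \<longrightarrow> (\<forall>t. \<bar>incr f x' d t - incr f y d t\<bar> \<le> \<sigma> / 4 * \<bar>t\<bar>) \<longrightarrow>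
    (\<forall>t. \<bar>incr f x' e t - incr f x e t\<bar> \<le> b * \<sigma> * \<bar>t\<bar>)"
proof -
  have L: "L \<ge> 0" using lipschitz_on_nonneg[OF lip] .
  have "\<sigma> / 32 > 0" using \<sigma> by simp
  obtain \<rho>1 where \<rho>1: "\<rho>1 > 0" "\<And>t. \<bar>t\<bar> < \<rho>1 \<Longrightarrow> \<bar>incr f x e t - v * t\<bar> \<le> \<sigma> / 32 * \<bar>t\<bar>"
    using has_dir_derivD[OF x \<open>\<sigma> / 32 > 0\<close>] by metis
  obtain \<rho>2 where \<rho>2: "\<rho>2 > 0" "\<And>t. \<bar>t\<bar> < \<rho>2 \<Longrightarrow> \<bar>incr f y d t - w * t\<bar> \<le> \<sigma> / 32 * \<bar>t\<bar>"
    using has_dir_derivD[OF y \<open>\<sigma> / 32 > 0\<close>] by metis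
  define \<rho> where "\<rho> = min \<rho>1 \<rho>2"
  have \<rho>: "\<rho> > 0" using \<rho>1(1) \<rho>2(1) by (simp add: \<rho>_def)
  \<comment> \<open>At scales |t| \<ge> \<rho>, moving the base from \<open>y\<close> to
    \<open>x'\<close> then costs no more than the slack (b - a) \<sigma> |t|.\<close>
  define \<delta> where "\<delta> = (b - a) * \<sigma> * \<rho> / (2 * (L + 1))"
  have \<delta>: "\<delta> > 0" using ab \<sigma> \<rho> L by (simp add: \<delta>_def)
  show ?thesis
  proof (intro exI[of _ \<delta>] conjI allI impI)
    fix x' t assume x': "norm (x' - y) \<le> \<delta>" and "\<forall>t. \<bar>incr f x' d t - incr f y d t\<bar> \<le> \<sigma> / 4 * \<bar>t\<bar>"
    then have tol': "\<bar>incr f x' d t - incr f y d t\<bar> \<le> \<sigma> / 4 * \<bar>t\<bar>" for t by blast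
    show "\<bar>incr f x' e t - incr f x e t\<bar> \<le> b * \<sigma> * \<bar>t\<bar>"
    proof (cases "\<bar>t\<bar> < \<rho>")
      case True
      \<comment> \<open>Budget at small scales: \<sigma>/8 for the change of direction and
        derivative, \<sigma>/4 for passing from \<open>x'\<close> to \<open>y\<close>, and twice
        \<sigma>/32 for linearity. The sum 7 \<sigma>/16 is below b \<sigma> because b exceeds
        1/2.\<close>
      have "\<bar>incr f x' e t - incr f x' d t\<bar> \<le> L * norm (d - e) * \<bar>t\<bar>"
        using incr_direction_bound[OF lip, of x' e t d] by (simp add: norm_minus_commute)
      moreover have "\<bar>incr f x' d t - incr f y d t\<bar> \<le> \<sigma> / 4 * \<bar>t\<bar>" by (rule tol')
      moreover have "\<bar>incr f y d t - w * t\<bar> \<le> \<sigma> / 32 * \<bar>t\<bar>" using True by (intro \<rho>2(2)) (simp add: \<rho>_def)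
      moreover have "\<bar>incr f x e t - v * t\<bar> \<le> \<sigma> / 32 * \<bar>t\<bar>" using True by (intro \<rho>1(2)) (simp add: \<rho>_def)
      moreover have "\<bar>w * t - v * t\<bar> = \<bar>w - v\<bar> * \<bar>t\<bar>" by (simp add: abs_mult flip: left_diff_distrib)
      moreover have "(L * norm (d - e) + \<bar>w - v\<bar>) * \<bar>t\<bar> \<le> \<sigma> / 8 * \<bar>t\<bar>" by (rule mult_right_mono[OF close]) simp
      moreover have "1/2 * \<sigma> * \<bar>t\<bar> \<le> b * \<sigma> * \<bar>t\<bar>" using ab \<sigma> by (intro mult_right_mono) auto
      moreover have "0 \<le> \<sigma> * \<bar>t\<bar>" using \<sigma> by simp
      ultimately show ?thesis unfolding distrib_right by linarith
    next
      case False
      have "\<bar>incr f x' e t - incr f y e t\<bar> \<le> 2 * L * norm (x' - y)" by (rule incr_base_bound[OF lip])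
      also have "\<dots> \<le> 2 * (L + 1) * \<delta>" using x' L by (intro mult_mono) auto
      also have "\<dots> = (b - a) * \<sigma> * \<rho>" using L by (simp add: \<delta>_def)
      also have "\<dots> \<le> (b - a) * \<sigma> * \<bar>t\<bar>" using False ab \<sigma> by (intro mult_left_mono) auto
      finally show ?thesis using tol[of t] by (simp add: algebra_simps)
    qed
  qed (rule \<delta>)
qed

section \<open>Almost locally maximal directional derivatives\<close>

text \<open>Tolerances and precisions: \<open>\<epsilon>seq n\<close> is small compared with both \<open>\<sigma>seq L (n + 1)\<close> (summably so) and
  the square of \<open>\<sigma>seq L n\<close> (needed for the convergence of the directions).\<close>
definition \<sigma>seq :: "real \<Rightarrow> nat \<Rightarrow> real" where "\<sigma>seq L n = 32 * (L + 1) / 4 ^ n"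
definition \<epsilon>seq :: "nat \<Rightarrow> real" where "\<epsilon>seq n = 1 / (64 * 32 ^ n)"

lemma \<epsilon>seq_pos: "\<epsilon>seq n > 0"
  by (simp add: \<epsilon>seq_def)

lemma \<epsilon>seq_le: "\<epsilon>seq n \<le> 1 / 64 / 4 ^ n"
proof -
  have "(4::real) ^ n \<le> 32 ^ n" by (rule power_mono) auto
  then show ?thesis by (simp add: \<epsilon>seq_def frac_le)
qed

lemma \<sigma>seq_pos: "L \<ge> 0 \<Longrightarrow> \<sigma>seq L n > 0"
  by (simp add: \<sigma>seq_def)

lemma \<sigma>seq_Suc: "\<sigma>seq L (Suc n) = \<sigma>seq L n / 4"
  by (simp add: \<sigma>seq_def)

section \<open>Candidates: tilting, nesting and passage to the limit\<close>

lemma unit_vector_distance: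
  fixes e d :: "'a::real_inner"
  assumes "norm e = 1" "norm d = 1" "1 - e \<bullet> d \<le> c\<^sup>2 / 2" "c \<ge> 0"
  shows "norm (d - e) \<le> c"
proof -
  have "e \<bullet> e = 1" "d \<bullet> d = 1" using assms(1,2) by (simp_all add: dot_square_norm)
  then have "(norm (d - e))\<^sup>2 = 2 * (1 - e \<bullet> d)"
    by (simp add: power2_norm_eq_inner inner_diff inner_commute)
  then have "(norm (d - e))\<^sup>2 \<le> c\<^sup>2" using assms(3) by simp
  then show ?thesis using assms(4) by (rule power2_le_imp_le)
qed

text \<open>Tilting by a multiple of the current direction \<open>e'\<close> forces the directions of all later candidates to be close to \<open>e'\<close>.\<close>
lemma tilted_candidates_close:
  fixes l :: "'a::real_inner"
  assumes L: "L \<ge> 0" and l: "norm l \<le> 1" "norm (l + (1 / 2 ^ (n + 2)) *\<^sub>R e') \<le> 1"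
    and e: "norm e' = 1" "norm e'' = 1"
    and up: "v'' + l \<bullet> e'' \<le> v' + l \<bullet> e' + \<epsilon>seq n"
    and low: "v' + (l + (1 / 2 ^ (n + 2)) *\<^sub>R e') \<bullet> e' \<le> v'' + (l + (1 / 2 ^ (n + 2)) *\<^sub>R e') \<bullet> e''"
  shows "(L + 1) * norm (e'' - e') + \<bar>v'' - v'\<bar> \<le> \<sigma>seq L (Suc n) / 8"
proof -
  define t :: real where "t = 1 / 2 ^ (n + 2)"
  have t: "t > 0" by (simp add: t_def)
  have ee: "e' \<bullet> e' = 1" using e by (simp add: dot_square_norm)
  \<comment> \<open>In the sum of the two inequalities the terms in v and l cancel, and only the
    tilt remains.\<close>
  have "t * (1 - e' \<bullet> e'') \<le> \<epsilon>seq n"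
    using up low ee unfolding t_def[symmetric] inner_add_left inner_scaleR_left right_diff_distrib by simp
  then have "1 - e' \<bullet> e'' \<le> \<epsilon>seq n / t" using t by (simp add: pos_le_divide_eq mult.commute)
  also have "\<epsilon>seq n / t = 2 ^ n / (16 * 32 ^ n)" by (simp add: t_def \<epsilon>seq_def)
  \<comment> \<open>Origin of the rate 32 in \<open>\<epsilon>seq\<close>: division by a tilt of
    size 2^-(n+2) leaves 16^-n, the square of the rate 4^-n of \<open>\<sigma>seq\<close>, as
    \<open>unit_vector_distance\<close> requires.\<close>
  also have "\<dots> = 1 / (16 * 16 ^ n)"
  proof -
    have "(32::real) ^ n = 2 ^ n * 16 ^ n" by (simp flip: power_mult_distrib)
    then show ?thesis by simp
  qed
  also have "\<dots> \<le> (3 / 8 / 4 ^ n)\<^sup>2 / 2"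
  proof -
    have "(16::real) ^ n = (4 ^ n)\<^sup>2" by (simp add: power2_eq_square flip: power_mult_distrib)
    then show ?thesis by (simp add: power2_eq_square field_simps)
  qed
  finally have n1: "norm (e'' - e') \<le> 3 / 8 / 4 ^ n"
    using unit_vector_distance[OF e] by simp
  have "\<bar>l \<bullet> (e'' - e')\<bar> \<le> 1 * norm (e'' - e')"
    by (rule order_trans[OF Cauchy_Schwarz_ineq2 mult_right_mono[OF l(1)]]) simp
  moreover have "\<bar>(l + t *\<^sub>R e') \<bullet> (e'' - e')\<bar> \<le> 1 * norm (e'' - e')"
    by (rule order_trans[OF Cauchy_Schwarz_ineq2 mult_right_mono[OF l(2)[folded t_def]]]) simp
  ultimately have "\<bar>v'' - v'\<bar> \<le> norm (e'' - e') + \<epsilon>seq n"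
    using up low \<epsilon>seq_pos[of n] unfolding t_def[symmetric] inner_diff_right by linarith
  then have "(L + 1) * norm (e'' - e') + \<bar>v'' - v'\<bar> \<le> (L + 2) * norm (e'' - e') + \<epsilon>seq n"
    by (simp add: algebra_simps)
  also have "\<dots> \<le> (L + 2) * (3 / 8 / 4 ^ n) + 1 / 64 / 4 ^ n"
    using L n1 \<epsilon>seq_le[of n] by (intro add_mono mult_left_mono) auto
  also have "\<dots> \<le> (L + 1) / 4 ^ n" using L by (simp add: field_simps)
  also have "\<dots> = \<sigma>seq L (Suc n) / 8" by (simp add: \<sigma>seq_def field_simps)
  finally show ?thesis .
qed

text \<open>The next candidate is a near-maximizer among the competitors of the current one. The
  closeness hypothesis \<open>R\<close> is what makes increments transfer through it; the new tilt
  restores this hypothesis for the next stage, with a tolerance four times smaller.\<close>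

lemma candidate_step:
  fixes f :: "'a::real_inner \<Rightarrow> real" and l :: 'a
  assumes lip: "L-lipschitz_on UNIV f" and T: "mono_on {0..} T"
    and x: "norm e = 1" "has_dir_deriv f x e v" "x \<in> T \<alpha>"
    and ab: "1/2 \<le> \<alpha>" "\<alpha> < \<beta>" "\<beta> \<le> 1" and \<delta>: "\<delta> > 0" and l: "norm l \<le> 1/2 - 1 / 2 ^ (n + 1)"
    and R: "\<forall>x' e' v'. competes f T (\<sigma>seq L n) x e v l \<delta> \<beta> x' e' v' \<longrightarrow>
              (L + 1) * norm (e' - e) + \<bar>v' - v\<bar> \<le> \<sigma>seq L n / 8"
  obtains x' e' v' a b \<alpha>' \<beta>' \<delta>' where
    "norm e' = 1" "has_dir_deriv f x' e' v'" "x' \<in> T \<alpha>'" "1/2 \<le> \<alpha>'" "\<alpha>' < \<beta>'" "\<beta>' \<le> 1" "\<delta>' > 0" "\<delta>' \<le> \<delta> / 2"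
    "\<alpha> \<le> \<alpha>'" "\<beta>' < b" "b \<le> \<beta>" "\<beta>' \<le> \<beta>"
    "norm (l + (1 / 2 ^ (n + 2)) *\<^sub>R e') \<le> 1/2 - 1 / 2 ^ (n + 2)"
    "\<And>x'' e'' v''. competes f T (\<sigma>seq L (Suc n)) x' e' v' (l + (1 / 2 ^ (n + 2)) *\<^sub>R e') \<delta>' \<beta>' x'' e'' v'' \<Longrightarrow>
              (L + 1) * norm (e'' - e') + \<bar>v'' - v'\<bar> \<le> \<sigma>seq L (Suc n) / 8"
    "competes f T (\<sigma>seq L n) x e v l \<delta> \<alpha>' x' e' v'"
    "\<And>x'' e'' v''. competes f T (\<sigma>seq L n) x e v l \<delta> b x'' e'' v'' \<Longrightarrow> v'' + l \<bullet> e'' \<le> v' + l \<bullet> e' + \<epsilon>seq n"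
    "\<And>lam x'' e'' v''. \<alpha>' \<le> lam \<Longrightarrow> lam \<le> b \<Longrightarrow>
        competes f T (\<sigma>seq L (Suc n)) x' e' v' (l + (1 / 2 ^ (n + 2)) *\<^sub>R e') \<delta>' lam x'' e'' v'' \<Longrightarrow>
        competes f T (\<sigma>seq L n) x e v l \<delta> lam x'' e'' v''"
proof -
  have mono: "T l \<subseteq> T l'" if "0 \<le> l" "l \<le> l'" for l l'
    using mono_onD[OF T, of l l'] that by simp
  have L: "L \<ge> 0" using lipschitz_on_nonneg[OF lip] .
  define t :: real where "t = 1 / 2 ^ (n + 2)"
  have t: "t > 0" by (simp add: t_def)
  have t': "1 / 2 ^ (n + 1) = t + 1 / 2 ^ (n + 2)" by (simp add: t_def)
  define \<sigma> where "\<sigma> = \<sigma>seq L n"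
  have \<sigma>: "\<sigma> > 0" using \<sigma>seq_pos[OF L] by (simp add: \<sigma>_def)
  define C where "C lam = {(x',e',v'). competes f T \<sigma> x e v l \<delta> lam x' e' v'}" for lam
  have pow: "0 < (1::real) / 2 ^ m" for m by simp
  have l1: "norm l \<le> 1" using l pow[of "n + 1"] by linarith
  have "\<exists>a b. \<alpha> \<le> a \<and> a < b \<and> b \<le> \<beta> \<and> (\<exists>z\<in>C a. \<forall>z'\<in>C b. (\<lambda>(x',e',v'). v' + l \<bullet> e') z' \<le> (\<lambda>(x',e',v'). v' + l \<bullet> e') z + \<epsilon>seq n)"
  proof (rule monotone_family_near_maximum[OF ab(2)])
    have "0 \<le> \<alpha> * \<sigma> * \<bar>s\<bar>" for s using ab \<sigma> by (intro mult_nonneg_nonneg) auto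
    then show "(x, e, v) \<in> C \<alpha>" using x ab \<delta> by (simp add: C_def competes_def)
    show "C lam \<subseteq> C lam'" if "\<alpha> \<le> lam" "lam \<le> lam'" "lam' \<le> \<beta>" for lam lam'
    proof -
      have "T lam \<subseteq> T lam'" using that ab by (intro mono) auto
      then have "competes f T \<sigma> x e v l \<delta> lam' x' e' v'" if "competes f T \<sigma> x e v l \<delta> lam x' e' v'" for x' e' v'
        using competes_mono[OF that \<open>lam \<le> lam'\<close>] \<delta> \<sigma> by simp
      then show ?thesis unfolding C_def by blast
    qed
    show "(\<lambda>(x',e',v'). v' + l \<bullet> e') z \<le> L + 1" if "z \<in> C \<beta>" for z
    proof -
      obtain x' e' v' where z: "z = (x', e', v')" by (cases z)
      have e': "norm e' = 1" "has_dir_deriv f x' e' v'" using that by (auto simp: z C_def competes_def)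
      have "l \<bullet> e' \<le> norm l * norm e'" by (rule norm_cauchy_schwarz)
      then show ?thesis using has_dir_deriv_bound[OF lip e'(2)] e'(1) l1 by (simp add: z)
    qed
  qed (rule \<epsilon>seq_pos)
  then obtain a b x' e' v' where a: "\<alpha> \<le> a" "a < b" "b \<le> \<beta>"
    and z': "competes f T \<sigma> x e v l \<delta> a x' e' v'"
    and max: "\<And>x'' e'' v''. competes f T \<sigma> x e v l \<delta> b x'' e'' v'' \<Longrightarrow> v'' + l \<bullet> e'' \<le> v' + l \<bullet> e' + \<epsilon>seq n"
    by (auto simp: C_def)
  have e': "norm e' = 1" "has_dir_deriv f x' e' v'" "x' \<in> T a" "v + l \<bullet> e \<le> v' + l \<bullet> e'" "norm (x' - x) \<le> a * \<delta>"
    "\<And>t. \<bar>incr f x' e t - incr f x e t\<bar> \<le> a * \<sigma> * \<bar>t\<bar>"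
    using z' by (auto simp: competes_def)
  have ee: "e' \<bullet> e' = 1" using e'(1) by (simp add: dot_square_norm)
  \<comment> \<open>Splitting (a, b) into thirds leaves room below, to absorb the errors made in
    passing through \<open>x'\<close>, and room above, so that later levels stay strictly under
    b.\<close>
  define \<alpha>' where "\<alpha>' = a + (b - a) / 3"
  define \<beta>' where "\<beta>' = b - (b - a) / 3"
  have a': "a < \<alpha>'" "\<alpha>' < \<beta>'" "\<beta>' < b" using a(2) unfolding \<alpha>'_def \<beta>'_def by (simp_all add: field_simps)
  have z'\<beta>: "competes f T \<sigma> x e v l \<delta> \<beta> x' e' v'"
    by (rule competes_mono[OF z' _ mono]) (use a ab \<delta> \<sigma> in simp_all)
  have "L * norm (e' - e) + \<bar>v' - v\<bar> \<le> \<sigma> / 8"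
    using R[rule_format, OF z'\<beta>[unfolded \<sigma>_def]] norm_ge_zero[of "e' - e"] unfolding \<sigma>_def distrib_right by linarith
  moreover have "1/2 \<le> a" using a ab by simp
  ultimately have "\<exists>\<delta>1>0. \<forall>x''. norm (x'' - x') \<le> \<delta>1 \<longrightarrow> (\<forall>t. \<bar>incr f x'' e' t - incr f x' e' t\<bar> \<le> \<sigma> / 4 * \<bar>t\<bar>) \<longrightarrow>
      (\<forall>t. \<bar>incr f x'' e t - incr f x e t\<bar> \<le> \<alpha>' * \<sigma> * \<bar>t\<bar>)"
    by (rule increments_transfer[OF lip x(2) e'(2) _ e'(6) _ a'(1) \<sigma>])
  then obtain \<delta>1 where \<delta>1: "\<delta>1 > 0" "\<And>x'' t. norm (x'' - x') \<le> \<delta>1 \<Longrightarrow>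
      (\<And>t. \<bar>incr f x'' e' t - incr f x' e' t\<bar> \<le> \<sigma> / 4 * \<bar>t\<bar>) \<Longrightarrow> \<bar>incr f x'' e t - incr f x e t\<bar> \<le> \<alpha>' * \<sigma> * \<bar>t\<bar>"
    by blast
  \<comment> \<open>The three bounds serve the transfer of increments, the convergence of the
    candidates, and the inclusion of the new ball in the old one: a \<delta> + (\<alpha>' - a)
    \<delta> = \<alpha>' \<delta>.\<close>
  define \<delta>' where "\<delta>' = min \<delta>1 (min (\<delta> / 2) ((\<alpha>' - a) * \<delta>))"
  have \<delta>': "\<delta>' > 0" "\<delta>' \<le> \<delta>1" "\<delta>' \<le> \<delta> / 2" "\<delta>' \<le> (\<alpha>' - a) * \<delta>"
    using \<delta>1(1) \<delta> a' by (auto simp: \<delta>'_def)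
  define l' where "l' = l + t *\<^sub>R e'"
  have nl': "norm l' \<le> 1/2 - 1 / 2 ^ (n + 2)"
  proof -
    have "norm l' \<le> norm l + t" using norm_triangle_ineq[of l "t *\<^sub>R e'"] e'(1) t by (simp add: l'_def)
    then show ?thesis using l t' by linarith
  qed
  have nest: "competes f T \<sigma> x e v l \<delta> lam x'' e'' v''"
    if lam: "\<alpha>' \<le> lam" "lam \<le> b" and z'': "competes f T (\<sigma>seq L (Suc n)) x' e' v' l' \<delta>' lam x'' e'' v''" for lam x'' e'' v''
  proof -
    have lam1: "0 \<le> lam" "lam \<le> 1" using lam a a' ab by auto
    have z: "x'' \<in> T lam" "norm e'' = 1" "has_dir_deriv f x'' e'' v''" "v' + l' \<bullet> e' \<le> v'' + l' \<bullet> e''"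
      "norm (x'' - x') \<le> lam * \<delta>'" "\<And>t. \<bar>incr f x'' e' t - incr f x' e' t\<bar> \<le> lam * (\<sigma> / 4) * \<bar>t\<bar>"
      using z'' by (auto simp: competes_def \<sigma>seq_Suc \<sigma>_def)
    have lam\<delta>': "lam * \<delta>' \<le> \<delta>'" using lam1 \<delta>'(1) by (simp add: mult_left_le_one_le)
    show ?thesis
      unfolding competes_def
    proof (intro conjI allI)
      \<comment> \<open>No unit vector has a larger inner product with \<open>e'\<close> than
        \<open>e'\<close> itself, so removing the tilt keeps the inequality between the
        values.\<close>
      have "e' \<bullet> e'' \<le> 1" using norm_cauchy_schwarz[of e' e''] e'(1) z(2) by simp
      then have "t * (e' \<bullet> e'') \<le> t * 1" using t by (intro mult_left_mono) auto
      then show "v + l \<bullet> e \<le> v'' + l \<bullet> e''" using z(4) e'(4) ee by (simp add: l'_def inner_add_left)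
      have "norm (x'' - x) \<le> norm (x'' - x') + norm (x' - x)" using norm_triangle_ineq[of "x'' - x'" "x' - x"] by simp
      also have "\<dots> \<le> (\<alpha>' - a) * \<delta> + a * \<delta>" using z(5) e'(5) lam\<delta>' \<delta>'(4) by linarith
      also have "\<dots> = \<alpha>' * \<delta>" by (simp add: algebra_simps)
      also have "\<dots> \<le> lam * \<delta>" using lam \<delta> by (intro mult_right_mono) auto
      finally show "norm (x'' - x) \<le> lam * \<delta>" .
      fix u :: real
      have "\<bar>incr f x'' e u - incr f x e u\<bar> \<le> \<alpha>' * \<sigma> * \<bar>u\<bar>"
      proof (rule \<delta>1(2))
        show "norm (x'' - x') \<le> \<delta>1" using z(5) lam\<delta>' \<delta>'(2) by linarith
        fix s :: real
        have "lam * (\<sigma> / 4) \<le> 1 * (\<sigma> / 4)" using lam1 \<sigma> by (intro mult_right_mono) auto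
        then have "lam * (\<sigma> / 4) * \<bar>s\<bar> \<le> 1 * (\<sigma> / 4) * \<bar>s\<bar>" by (rule mult_right_mono) simp
        then show "\<bar>incr f x'' e' s - incr f x' e' s\<bar> \<le> \<sigma> / 4 * \<bar>s\<bar>" using z(6)[of s] by simp
      qed
      also have "\<dots> \<le> lam * \<sigma> * \<bar>u\<bar>" using lam \<sigma> by (intro mult_right_mono) auto
      finally show "\<bar>incr f x'' e u - incr f x e u\<bar> \<le> lam * \<sigma> * \<bar>u\<bar>" .
    qed (use z in auto)
  qed
  show ?thesis
  proof (rule that[of e' x' v' \<alpha>' \<beta>' \<delta>' b])
    show "x' \<in> T \<alpha>'" using e'(3) mono[of a \<alpha>'] a a' ab by auto
    show "norm (l + (1 / 2 ^ (n + 2)) *\<^sub>R e') \<le> 1/2 - 1 / 2 ^ (n + 2)" using nl' by (simp add: l'_def t_def)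
    show "competes f T (\<sigma>seq L n) x e v l \<delta> \<alpha>' x' e' v'"
      unfolding \<sigma>_def[symmetric] using a a' ab \<delta> \<sigma> by (intro competes_mono[OF z'] mono) simp_all
    show "competes f T (\<sigma>seq L n) x e v l \<delta> lam x'' e'' v''"
      if "\<alpha>' \<le> lam" "lam \<le> b" "competes f T (\<sigma>seq L (Suc n)) x' e' v' (l + (1 / 2 ^ (n + 2)) *\<^sub>R e') \<delta>' lam x'' e'' v''" for lam x'' e'' v''
      using nest[OF that(1,2)] that(3) by (simp add: l'_def t_def \<sigma>_def)
    show "v'' + l \<bullet> e'' \<le> v' + l \<bullet> e' + \<epsilon>seq n" if "competes f T (\<sigma>seq L n) x e v l \<delta> b x'' e'' v''" for x'' e'' v''
      using max that by (simp add: \<sigma>_def)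
    show "(L + 1) * norm (e'' - e') + \<bar>v'' - v'\<bar> \<le> \<sigma>seq L (Suc n) / 8"
      if z'': "competes f T (\<sigma>seq L (Suc n)) x' e' v' (l + (1 / 2 ^ (n + 2)) *\<^sub>R e') \<delta>' \<beta>' x'' e'' v''" for x'' e'' v''
    proof (rule tilted_candidates_close[OF L l1 _ e'(1)])
      have "competes f T \<sigma> x e v l \<delta> \<beta>' x'' e'' v''"
        using nest[of \<beta>' x'' e'' v''] a' z'' by (simp add: l'_def t_def)
      then have "competes f T \<sigma> x e v l \<delta> b x'' e'' v''"
        using a a' ab \<delta> \<sigma> by (elim competes_mono) (simp_all add: mono)
      then show "v'' + l \<bullet> e'' \<le> v' + l \<bullet> e' + \<epsilon>seq n" by (rule max)
      show "norm (l + (1 / 2 ^ (n + 2)) *\<^sub>R e') \<le> 1"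
        using nl' pow[of "n + 2"] unfolding l'_def t_def by linarith
    qed (use z'' in \<open>auto simp: competes_def\<close>)
  qed (use e' a a' ab \<delta>' in auto)
qed

text \<open>Dependent choice over the state of a stage. The intermediate level \<open>b n\<close>
  links two consecutive stages, so it belongs to the relation between states and is extracted by
  choice at the end.\<close>

lemma candidate_sequence:
  fixes f :: "'a::real_inner \<Rightarrow> real"
  assumes lip: "L-lipschitz_on UNIV f" and T: "mono_on {0..} T"
    and x0: "x0 \<in> T (1/2)" "norm e0 = 1" "has_dir_deriv f x0 e0 v0" and \<delta>0: "\<delta>0 > 0"
  obtains X E V l \<alpha> \<beta> \<delta> b where
    "X 0 = x0" "\<delta> 0 = \<delta>0"
    "\<And>n. norm (E n) = 1" "\<And>n. has_dir_deriv f (X n) (E n) (V n)" "\<And>n. X n \<in> T (\<alpha> n)"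
    "\<And>n. 1/2 \<le> \<alpha> n" "\<And>n. \<alpha> n < \<beta> n" "\<And>n. \<beta> n \<le> 1" "\<And>n. \<delta> n > 0" "\<And>n. norm (l n) \<le> 1/2"
    "\<And>n x' e' v'. competes f T (\<sigma>seq L n) (X n) (E n) (V n) (l n) (\<delta> n) (\<beta> n) x' e' v' \<Longrightarrow>
        (L + 1) * norm (e' - E n) + \<bar>v' - V n\<bar> \<le> \<sigma>seq L n / 8"
    "\<And>n. \<delta> (Suc n) \<le> \<delta> n / 2" "\<And>n. \<alpha> n \<le> \<alpha> (Suc n)" "\<And>n. \<beta> (Suc n) < b n" "\<And>n. b n \<le> 1" "\<And>n. \<beta> (Suc n) \<le> \<beta> n"
    "\<And>n. l (Suc n) = l n + (1 / 2 ^ (n + 2)) *\<^sub>R E (Suc n)"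
    "\<And>n. V n + l n \<bullet> E n \<le> V (Suc n) + l n \<bullet> E (Suc n)"
    "\<And>n x' e' v'. competes f T (\<sigma>seq L n) (X n) (E n) (V n) (l n) (\<delta> n) (b n) x' e' v' \<Longrightarrow>
        v' + l n \<bullet> e' \<le> V (Suc n) + l n \<bullet> E (Suc n) + \<epsilon>seq n"
    "\<And>n lam x' e' v'. \<alpha> (Suc n) \<le> lam \<Longrightarrow> lam \<le> b n \<Longrightarrow>
        competes f T (\<sigma>seq L (Suc n)) (X (Suc n)) (E (Suc n)) (V (Suc n)) (l (Suc n)) (\<delta> (Suc n)) lam x' e' v' \<Longrightarrow>
        competes f T (\<sigma>seq L n) (X n) (E n) (V n) (l n) (\<delta> n) lam x' e' v'"
proof -
  have L: "L \<ge> 0" using lipschitz_on_nonneg[OF lip] .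
  define P where "P = (\<lambda>n (x,e,v,l,\<alpha>,\<beta>,\<delta>).
    norm e = 1 \<and> has_dir_deriv f x e v \<and> x \<in> T \<alpha> \<and> 1/2 \<le> \<alpha> \<and> \<alpha> < \<beta> \<and> \<beta> \<le> 1 \<and> \<delta> > 0 \<and>
    norm l \<le> 1/2 - 1 / 2 ^ (n + 1) \<and>
    (\<forall>x' e' v'. competes f T (\<sigma>seq L n) x e v l \<delta> \<beta> x' e' v' \<longrightarrow>
      (L + 1) * norm (e' - e) + \<bar>v' - v\<bar> \<le> \<sigma>seq L n / 8) \<and> (n = 0 \<longrightarrow> x = x0 \<and> \<delta> = \<delta>0))"
  define Q where "Q = (\<lambda>n (x,e,v,l,\<alpha>,\<beta>::real,\<delta>::real) (x',e',v',l',\<alpha>',\<beta>',\<delta>'). \<exists>b.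
    \<delta>' \<le> \<delta> / 2 \<and> \<alpha> \<le> \<alpha>' \<and> \<beta>' < b \<and> b \<le> \<beta> \<and> \<beta>' \<le> \<beta> \<and> l' = l + (1 / 2 ^ (n + 2)) *\<^sub>R e' \<and>
    v + l \<bullet> e \<le> v' + l \<bullet> e' \<and>
    (\<forall>x'' e'' v''. competes f T (\<sigma>seq L n) x e v l \<delta> b x'' e'' v'' \<longrightarrow> v'' + l \<bullet> e'' \<le> v' + l \<bullet> e' + \<epsilon>seq n) \<and>
    (\<forall>lam x'' e'' v''. \<alpha>' \<le> lam \<longrightarrow> lam \<le> b \<longrightarrow>
        competes f T (\<sigma>seq L (Suc n)) x' e' v' l' \<delta>' lam x'' e'' v'' \<longrightarrow>
        competes f T (\<sigma>seq L n) x e v l \<delta> lam x'' e'' v''))"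
  have "\<exists>s. \<forall>n. P n (s n) \<and> Q n (s n) (s (Suc n))"
  proof (rule dependent_nat_choice)
    \<comment> \<open>\<open>\<sigma>seq L 0\<close> is so large that closeness is automatic at the
      start: unit vectors differ by at most 2 and directional derivatives by at most 2 L.\<close>
    have "(L + 1) * norm (e' - e0) + \<bar>v' - v0\<bar> \<le> \<sigma>seq L 0 / 8"
      if "competes f T (\<sigma>seq L 0) x0 e0 v0 0 \<delta>0 1 x' e' v'" for x' e' v'
    proof -
      have e': "norm e' = 1" "has_dir_deriv f x' e' v'" using that by (auto simp: competes_def)
      have "norm (e' - e0) \<le> 2" using norm_triangle_ineq4[of e' e0] e' x0 by simp
      then have "(L + 1) * norm (e' - e0) \<le> (L + 1) * 2" using L by (intro mult_left_mono) auto
      moreover have "\<bar>v'\<bar> \<le> L" "\<bar>v0\<bar> \<le> L"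
        using has_dir_deriv_bound[OF lip] e' x0 by fastforce+
      moreover have "\<sigma>seq L 0 / 8 = 4 * L + 4" by (simp add: \<sigma>seq_def)
      ultimately show ?thesis using L by argo
    qed
    then have "P 0 (x0, e0, v0, 0, 1/2, 1, \<delta>0)" unfolding P_def prod.case using x0 \<delta>0 by auto
    then show "\<exists>s. P 0 s" by blast
  next
    fix s n assume "P n s"
    moreover obtain x e v l \<alpha> \<beta> \<delta> where s: "s = (x,e,v,l,\<alpha>,\<beta>,\<delta>)" by (metis prod_cases7)
    ultimately have p: "norm e = 1" "has_dir_deriv f x e v" "x \<in> T \<alpha>" "1/2 \<le> \<alpha>" "\<alpha> < \<beta>" "\<beta> \<le> 1" "\<delta> > 0"
      "norm l \<le> 1/2 - 1 / 2 ^ (n + 1)"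
      "\<forall>x' e' v'. competes f T (\<sigma>seq L n) x e v l \<delta> \<beta> x' e' v' \<longrightarrow> (L + 1) * norm (e' - e) + \<bar>v' - v\<bar> \<le> \<sigma>seq L n / 8"
      unfolding P_def by auto
    show "\<exists>s'. P (Suc n) s' \<and> Q n s s'"
    proof (rule candidate_step[OF lip T p])
      fix x' e' v' a b \<alpha>' \<beta>' \<delta>'
      assume c: "norm e' = 1" "has_dir_deriv f x' e' v'" "x' \<in> T \<alpha>'" "1/2 \<le> \<alpha>'" "\<alpha>' < \<beta>'" "\<beta>' \<le> 1" "\<delta>' > 0" "\<delta>' \<le> \<delta> / 2"
        "\<alpha> \<le> \<alpha>'" "\<beta>' < b" "b \<le> \<beta>" "\<beta>' \<le> \<beta>"
        "norm (l + (1 / 2 ^ (n + 2)) *\<^sub>R e') \<le> 1/2 - 1 / 2 ^ (n + 2)"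
      assume R': "\<And>x'' e'' v''. competes f T (\<sigma>seq L (Suc n)) x' e' v' (l + (1 / 2 ^ (n + 2)) *\<^sub>R e') \<delta>' \<beta>' x'' e'' v'' \<Longrightarrow>
              (L + 1) * norm (e'' - e') + \<bar>v'' - v'\<bar> \<le> \<sigma>seq L (Suc n) / 8"
      assume c': "competes f T (\<sigma>seq L n) x e v l \<delta> \<alpha>' x' e' v'"
      assume m: "\<And>x'' e'' v''. competes f T (\<sigma>seq L n) x e v l \<delta> b x'' e'' v'' \<Longrightarrow> v'' + l \<bullet> e'' \<le> v' + l \<bullet> e' + \<epsilon>seq n"
      assume nest: "\<And>lam x'' e'' v''. \<alpha>' \<le> lam \<Longrightarrow> lam \<le> b \<Longrightarrow>
        competes f T (\<sigma>seq L (Suc n)) x' e' v' (l + (1 / 2 ^ (n + 2)) *\<^sub>R e') \<delta>' lam x'' e'' v'' \<Longrightarrow>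
        competes f T (\<sigma>seq L n) x e v l \<delta> lam x'' e'' v''"
      define l' where "l' = l + (1 / 2 ^ (n + 2)) *\<^sub>R e'"
      have "P (Suc n) (x', e', v', l', \<alpha>', \<beta>', \<delta>')"
        unfolding P_def prod.case using c R' unfolding l'_def[symmetric] by simp
      moreover have "Q n s (x', e', v', l', \<alpha>', \<beta>', \<delta>')"
        unfolding Q_def s prod.case
      proof (intro exI[of _ b] conjI allI impI)
        show "v + l \<bullet> e \<le> v' + l \<bullet> e'" using c' by (simp add: competes_def)
      qed (use c m nest in \<open>simp_all add: l'_def\<close>)
      ultimately show ?thesis by blast
    qed
  qed
  then obtain s where s: "\<And>n. P n (s n)" "\<And>n. Q n (s n) (s (Suc n))" by blast
  define X where "X n = fst (s n)" for n
  define E where "E n = fst (snd (s n))" for n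
  define V where "V n = fst (snd (snd (s n)))" for n
  define l where "l n = fst (snd (snd (snd (s n))))" for n
  define \<alpha> where "\<alpha> n = fst (snd (snd (snd (snd (s n)))))" for n
  define \<beta> where "\<beta> n = fst (snd (snd (snd (snd (snd (s n))))))" for n
  define \<delta> where "\<delta> n = snd (snd (snd (snd (snd (snd (s n))))))" for n
  have sn: "s n = (X n, E n, V n, l n, \<alpha> n, \<beta> n, \<delta> n)" for n
    by (simp add: X_def E_def V_def l_def \<alpha>_def \<beta>_def \<delta>_def)
  have P: "norm (E n) = 1 \<and> has_dir_deriv f (X n) (E n) (V n) \<and> X n \<in> T (\<alpha> n) \<and> 1/2 \<le> \<alpha> n \<and> \<alpha> n < \<beta> n \<and> \<beta> n \<le> 1 \<and> \<delta> n > 0 \<and>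
    norm (l n) \<le> 1/2 - 1 / 2 ^ (n + 1) \<and>
    (\<forall>x' e' v'. competes f T (\<sigma>seq L n) (X n) (E n) (V n) (l n) (\<delta> n) (\<beta> n) x' e' v' \<longrightarrow>
      (L + 1) * norm (e' - E n) + \<bar>v' - V n\<bar> \<le> \<sigma>seq L n / 8) \<and> (n = 0 \<longrightarrow> X n = x0 \<and> \<delta> n = \<delta>0)" for n
    using s(1)[of n] unfolding P_def sn prod.case .
  have "\<forall>n. \<exists>b. \<delta> (Suc n) \<le> \<delta> n / 2 \<and> \<alpha> n \<le> \<alpha> (Suc n) \<and> \<beta> (Suc n) < b \<and> b \<le> \<beta> n \<and> \<beta> (Suc n) \<le> \<beta> n \<and>
    l (Suc n) = l n + (1 / 2 ^ (n + 2)) *\<^sub>R E (Suc n) \<and>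
    V n + l n \<bullet> E n \<le> V (Suc n) + l n \<bullet> E (Suc n) \<and>
    (\<forall>x'' e'' v''. competes f T (\<sigma>seq L n) (X n) (E n) (V n) (l n) (\<delta> n) b x'' e'' v'' \<longrightarrow>
      v'' + l n \<bullet> e'' \<le> V (Suc n) + l n \<bullet> E (Suc n) + \<epsilon>seq n) \<and>
    (\<forall>lam x'' e'' v''. \<alpha> (Suc n) \<le> lam \<longrightarrow> lam \<le> b \<longrightarrow>
        competes f T (\<sigma>seq L (Suc n)) (X (Suc n)) (E (Suc n)) (V (Suc n)) (l (Suc n)) (\<delta> (Suc n)) lam x'' e'' v'' \<longrightarrow>
        competes f T (\<sigma>seq L n) (X n) (E n) (V n) (l n) (\<delta> n) lam x'' e'' v'')"
    using s(2) unfolding Q_def sn prod.case by blast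
  from choice[OF this] obtain b where Q: "\<And>n. \<delta> (Suc n) \<le> \<delta> n / 2 \<and> \<alpha> n \<le> \<alpha> (Suc n) \<and> \<beta> (Suc n) < b n \<and> b n \<le> \<beta> n \<and> \<beta> (Suc n) \<le> \<beta> n \<and>
    l (Suc n) = l n + (1 / 2 ^ (n + 2)) *\<^sub>R E (Suc n) \<and>
    V n + l n \<bullet> E n \<le> V (Suc n) + l n \<bullet> E (Suc n) \<and>
    (\<forall>x'' e'' v''. competes f T (\<sigma>seq L n) (X n) (E n) (V n) (l n) (\<delta> n) (b n) x'' e'' v'' \<longrightarrow>
      v'' + l n \<bullet> e'' \<le> V (Suc n) + l n \<bullet> E (Suc n) + \<epsilon>seq n) \<and>
    (\<forall>lam x'' e'' v''. \<alpha> (Suc n) \<le> lam \<longrightarrow> lam \<le> b n \<longrightarrow>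
        competes f T (\<sigma>seq L (Suc n)) (X (Suc n)) (E (Suc n)) (V (Suc n)) (l (Suc n)) (\<delta> (Suc n)) lam x'' e'' v'' \<longrightarrow>
        competes f T (\<sigma>seq L n) (X n) (E n) (V n) (l n) (\<delta> n) lam x'' e'' v'')" by blast
  show ?thesis
  proof (rule that[of X \<delta> E V \<alpha> \<beta> l b])
    show "norm (l n) \<le> 1/2" for n
    proof -
      have "(0::real) < 1 / 2 ^ (n + 1)" by simp
      then show ?thesis using P[of n] by linarith
    qed
    show "b n \<le> 1" for n using P[of n] Q[of n] by linarith
    fix n
    show "X 0 = x0" "\<delta> 0 = \<delta>0" using P[of 0] by simp_all
    show "norm (E n) = 1" "has_dir_deriv f (X n) (E n) (V n)" "X n \<in> T (\<alpha> n)" "1/2 \<le> \<alpha> n" "\<alpha> n < \<beta> n" "\<beta> n \<le> 1" "\<delta> n > 0"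
      using P[of n] by blast+
    show "\<delta> (Suc n) \<le> \<delta> n / 2" "\<alpha> n \<le> \<alpha> (Suc n)" "\<beta> (Suc n) < b n" "\<beta> (Suc n) \<le> \<beta> n"
      "l (Suc n) = l n + (1 / 2 ^ (n + 2)) *\<^sub>R E (Suc n)" "V n + l n \<bullet> E n \<le> V (Suc n) + l n \<bullet> E (Suc n)"
      using Q[of n] by blast+
    show "(L + 1) * norm (e' - E n) + \<bar>v' - V n\<bar> \<le> \<sigma>seq L n / 8"
      if "competes f T (\<sigma>seq L n) (X n) (E n) (V n) (l n) (\<delta> n) (\<beta> n) x' e' v'" for x' e' v'
      using P[of n] that by blast
    show "v' + l n \<bullet> e' \<le> V (Suc n) + l n \<bullet> E (Suc n) + \<epsilon>seq n"
      if "competes f T (\<sigma>seq L n) (X n) (E n) (V n) (l n) (\<delta> n) (b n) x' e' v'" for x' e' v'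
      using Q[of n] that by blast
    show "competes f T (\<sigma>seq L n) (X n) (E n) (V n) (l n) (\<delta> n) lam x' e' v'"
      if "\<alpha> (Suc n) \<le> lam" "lam \<le> b n"
        "competes f T (\<sigma>seq L (Suc n)) (X (Suc n)) (E (Suc n)) (V (Suc n)) (l (Suc n)) (\<delta> (Suc n)) lam x' e' v'" for lam x' e' v'
      using Q[of n] that by blast
  qed
qed

text \<open>The limit of the candidates. That every k comes with a level \<open>b\<close> strictly
  above \<open>lam\<close> is essential, since wedges near \<open>x\<close> can be had only in sets
  of level above \<open>lam\<close>.\<close>

lemma near_maximal_direction:
  fixes f :: "'a::euclidean_space \<Rightarrow> real" and T :: "real \<Rightarrow> 'a set"
  assumes lip: "L-lipschitz_on UNIV f" and closed: "\<And>l. closed (T l)"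
    and T: "mono_on {0..} T"
    and x0: "x0 \<in> T (1/2)" "norm e0 = 1" "has_dir_deriv f x0 e0 v0" and \<delta>0: "\<delta>0 > 0"
  obtains x e v l lam where "1/2 \<le> lam" "x \<in> T lam" "norm e = 1" "has_dir_deriv f x e v" "norm (x - x0) \<le> \<delta>0"
    "norm l \<le> 1"
    "\<And>k. \<exists>b>lam. b \<le> 1 \<and> (\<exists>\<delta>>0. \<forall>x' e' v'. x' \<in> T b \<longrightarrow> norm e' = 1 \<longrightarrow> has_dir_deriv f x' e' v' \<longrightarrow>
       norm (x' - x) \<le> \<delta> \<longrightarrow> (\<forall>t. \<bar>incr f x' e t - incr f x e t\<bar> \<le> \<sigma>seq L k / 4 * \<bar>t\<bar>) \<longrightarrow>
       v' + l \<bullet> e' \<le> v + l \<bullet> e + \<epsilon>seq k)"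
proof -
  have mono: "T l \<subseteq> T l'" if "0 \<le> l" "l \<le> l'" for l l'
    using mono_onD[OF T, of l l'] that by simp
  have L: "L \<ge> 0" using lipschitz_on_nonneg[OF lip] .
  obtain X \<delta> E V \<alpha> \<beta> l b where
    init: "X 0 = x0" "\<delta> 0 = \<delta>0"
    and s: "\<And>n. norm (E n) = 1" "\<And>n. has_dir_deriv f (X n) (E n) (V n)" "\<And>n. X n \<in> T (\<alpha> n)"
    "\<And>n. 1/2 \<le> \<alpha> n" "\<And>n. \<alpha> n < \<beta> n" "\<And>n. \<beta> n \<le> 1" "\<And>n. \<delta> n > 0" "\<And>n. norm (l n) \<le> 1/2"
    and R: "\<And>n x' e' v'. competes f T (\<sigma>seq L n) (X n) (E n) (V n) (l n) (\<delta> n) (\<beta> n) x' e' v' \<Longrightarrow>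
        (L + 1) * norm (e' - E n) + \<bar>v' - V n\<bar> \<le> \<sigma>seq L n / 8"
    and q: "\<And>n. \<delta> (Suc n) \<le> \<delta> n / 2" "\<And>n. \<alpha> n \<le> \<alpha> (Suc n)" "\<And>n. \<beta> (Suc n) < b n" "\<And>n. b n \<le> 1" "\<And>n. \<beta> (Suc n) \<le> \<beta> n"
    "\<And>n. l (Suc n) = l n + (1 / 2 ^ (n + 2)) *\<^sub>R E (Suc n)"
    "\<And>n. V n + l n \<bullet> E n \<le> V (Suc n) + l n \<bullet> E (Suc n)"
    and max: "\<And>n x' e' v'. competes f T (\<sigma>seq L n) (X n) (E n) (V n) (l n) (\<delta> n) (b n) x' e' v' \<Longrightarrow>
        v' + l n \<bullet> e' \<le> V (Suc n) + l n \<bullet> E (Suc n) + \<epsilon>seq n"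
    and nest: "\<And>n lam x' e' v'. \<alpha> (Suc n) \<le> lam \<Longrightarrow> lam \<le> b n \<Longrightarrow>
        competes f T (\<sigma>seq L (Suc n)) (X (Suc n)) (E (Suc n)) (V (Suc n)) (l (Suc n)) (\<delta> (Suc n)) lam x' e' v' \<Longrightarrow>
        competes f T (\<sigma>seq L n) (X n) (E n) (V n) (l n) (\<delta> n) lam x' e' v'"
    by (rule candidate_sequence[OF lip T x0 \<delta>0]) (rule that)
  have \<alpha>_mono: "\<alpha> m \<le> \<alpha> n" if "m \<le> n" for m n using that by (rule lift_Suc_mono_le[of \<alpha>, OF q(2)])
  have \<beta>_mono: "\<beta> n \<le> \<beta> m" if "m \<le> n" for m n using that by (rule lift_Suc_antimono_le[of \<beta>, OF q(5)])
  have \<alpha>\<beta>: "\<alpha> m \<le> \<beta> n" for m n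
    using \<alpha>_mono[of m "max m n"] \<beta>_mono[of n "max m n"] s(5)[of "max m n"] by simp
  have \<sigma>: "\<sigma>seq L n > 0" for n by (rule \<sigma>seq_pos[OF L])
  have nested: "competes f T (\<sigma>seq L k) (X k) (E k) (V k) (l k) (\<delta> k) lam x' e' v'"
    if "k \<le> j" "\<alpha> j \<le> lam" "lam \<le> \<beta> j"
      "competes f T (\<sigma>seq L j) (X j) (E j) (V j) (l j) (\<delta> j) lam x' e' v'" for k j lam x' e' v'
    using that(1)
  proof (induction rule: inc_induct)
    case base then show ?case by (rule that(4))
  next
    case (step n)
    show ?case
    proof (rule nest[OF _ _ step.IH])
      show "\<alpha> (Suc n) \<le> lam" using \<alpha>_mono[of "Suc n" j] step.hyps that(2) by simp
      show "lam \<le> b n" using \<beta>_mono[of "Suc n" j] step.hyps that(3) q(3)[of n] by simp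
    qed
  qed
  have comp: "competes f T (\<sigma>seq L k) (X k) (E k) (V k) (l k) (\<delta> k) (\<alpha> j) (X j) (E j) (V j)" if "k \<le> j" for k j
  proof (rule nested[OF that])
    have "0 \<le> \<alpha> j" using s(4)[of j] by simp
    then have "0 \<le> \<alpha> j * \<sigma>seq L j * \<bar>t\<bar>" for t using \<sigma>[of j] by simp
    then show "competes f T (\<sigma>seq L j) (X j) (E j) (V j) (l j) (\<delta> j) (\<alpha> j) (X j) (E j) (V j)"
      using s(1-4,7)[of j] \<open>0 \<le> \<alpha> j\<close> by (simp add: competes_def)
  qed (use s(5)[of j] in simp_all)
  have cl: "(L + 1) * norm (E j - E k) + \<bar>V j - V k\<bar> \<le> \<sigma>seq L k / 8" if "k \<le> j" for k j
  proof (rule R)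
    have "0 \<le> \<alpha> j" using s(4)[of j] by simp
    then show "competes f T (\<sigma>seq L k) (X k) (E k) (V k) (l k) (\<delta> k) (\<beta> k) (X j) (E j) (V j)"
      by (rule competes_mono[OF comp[OF that] \<alpha>\<beta> mono[OF _ \<alpha>\<beta>]])
        (use \<sigma>[of k] s(7)[of k] in simp_all)
  qed
  have EV: "norm (E j - E k) \<le> \<sigma>seq L k / 8" "\<bar>V j - V k\<bar> \<le> \<sigma>seq L k / 8" if "k \<le> j" for k j
  proof -
    have "1 * norm (E j - E k) \<le> (L + 1) * norm (E j - E k)" using L by (intro mult_right_mono) auto
    then show "norm (E j - E k) \<le> \<sigma>seq L k / 8" "\<bar>V j - V k\<bar> \<le> \<sigma>seq L k / 8"
      using cl[OF that] norm_ge_zero[of "E j - E k"] by linarith+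
  qed
  have \<delta>_le: "\<delta> n \<le> \<delta>0 * (1/2) ^ n" for n
  proof (induction n)
    case (Suc n) then show ?case using q(1)[of n] by simp
  qed (simp add: init)
  have Xd: "norm (X j - X k) \<le> \<alpha> j * \<delta> k" if "k \<le> j" for k j
    using comp[OF that] by (simp add: competes_def)
  have \<alpha>1: "\<alpha> j \<le> 1" for j using s(5,6)[of j] by simp
  have Xd': "norm (X j - X k) \<le> \<delta>0 * (1/2) ^ k" if "k \<le> j" for k j
  proof -
    have "\<alpha> j * \<delta> k \<le> 1 * \<delta> k" using \<alpha>1[of j] s(7)[of k] by (intro mult_right_mono) auto
    then show ?thesis using Xd[OF that] \<delta>_le[of k] by linarith
  qed
  have convergent_if: "convergent S" if "\<And>j k. k \<le> j \<Longrightarrow> norm (S j - S k) \<le> c k" "c \<longlonglongrightarrow> 0"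
    for S :: "nat \<Rightarrow> 'b::banach" and c
  proof -
    have "Cauchy S"
    proof (rule CauchyI')
      fix e :: real assume "e > 0"
      then have "\<forall>\<^sub>F k in sequentially. c k < e" using that(2) by (auto dest: order_tendstoD(2))
      then obtain M where M: "\<And>k. k \<ge> M \<Longrightarrow> c k < e" by (auto simp: eventually_sequentially)
      show "\<exists>M. \<forall>m\<ge>M. \<forall>n>m. dist (S m) (S n) < e"
      proof (intro exI[of _ M] allI impI)
        fix m n :: nat assume "M \<le> m" "m < n"
        then show "dist (S m) (S n) < e" using that(1)[of m n] M[of m] by (simp add: dist_norm norm_minus_commute)
      qed
    qed
    then show ?thesis by (rule Cauchy_convergent)
  qed
  have pow0: "(\<lambda>k. c * (1/2) ^ k) \<longlonglongrightarrow> 0" for c :: real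
    using tendsto_mult_right_zero[OF LIMSEQ_realpow_zero[of "1/2"]] by simp
  have \<sigma>0: "(\<lambda>k. \<sigma>seq L k / 8) \<longlonglongrightarrow> 0"
  proof -
    have "(\<lambda>k. 4 * (L + 1) * (1/4) ^ k) \<longlonglongrightarrow> 0"
      using tendsto_mult_right_zero[OF LIMSEQ_realpow_zero[of "1/4"]] by simp
    moreover have "4 * (L + 1) * (1/4) ^ k = \<sigma>seq L k / 8" for k by (simp add: \<sigma>seq_def power_divide field_simps)
    ultimately show ?thesis by (simp only:)
  qed
  have "convergent X" by (rule convergent_if[OF Xd' pow0])
  then obtain x where x: "X \<longlonglongrightarrow> x" by (auto simp: convergent_def)
  have "convergent E" by (rule convergent_if[OF EV(1) \<sigma>0])
  then obtain e where e: "E \<longlonglongrightarrow> e" by (auto simp: convergent_def)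
  have "convergent V" using EV(2) by (intro convergent_if[OF _ \<sigma>0]) auto
  then obtain v where v: "V \<longlonglongrightarrow> v" by (auto simp: convergent_def)
  \<comment> \<open>The total size of all tilts added after stage k.\<close>
  define \<tau> :: "nat \<Rightarrow> real" where "\<tau> k = 1 / 2 ^ (k + 1)" for k
  have \<tau>_Suc: "\<tau> k = 1 / 2 ^ (k + 2) + \<tau> (Suc k)" for k by (simp add: \<tau>_def)
  have \<tau>_pos: "\<tau> k > 0" for k by (simp add: \<tau>_def)
  have ld: "norm (l j - l k) \<le> \<tau> k - \<tau> j" if "k \<le> j" for k j
    using that
  proof (induction rule: dec_induct)
    case (step j)
    have "norm (l (Suc j) - l k) \<le> norm (l j - l k) + norm ((1 / 2 ^ (j + 2)) *\<^sub>R E (Suc j))"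
      using norm_triangle_ineq[of "l j - l k" "(1 / 2 ^ (j + 2)) *\<^sub>R E (Suc j)"] by (simp add: q(6) algebra_simps)
    also have "norm ((1 / 2 ^ (j + 2)) *\<^sub>R E (Suc j)) = 1 / 2 ^ (j + 2)" by (simp add: s(1))
    finally show ?case using step.IH \<tau>_Suc[of j] by linarith
  qed simp
  have \<tau>0: "\<tau> \<longlonglongrightarrow> 0"
  proof -
    have "\<tau> = (\<lambda>k. 1/2 * (1/2) ^ k)" by (auto simp: \<tau>_def power_divide)
    then show ?thesis using pow0[of "1/2"] by simp
  qed
  have ld': "norm (l j - l k) \<le> \<tau> k" if "k \<le> j" for k j using ld[OF that] \<tau>_pos[of j] by linarith
  have "convergent l" by (rule convergent_if[OF ld' \<tau>0])
  then obtain ll where ll: "l \<longlonglongrightarrow> ll" by (auto simp: convergent_def)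
  have lim_le: "a \<le> c" if "S \<longlonglongrightarrow> a" "\<And>j. j \<ge> k \<Longrightarrow> S j \<le> c" for S :: "nat \<Rightarrow> real" and a c k
    using that by (intro LIMSEQ_le_const2[OF that(1)]) auto
  have le_lim: "c \<le> a" if "S \<longlonglongrightarrow> a" "\<And>j. j \<ge> k \<Longrightarrow> c \<le> S j" for S :: "nat \<Rightarrow> real" and a c k
    using that by (intro LIMSEQ_le_const[OF that(1)]) auto
  have inc\<alpha>: "incseq \<alpha>" using q(2) by (intro incseq_SucI)
  obtain lam where lam: "\<alpha> \<longlonglongrightarrow> lam" using incseq_convergent[OF inc\<alpha>, of 1] \<alpha>1 by metis
  have \<alpha>lam: "\<alpha> n \<le> lam" for n by (rule incseq_le[OF inc\<alpha> lam])
  have lam\<beta>: "lam \<le> \<beta> n" for n by (rule lim_le[OF lam]) (rule \<alpha>\<beta>)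
  \<comment> \<open>Strictness survives the limit because \<open>lam\<close> stays below \<beta> of
    the next stage, which is strictly less than \<open>b n\<close>.\<close>
  have lamb: "lam < b n" for n using lam\<beta>[of "Suc n"] q(3)[of n] by simp
  have lam_half: "1/2 \<le> lam" using s(4)[of 0] \<alpha>lam[of 0] by simp
  have xT: "x \<in> T lam"
  proof (rule closed_sequentially[OF closed _ x])
    show "X n \<in> T lam" for n using s(3)[of n] mono[OF _ \<alpha>lam[of n]] s(4)[of n] by auto
  qed
  have ne: "norm e = 1"
    using tendsto_norm[OF e] s(1) by (simp add: LIMSEQ_const_iff)
  have xX: "norm (x - X k) \<le> lam * \<delta> k" for k
  proof (rule lim_le)
    show "(\<lambda>j. norm (X j - X k)) \<longlonglongrightarrow> norm (x - X k)" by (intro tendsto_intros x)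
    show "norm (X j - X k) \<le> lam * \<delta> k" if "k \<le> j" for j
      using Xd[OF that] mult_right_mono[OF \<alpha>lam[of j], of "\<delta> k"] s(7)[of k] by linarith
  qed
  have contf: "isCont f z" for z
    using lipschitz_on_continuous_on[OF lip] by (simp add: continuous_on_eq_continuous_at)
  have incr_lim: "(\<lambda>j. incr f (X j) d t) \<longlonglongrightarrow> incr f x d t" for d t
    unfolding incr_def by (intro tendsto_diff isCont_tendsto_compose[OF contf] tendsto_add x tendsto_const)
  have tol: "\<bar>incr f x (E k) t - incr f (X k) (E k) t\<bar> \<le> lam * \<sigma>seq L k * \<bar>t\<bar>" for k t
  proof (rule lim_le)
    show "(\<lambda>j. \<bar>incr f (X j) (E k) t - incr f (X k) (E k) t\<bar>) \<longlonglongrightarrow> \<bar>incr f x (E k) t - incr f (X k) (E k) t\<bar>"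
      by (intro tendsto_intros incr_lim)
    show "\<bar>incr f (X j) (E k) t - incr f (X k) (E k) t\<bar> \<le> lam * \<sigma>seq L k * \<bar>t\<bar>" if "k \<le> j" for j
    proof -
      have "\<bar>incr f (X j) (E k) t - incr f (X k) (E k) t\<bar> \<le> \<alpha> j * \<sigma>seq L k * \<bar>t\<bar>"
        using comp[OF that] by (simp add: competes_def)
      also have "\<dots> \<le> lam * \<sigma>seq L k * \<bar>t\<bar>" using \<alpha>lam[of j] \<sigma>[of k] by (intro mult_right_mono) auto
      finally show ?thesis .
    qed
  qed
  have cl_lim: "(L + 1) * norm (e - E k) + \<bar>v - V k\<bar> \<le> \<sigma>seq L k / 8" for k
  proof (rule lim_le)
    show "(\<lambda>j. (L + 1) * norm (E j - E k) + \<bar>V j - V k\<bar>) \<longlonglongrightarrow> (L + 1) * norm (e - E k) + \<bar>v - V k\<bar>"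
      by (intro tendsto_intros e v)
  qed (rule cl)
  have cl_lim': "L * norm (e - E k) + \<bar>v - V k\<bar> \<le> \<sigma>seq L k / 8" for k
    using cl_lim[of k] norm_ge_zero[of "e - E k"] unfolding distrib_right by linarith
  have dd: "has_dir_deriv f x e v"
    unfolding has_dir_deriv_def
  proof (intro allI impI)
    fix \<kappa> :: real assume "\<kappa> > 0"
    \<comment> \<open>Errors in units of \<sigma>/8: eight for the tolerance between
      \<open>x\<close> and \<open>X k\<close>, one for the direction and derivative, one for the
      linearity at \<open>X k\<close>.\<close>
    have "(\<lambda>k. \<sigma>seq L k / 8 * 10) \<longlonglongrightarrow> 0" using tendsto_mult_left_zero[OF \<sigma>0] .
    then have "\<forall>\<^sub>F k in sequentially. \<sigma>seq L k / 8 * 10 < \<kappa>" using \<open>\<kappa> > 0\<close> by (rule order_tendstoD(2))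
    then obtain k where k: "\<sigma>seq L k / 8 * 10 < \<kappa>" by (auto simp: eventually_sequentially)
    have pos: "\<sigma>seq L k / 8 > 0" using \<sigma>[of k] by simp
    obtain \<rho> where \<rho>: "\<rho> > 0" "\<And>t. \<bar>t\<bar> < \<rho> \<Longrightarrow> \<bar>incr f (X k) (E k) t - V k * t\<bar> \<le> \<sigma>seq L k / 8 * \<bar>t\<bar>"
      by (rule has_dir_derivD[OF s(2)[of k] pos]) (rule that)
    have "\<bar>incr f x e t - v * t\<bar> \<le> \<kappa> * \<bar>t\<bar>" if t: "\<bar>t\<bar> < \<rho>" for t
    proof -
      have "\<bar>incr f x e t - incr f x (E k) t\<bar> \<le> L * norm (e - E k) * \<bar>t\<bar>" by (rule incr_direction_bound[OF lip])
      moreover have "\<bar>incr f x (E k) t - incr f (X k) (E k) t\<bar> \<le> 1 * (\<sigma>seq L k * \<bar>t\<bar>)"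
      proof -
        have "lam \<le> 1" using lam\<beta>[of 0] s(6)[of 0] by simp
        then have "lam * (\<sigma>seq L k * \<bar>t\<bar>) \<le> 1 * (\<sigma>seq L k * \<bar>t\<bar>)" using \<sigma>[of k] by (intro mult_right_mono) auto
        then show ?thesis using tol[of k t] by (simp add: mult.assoc)
      qed
      moreover have "\<bar>v * t - V k * t\<bar> = \<bar>v - V k\<bar> * \<bar>t\<bar>"
        by (simp add: abs_mult flip: left_diff_distrib)
      moreover have "(L * norm (e - E k) + \<bar>v - V k\<bar>) * \<bar>t\<bar> \<le> \<sigma>seq L k / 8 * \<bar>t\<bar>"
        by (rule mult_right_mono[OF cl_lim']) simp
      moreover have "\<sigma>seq L k / 8 * 10 * \<bar>t\<bar> \<le> \<kappa> * \<bar>t\<bar>" using k by (intro mult_right_mono) auto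
      ultimately show ?thesis using \<rho>(2)[OF t] unfolding distrib_right by linarith
    qed
    then show "\<exists>\<rho>>0. \<forall>t. \<bar>t\<bar> < \<rho> \<longrightarrow> \<bar>incr f x e t - v * t\<bar> \<le> \<kappa> * \<bar>t\<bar>" using \<rho>(1) by blast
  qed
  have ee: "E k \<bullet> E k = 1" for k using s(1)[of k] by (simp add: dot_square_norm)
  \<comment> \<open>A tilt along the unit vector \<open>E (Suc n)\<close> raises the value there by
    exactly its length, which compensates the decrease of \<tau>.\<close>
  have incV: "V k + l k \<bullet> E k + \<tau> k \<le> V j + l j \<bullet> E j + \<tau> j" if "k \<le> j" for k j
    using that
  proof (rule lift_Suc_mono_le[of "\<lambda>k. V k + l k \<bullet> E k + \<tau> k", rotated])
    fix n
    show "V n + l n \<bullet> E n + \<tau> n \<le> V (Suc n) + l (Suc n) \<bullet> E (Suc n) + \<tau> (Suc n)"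
      using q(7)[of n] \<tau>_Suc[of n] ee[of "Suc n"] by (simp add: q(6) inner_add_left)
  qed
  have val: "V k + l k \<bullet> E k + \<tau> k \<le> v + ll \<bullet> e" for k
  proof (rule le_lim)
    have "(\<lambda>j. V j + l j \<bullet> E j + \<tau> j) \<longlonglongrightarrow> v + ll \<bullet> e + 0"
      by (intro tendsto_intros v ll e \<tau>0)
    then show "(\<lambda>j. V j + l j \<bullet> E j + \<tau> j) \<longlonglongrightarrow> v + ll \<bullet> e" by simp
  qed (rule incV)
  have lll: "norm (ll - l k) \<le> \<tau> k" for k
  proof (rule lim_le)
    show "(\<lambda>j. norm (l j - l k)) \<longlonglongrightarrow> norm (ll - l k)" by (intro tendsto_intros ll)
  qed (rule ld')
  have "norm ll \<le> 1"
  proof (rule lim_le)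
    show "(\<lambda>j. norm (l j)) \<longlonglongrightarrow> norm ll" by (intro tendsto_intros ll)
    show "norm (l j) \<le> 1" if "0 \<le> j" for j using s(8)[of j] by simp
  qed
  show ?thesis
  proof (rule that[OF lam_half xT ne dd _ \<open>norm ll \<le> 1\<close>])
    have "lam * \<delta> 0 \<le> 1 * \<delta> 0" using lam\<beta>[of 0] s(6,7)[of 0] by (intro mult_right_mono) auto
    then show "norm (x - x0) \<le> \<delta>0" using xX[of 0] init by simp
    fix k
    have "\<exists>\<delta>1>0. \<forall>x'. norm (x' - x) \<le> \<delta>1 \<longrightarrow> (\<forall>t. \<bar>incr f x' e t - incr f x e t\<bar> \<le> \<sigma>seq L k / 4 * \<bar>t\<bar>) \<longrightarrow>
      (\<forall>t. \<bar>incr f x' (E k) t - incr f (X k) (E k) t\<bar> \<le> b k * \<sigma>seq L k * \<bar>t\<bar>)"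
      by (rule increments_transfer[OF lip s(2) dd cl_lim' tol lam_half lamb \<sigma>])
    then obtain \<delta>1 where \<delta>1: "\<delta>1 > 0" "\<And>x'. norm (x' - x) \<le> \<delta>1 \<Longrightarrow> \<forall>t. \<bar>incr f x' e t - incr f x e t\<bar> \<le> \<sigma>seq L k / 4 * \<bar>t\<bar> \<Longrightarrow>
      \<forall>t. \<bar>incr f x' (E k) t - incr f (X k) (E k) t\<bar> \<le> b k * \<sigma>seq L k * \<bar>t\<bar>" by blast
    define \<delta>2 where "\<delta>2 = min \<delta>1 ((b k - lam) * \<delta> k)"
    have \<delta>2: "\<delta>2 > 0" "\<delta>2 \<le> \<delta>1" "\<delta>2 \<le> (b k - lam) * \<delta> k" using \<delta>1(1) lamb[of k] s(7)[of k] by (auto simp: \<delta>2_def)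
    have "v' + ll \<bullet> e' \<le> v + ll \<bullet> e + \<epsilon>seq k"
      if x': "x' \<in> T (b k)" "norm e' = 1" "has_dir_deriv f x' e' v'" "norm (x' - x) \<le> \<delta>2"
        "\<forall>t. \<bar>incr f x' e t - incr f x e t\<bar> \<le> \<sigma>seq L k / 4 * \<bar>t\<bar>" for x' e' v'
    proof (rule ccontr)
      \<comment> \<open>Arguing by contradiction supplies what a competitor needs: a value at least
        that of \<open>X k\<close>.\<close>
      assume "\<not> ?thesis"
      then have big: "v' + ll \<bullet> e' > v + ll \<bullet> e + \<epsilon>seq k" by simp
      have "\<bar>(ll - l k) \<bullet> e'\<bar> \<le> norm (ll - l k) * norm e'" by (rule Cauchy_Schwarz_ineq2)
      then have l_e': "v' + ll \<bullet> e' - \<tau> k \<le> v' + l k \<bullet> e'" using lll[of k] x'(2) by (simp add: inner_diff_left)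
      have "competes f T (\<sigma>seq L k) (X k) (E k) (V k) (l k) (\<delta> k) (b k) x' e' v'"
        unfolding competes_def
      proof (intro conjI)
        show "V k + l k \<bullet> E k \<le> v' + l k \<bullet> e'" using l_e' big val[of k] \<epsilon>seq_pos[of k] by linarith
        have "norm (x' - X k) \<le> norm (x' - x) + norm (x - X k)" using norm_triangle_ineq[of "x' - x" "x - X k"] by simp
        also have "\<dots> \<le> (b k - lam) * \<delta> k + lam * \<delta> k" using x'(4) \<delta>2(3) xX[of k] by linarith
        finally show "norm (x' - X k) \<le> b k * \<delta> k" by (simp add: algebra_simps)
        show "\<forall>t. \<bar>incr f x' (E k) t - incr f (X k) (E k) t\<bar> \<le> b k * \<sigma>seq L k * \<bar>t\<bar>"
          using \<delta>1(2)[OF _ x'(5)] x'(4) \<delta>2(2) by simp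
      qed (use x' in auto)
      then have "v' + l k \<bullet> e' \<le> V (Suc k) + l k \<bullet> E (Suc k) + \<epsilon>seq k" by (rule max)
      \<comment> \<open>Replacing \<open>ll\<close> by \<open>l k\<close> at e' loses at most \<tau>
        k, while the limit value exceeds that of the new candidate by at least \<tau> k. The two
        cancel, so the precision stays \<open>\<epsilon>seq k\<close>.\<close>
      moreover have "V (Suc k) + l k \<bullet> E (Suc k) + \<tau> k \<le> v + ll \<bullet> e"
        using val[of "Suc k"] \<tau>_Suc[of k] ee[of "Suc k"] by (simp add: q(6) inner_add_left)
      ultimately show False using l_e' big by linarith
    qed
    then show "\<exists>b>lam. b \<le> 1 \<and> (\<exists>\<delta>>0. \<forall>x' e' v'. x' \<in> T b \<longrightarrow> norm e' = 1 \<longrightarrow> has_dir_deriv f x' e' v' \<longrightarrow>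
       norm (x' - x) \<le> \<delta> \<longrightarrow> (\<forall>t. \<bar>incr f x' e t - incr f x e t\<bar> \<le> \<sigma>seq L k / 4 * \<bar>t\<bar>) \<longrightarrow>
       v' + ll \<bullet> e' \<le> v + ll \<bullet> e + \<epsilon>seq k)"
      using \<delta>2(1) lamb[of k] q(4)[of k] by blast
  qed
qed

section \<open>Wedges and differentiability\<close>

text \<open>For unit vectors a and b this parametrises a wedge by arc length, with the corner q at
  time 0, so that derivatives along it are directional derivatives in unit directions.\<close>

definition bent_line :: "'a::real_vector \<Rightarrow> 'a \<Rightarrow> 'a \<Rightarrow> real \<Rightarrow> 'a" where
  "bent_line q a b \<tau> = q + \<tau> *\<^sub>R (if \<tau> \<le> 0 then a else b)"

lemma bent_line_lipschitz:
  fixes q :: "'a::real_normed_vector"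
  assumes "norm a \<le> c" "norm b \<le> c"
  shows "norm (bent_line q a b u - bent_line q a b v) \<le> c * \<bar>u - v\<bar>"
proof -
  have c: "c \<ge> 0" using assms(1) norm_ge_zero order_trans by blast
  have *: "norm (u *\<^sub>R a' + v *\<^sub>R b') \<le> c * (\<bar>u\<bar> + \<bar>v\<bar>)" if "norm a' \<le> c" "norm b' \<le> c" for u v and a' b' :: 'a
  proof -
    have "norm (u *\<^sub>R a' + v *\<^sub>R b') \<le> \<bar>u\<bar> * norm a' + \<bar>v\<bar> * norm b'"
      using norm_triangle_ineq[of "u *\<^sub>R a'" "v *\<^sub>R b'"] by simp
    also have "\<dots> \<le> \<bar>u\<bar> * c + \<bar>v\<bar> * c" using that by (intro add_mono mult_left_mono) auto
    finally show ?thesis by (simp add: algebra_simps)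
  qed
  consider "u \<le> 0" "v \<le> 0" | "u > 0" "v > 0" | "u \<le> 0" "v > 0" | "u > 0" "v \<le> 0" by linarith
  then show ?thesis
  proof cases
    case 1 then show ?thesis using *[OF assms, of "u - v" 0] by (simp add: bent_line_def scaleR_diff_left)
  next
    case 2 then show ?thesis using *[OF assms(2,1), of "u - v" 0] by (simp add: bent_line_def scaleR_diff_left)
  next
    case 3
    then have "\<bar>u\<bar> + \<bar>- v\<bar> = \<bar>u - v\<bar>" by simp
    then show ?thesis using 3 *[OF assms, of u "- v"] by (simp add: bent_line_def)
  next
    case 4
    then have "\<bar>u\<bar> + \<bar>- v\<bar> = \<bar>u - v\<bar>" by simp
    then show ?thesis using 4 *[OF assms(2,1), of u "- v"] by (simp add: bent_line_def)
  qed
qed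

lemma bent_line_direction:
  fixes q :: "'a::real_normed_vector"
  assumes "norm (a - e) \<le> c" "norm (b - e) \<le> c"
  shows "norm (bent_line q a b u - bent_line q a b v - (u - v) *\<^sub>R e) \<le> c * \<bar>u - v\<bar>"
proof -
  have "bent_line q a b u - bent_line q a b v - (u - v) *\<^sub>R e = bent_line q (a - e) (b - e) u - bent_line q (a - e) (b - e) v"
    by (simp add: bent_line_def algebra_simps)
  then show ?thesis using bent_line_lipschitz[OF assms, of q u v] by simp
qed

text \<open>The term \<open>e \<bullet> h\<close> is the first-order change of length, matched by
  the linear approximation of the function. The quadratic rest comes from completing the square; for
  a leg of the wedge it is r / (2 s).\<close>

lemma norm_axis_plus:
  fixes e h :: "'a::real_inner"
  assumes "norm e = 1" "a > 0" "norm h \<le> a"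
  shows "a + e \<bullet> h \<le> norm (a *\<^sub>R e + h)" "norm (a *\<^sub>R e + h) \<le> a + e \<bullet> h + (norm h)\<^sup>2 / (2 * a)"
proof -
  have ee: "e \<bullet> e = 1" using assms(1) by (simp add: dot_square_norm)
  have "a + e \<bullet> h = e \<bullet> (a *\<^sub>R e + h)" using ee by (simp add: inner_add_right)
  also have "\<dots> \<le> norm e * norm (a *\<^sub>R e + h)" by (rule norm_cauchy_schwarz)
  finally show "a + e \<bullet> h \<le> norm (a *\<^sub>R e + h)" using assms(1) by simp
  have "\<bar>e \<bullet> h\<bar> \<le> norm h" using Cauchy_Schwarz_ineq2[of e h] assms(1) by simp
  then have pos: "0 \<le> a + e \<bullet> h" using assms(3) by linarith
  have "(norm (a *\<^sub>R e + h))\<^sup>2 = a\<^sup>2 + 2 * a * (e \<bullet> h) + (norm h)\<^sup>2"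
    unfolding power2_norm_eq_inner using ee by (simp add: inner_add inner_commute power2_eq_square algebra_simps)
  also have "\<dots> = (a + e \<bullet> h)\<^sup>2 + 2 * a * ((norm h)\<^sup>2 / (2 * a)) - (e \<bullet> h)\<^sup>2"
    using assms(2) by (simp add: power2_eq_square algebra_simps)
  also have "\<dots> = (a + e \<bullet> h + (norm h)\<^sup>2 / (2 * a))\<^sup>2 - (e \<bullet> h + (norm h)\<^sup>2 / (2 * a))\<^sup>2"
    by (simp add: power2_eq_square algebra_simps)
  also have "\<dots> \<le> (a + e \<bullet> h + (norm h)\<^sup>2 / (2 * a))\<^sup>2" by simp
  finally show "norm (a *\<^sub>R e + h) \<le> a + e \<bullet> h + (norm h)\<^sup>2 / (2 * a)"
    by (rule power2_le_imp_le) (use pos assms(2) in simp)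
qed

text \<open>Normalising moves w by | |w| - a |, at most the distance from w to
  \<open>a *\<^sub>R e\<close>; hence the factor 2.\<close>

lemma normalized_direction_close:
  fixes w e :: "'a::real_inner"
  assumes "norm e = 1" "a > 0" "w \<noteq> 0"
  shows "norm ((1 / norm w) *\<^sub>R w - e) \<le> 2 * norm (w - a *\<^sub>R e) / a"
proof -
  have "(a / norm w) *\<^sub>R w + ((norm w - a) / norm w) *\<^sub>R w = w"
    using assms(3) by (simp flip: scaleR_add_left add_divide_distrib)
  then have "a *\<^sub>R ((1 / norm w) *\<^sub>R w - e) = (w - a *\<^sub>R e) - ((norm w - a) / norm w) *\<^sub>R w"
    by (simp add: scaleR_diff_right algebra_simps)
  then have "a * norm ((1 / norm w) *\<^sub>R w - e) = norm ((w - a *\<^sub>R e) - ((norm w - a) / norm w) *\<^sub>R w)"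
    using assms(2) by (metis abs_of_pos norm_scaleR)
  also have "\<dots> \<le> norm (w - a *\<^sub>R e) + norm (((norm w - a) / norm w) *\<^sub>R w)" by (rule norm_triangle_ineq4)
  also have "norm (((norm w - a) / norm w) *\<^sub>R w) = \<bar>norm w - norm (a *\<^sub>R e)\<bar>" using assms by simp
  also have "\<dots> \<le> norm (w - a *\<^sub>R e)" by (rule norm_triangle_ineq3)
  finally show ?thesis using assms(2) by (simp add: pos_le_divide_eq mult.commute)
qed

text \<open>There are three ranges of t. While \<tau> + t is in [A, B] the increment follows
  \<gamma>, whose slopes are controlled. Past an end it leaves through that end, which is close to
  the line through x, where g is almost linear. For |t| \<ge> \<rho>/2 only the displacement of the
  base point counts. The fixed error 4 \<omega> w made at an end is absorbed because \<tau> stays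
  \<theta> away from both ends.\<close>

lemma increments_near_line:
  fixes g :: "'a::real_normed_vector \<Rightarrow> real"
  assumes lip: "M-lipschitz_on UNIV g"
    and lin: "\<And>t. \<bar>t\<bar> < \<rho> \<Longrightarrow> \<bar>incr g x e t - D * t\<bar> \<le> \<omega> * \<bar>t\<bar>" and "\<rho> > 0" "\<omega> > 0"
    and \<gamma>: "\<And>u v. norm (\<gamma> u - \<gamma> v - (u - v) *\<^sub>R e) \<le> c * \<bar>u - v\<bar>" and c: "M * c \<le> \<kappa> / 8"
    and ends: "norm (\<gamma> A - (x - w *\<^sub>R e)) \<le> \<mu>" "norm (\<gamma> B - (x + w *\<^sub>R e)) \<le> \<mu>"
    and w: "0 \<le> w" "w < \<rho> / 2" "M * \<mu> \<le> \<omega> * w"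
    and \<theta>: "4 * \<omega> * w \<le> \<kappa> / 8 * \<theta>" "\<omega> \<le> \<kappa> / 16" "\<kappa> > 0" "\<theta> \<ge> 0"
    and \<tau>: "A + \<theta> < \<tau>" "\<tau> < B - \<theta>"
    and near: "8 * M * norm (\<gamma> \<tau> - x) \<le> \<kappa> * \<rho>"
    and slopes: "\<And>u. u \<in> {A..B} \<Longrightarrow> \<bar>g (\<gamma> u) - g (\<gamma> \<tau>) - D * (u - \<tau>)\<bar> \<le> a * \<bar>u - \<tau>\<bar>" and a: "a \<ge> 0"
  shows "\<bar>incr g (\<gamma> \<tau>) e t - incr g x e t\<bar> \<le> (a + \<kappa> / 2) * \<bar>t\<bar>"
proof -
  have M: "M \<ge> 0" using lipschitz_on_nonneg[OF lip] .
  note bd = lipschitz_real_valued_bound[OF lip]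
  have shift: "\<bar>g (\<gamma> \<tau> + (u - \<tau>) *\<^sub>R e + z) - g (\<gamma> u + z)\<bar> \<le> \<kappa> / 8 * \<bar>u - \<tau>\<bar>" for u z
  proof -
    have "\<bar>g (\<gamma> \<tau> + (u - \<tau>) *\<^sub>R e + z) - g (\<gamma> u + z)\<bar> \<le> M * norm (\<gamma> \<tau> - \<gamma> u - (\<tau> - u) *\<^sub>R e)"
      using bd[of "\<gamma> \<tau> + (u - \<tau>) *\<^sub>R e + z" "\<gamma> u + z"] by (simp add: algebra_simps)
    also have "\<dots> \<le> M * (c * \<bar>\<tau> - u\<bar>)" using \<gamma>[of \<tau> u] M by (intro mult_left_mono) auto
    also have "\<dots> \<le> \<kappa> / 8 * \<bar>\<tau> - u\<bar>" using mult_right_mono[OF c, of "\<bar>\<tau> - u\<bar>"] by (simp add: mult.assoc)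
    finally show ?thesis by (simp add: abs_minus_commute)
  qed
  have inside: "\<bar>incr g (\<gamma> \<tau>) e t - D * t\<bar> \<le> (a + \<kappa> / 8) * \<bar>t\<bar>" if "\<tau> + t \<in> {A..B}" for t
  proof -
    have "\<bar>incr g (\<gamma> \<tau>) e t - D * t\<bar> \<le> \<bar>g (\<gamma> (\<tau> + t)) - g (\<gamma> \<tau>) - D * t\<bar> + \<bar>g (\<gamma> \<tau> + t *\<^sub>R e) - g (\<gamma> (\<tau> + t))\<bar>"
      unfolding incr_def by linarith
    also have "\<dots> \<le> a * \<bar>t\<bar> + \<kappa> / 8 * \<bar>t\<bar>" using shift[of "\<tau> + t" 0] slopes[OF that] by (intro add_mono) simp_all
    finally show ?thesis by (simp add: distrib_right)
  qed
  \<comment> \<open>Here u is the parameter of the end passed, v = w or v = -w the position of that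
    end on the line, and t - (u - \<tau>) the remaining part of the increment.\<close>
  have outside: "\<bar>incr g (\<gamma> \<tau>) e t - D * t\<bar> \<le> (a + \<kappa> / 4) * \<bar>t\<bar>"
    if u: "u \<in> {A..B}" "\<bar>u - \<tau>\<bar> + \<bar>t - (u - \<tau>)\<bar> = \<bar>t\<bar>" "\<bar>u - \<tau>\<bar> \<ge> \<theta>" and t: "\<bar>t\<bar> < \<rho> / 2"
      and v: "norm (\<gamma> u - (x + v *\<^sub>R e)) \<le> \<mu>" "\<bar>v\<bar> = w" for t u v
  proof -
    define t' where "t' = t - (u - \<tau>)"
    have t': "t = (u - \<tau>) + t'" "\<bar>u - \<tau>\<bar> + \<bar>t'\<bar> = \<bar>t\<bar>" using u(2) by (auto simp: t'_def)
    have 1: "\<bar>g (\<gamma> \<tau> + t *\<^sub>R e) - g (\<gamma> u + t' *\<^sub>R e)\<bar> \<le> \<kappa> / 8 * \<bar>u - \<tau>\<bar>"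
      using shift[of u "t' *\<^sub>R e"] by (simp add: t'(1) scaleR_add_left add.assoc)
    have 2: "\<bar>g (\<gamma> u) - g (\<gamma> \<tau>) - D * (u - \<tau>)\<bar> \<le> a * \<bar>u - \<tau>\<bar>" by (rule slopes[OF u(1)])
    have M\<mu>: "M * norm (\<gamma> u - (x + v *\<^sub>R e)) \<le> \<omega> * w" using mult_left_mono[OF v(1) M] w(3) by linarith
    have 3: "\<bar>g (\<gamma> u) - g (x + v *\<^sub>R e)\<bar> \<le> \<omega> * w"
      using bd[of "\<gamma> u" "x + v *\<^sub>R e"] M\<mu> by linarith
    have 4: "\<bar>g (\<gamma> u + t' *\<^sub>R e) - g (x + (v + t') *\<^sub>R e)\<bar> \<le> \<omega> * w"
      using bd[of "\<gamma> u + t' *\<^sub>R e" "x + (v + t') *\<^sub>R e"] M\<mu> by (simp add: algebra_simps)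
    have 5: "\<bar>incr g x e v - D * v\<bar> \<le> \<omega> * w" using lin[of v] v(2) w(1,2) by simp
    have "\<bar>v + t'\<bar> < \<rho>" using t t'(2) v(2) w(2) by linarith
    then have "\<bar>incr g x e (v + t') - D * (v + t')\<bar> \<le> \<omega> * \<bar>v + t'\<bar>" by (rule lin)
    also have "\<dots> \<le> \<omega> * (w + \<bar>t'\<bar>)" using v(2) \<open>\<omega> > 0\<close> by (intro mult_left_mono) auto
    finally have 6: "\<bar>incr g x e (v + t') - D * (v + t')\<bar> \<le> \<omega> * w + \<omega> * \<bar>t'\<bar>" by (simp add: distrib_left)
    have 7: "\<bar>incr g (\<gamma> \<tau>) e t - D * t\<bar> \<le> (\<kappa> / 8 * \<bar>u - \<tau>\<bar> + a * \<bar>u - \<tau>\<bar>) + (4 * \<omega> * w + \<omega> * \<bar>t'\<bar>)"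
    proof -
      have "D * (v + t') = D * v + D * t'" by (rule distrib_left)
      moreover have "D * t = D * (u - \<tau>) + D * t'" by (subst t'(1)) (rule distrib_left)
      moreover define P Q R S where "P = \<kappa> / 8 * \<bar>u - \<tau>\<bar>" and "Q = a * \<bar>u - \<tau>\<bar>" and "R = \<omega> * \<bar>t'\<bar>" and "S = \<omega> * w"
      moreover have "4 * \<omega> * w = 4 * S" by (simp add: S_def)
      ultimately show ?thesis using 1 2 3 4 5 6 unfolding incr_def
        unfolding P_def[symmetric] Q_def[symmetric] R_def[symmetric] S_def[symmetric] by linarith
    qed
    have "\<kappa> / 8 * \<theta> \<le> \<kappa> / 8 * \<bar>u - \<tau>\<bar>" using u(3) \<theta>(3) by (intro mult_left_mono) auto
    moreover have "\<omega> * \<bar>t'\<bar> \<le> \<kappa> / 4 * \<bar>t'\<bar>" using \<theta>(2,3) by (intro mult_right_mono) auto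
    moreover have "(a + \<kappa> / 4) * \<bar>t\<bar> = a * \<bar>u - \<tau>\<bar> + a * \<bar>t'\<bar> + \<kappa> / 4 * \<bar>u - \<tau>\<bar> + \<kappa> / 4 * \<bar>t'\<bar>"
      unfolding t'(2)[symmetric] by (simp add: algebra_simps)
    moreover have "0 \<le> a * \<bar>t'\<bar>" using a by simp
    moreover have "\<kappa> / 4 * \<bar>u - \<tau>\<bar> = \<kappa> / 8 * \<bar>u - \<tau>\<bar> + \<kappa> / 8 * \<bar>u - \<tau>\<bar>" by simp
    ultimately show ?thesis using 7 \<theta>(1) by linarith
  qed
  show ?thesis
  proof (cases "\<bar>t\<bar> < \<rho> / 2")
    case True
    have "\<bar>incr g (\<gamma> \<tau>) e t - D * t\<bar> \<le> (a + \<kappa> / 4) * \<bar>t\<bar>"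
    proof -
      consider "\<tau> + t \<in> {A..B}" | "\<tau> + t < A" | "\<tau> + t > B" by fastforce
      then show ?thesis
      proof cases
        case 1
        have "(a + \<kappa> / 8) * \<bar>t\<bar> \<le> (a + \<kappa> / 4) * \<bar>t\<bar>" using \<theta>(3) by (intro mult_right_mono) auto
        then show ?thesis using inside[OF 1] by linarith
      next
        case 2
        show ?thesis
          by (rule outside[of A _ "- w"]) (use 2 \<tau> \<theta>(4) True ends w in auto)
      next
        case 3
        show ?thesis
          by (rule outside[of B _ w]) (use 3 \<tau> \<theta>(4) True ends w in auto)
      qed
    qed
    moreover have "\<bar>incr g x e t - D * t\<bar> \<le> \<omega> * \<bar>t\<bar>" using True \<open>\<rho> > 0\<close> by (intro lin) auto
    moreover have "\<omega> * \<bar>t\<bar> \<le> \<kappa> / 4 * \<bar>t\<bar>" using \<theta>(2,3) by (intro mult_right_mono) auto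
    moreover have "(a + \<kappa> / 2) * \<bar>t\<bar> = (a + \<kappa> / 4) * \<bar>t\<bar> + \<kappa> / 4 * \<bar>t\<bar>" by (simp add: algebra_simps)
    ultimately show ?thesis by linarith
  next
    case False
    have "\<bar>incr g (\<gamma> \<tau>) e t - incr g x e t\<bar> \<le> 2 * M * norm (\<gamma> \<tau> - x)" by (rule incr_base_bound[OF lip])
    also have "\<dots> \<le> \<kappa> / 4 * \<rho>" using near by simp
    also have "\<dots> \<le> \<kappa> / 4 * (2 * \<bar>t\<bar>)" using False \<theta>(3) by (intro mult_left_mono) auto
    also have "\<dots> \<le> (a + \<kappa> / 2) * \<bar>t\<bar>" using a by (simp add: distrib_right)
    finally show ?thesis .
  qed
qed

section \<open>The gain on a wedge and differentiability\<close>

lemma \<epsilon>seq_sum: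
  assumes "M \<ge> 1"
  shows "(\<Sum>j<k. \<epsilon>seq j / (4 * M / 4 ^ Suc j)) \<le> 1 / 30"
proof -
  \<comment> \<open>The summands decay like (4/32)^j = (1/8)^j, so the sum is at most 8/7 times
    1/64, below the 1/30 demanded by the selection lemma.\<close>
  have "(\<Sum>j<k. \<epsilon>seq j / (4 * M / 4 ^ Suc j)) \<le> (\<Sum>j<k. 1 / 64 * (1 / 8) ^ j)"
  proof (rule sum_mono)
    fix j
    have "(32::real) ^ j = 4 ^ j * 8 ^ j" by (simp flip: power_mult_distrib)
    then have "\<epsilon>seq j / (4 * M / 4 ^ Suc j) = 1 / M * (1 / 64 * (1 / 8) ^ j)"
      by (simp add: \<epsilon>seq_def power_divide)
    also have "\<dots> \<le> 1 * (1 / 64 * (1 / 8) ^ j)" using assms by (intro mult_right_mono) auto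
    finally show "\<epsilon>seq j / (4 * M / 4 ^ Suc j) \<le> 1 / 64 * (1 / 8) ^ j" by simp
  qed
  also have "\<dots> = 1 / 64 * (\<Sum>j<k. (1 / 8) ^ j)" by (simp add: sum_distrib_left)
  also have "(\<Sum>j<k. (1 / 8 :: real) ^ j) = (1 - (1 / 8) ^ k) * (8 / 7)" by (subst geometric_sum) (auto simp: field_simps)
  also have "1 / 64 * \<dots> \<le> 1 / 64 * (1 * (8 / 7))" by (intro mult_left_mono mult_right_mono) auto
  finally show ?thesis by simp
qed

text \<open>Away from the corner the bent line is locally straight. The corner itself is a single
  parameter and can be discarded as a null set.\<close>

lemma bent_line_has_dir_deriv:
  assumes "((\<lambda>\<tau>. g (bent_line q a b \<tau>)) has_real_derivative v) (at \<tau>)" "\<tau> \<noteq> 0"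
  shows "has_dir_deriv g (bent_line q a b \<tau>) (if \<tau> \<le> 0 then a else b) v"
  unfolding has_dir_deriv_iff_has_real_derivative
proof (rule has_field_derivative_transform_within)
  show "((\<lambda>t. g (bent_line q a b (t + \<tau>))) has_real_derivative v) (at 0)"
    using assms(1) DERIV_shift[of "\<lambda>\<tau>. g (bent_line q a b \<tau>)" v 0 \<tau>] by simp
  show "0 < \<bar>\<tau>\<bar>" using assms(2) by simp
  fix t :: real assume "dist t 0 < \<bar>\<tau>\<bar>"
  then have "(t + \<tau> \<le> 0) = (\<tau> \<le> 0)" by (auto simp: dist_real_def abs_if split: if_splits)
  then show "g (bent_line q a b (t + \<tau>)) = g (bent_line q a b \<tau> + t *\<^sub>R (if \<tau> \<le> 0 then a else b))"
    by (simp add: bent_line_def scaleR_add_left add_ac)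
qed simp

text \<open>The deviation at \<open>x + h\<close> forces a gain of \<epsilon> r / 2 on one leg. The
  right-hand side is the most that the selection lemma allows: the loss on the end strips and the
  precision \<open>\<epsilon>seq k\<close> over a total length of at most 4 w. Suitable constants
  make the two incompatible.\<close>

lemma wedge_gain_bounded:
  fixes g :: "'a::euclidean_space \<Rightarrow> real"
  assumes lip: "M-lipschitz_on UNIV g" and M: "M \<ge> 1" and e: "norm e = 1" and D: "\<bar>D\<bar> \<le> M"
    and s_def: "s = 4 ^ Suc k" and r_def: "r = norm h" and r: "r > 0" and w_def: "w = r * s"
    and \<eta>: "\<eta> > 0" "\<eta> * s \<le> 1 / 8" and \<omega>_def: "\<omega> = M * \<eta>" and \<kappa>_def: "\<kappa> = 8 * M / 4 ^ k"
    and lin: "\<And>t. \<bar>t\<bar> < \<rho> \<Longrightarrow> \<bar>incr g x e t - D * t\<bar> \<le> \<omega> * \<bar>t\<bar>" and \<rho>: "\<rho> > 0" "32 * M * w \<le> \<kappa> * \<rho>"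
    and \<omega>\<kappa>: "\<omega> \<le> \<kappa> / 16"
    and pqu: "norm (p - (x - w *\<^sub>R e)) \<le> \<eta> * w" "norm (q - (x + h)) \<le> \<eta> * w" "norm (u - (x + w *\<^sub>R e)) \<le> \<eta> * w"
    and sel: "\<And>j y d v. j \<le> k \<Longrightarrow> y \<in> closed_segment p q \<union> closed_segment q u \<Longrightarrow> norm d = 1 \<Longrightarrow>
        has_dir_deriv g y d v \<Longrightarrow> norm (y - x) \<le> 4 * w \<Longrightarrow>
        (\<And>t. \<bar>incr g y e t - incr g x e t\<bar> \<le> 8 * M / 4 ^ j * \<bar>t\<bar>) \<Longrightarrow> v \<le> D + \<epsilon>seq j"
    and dev: "\<bar>g (x + h) - g x - D * (e \<bullet> h)\<bar> > \<epsilon> * r"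
    and \<epsilon>: "16 * M \<le> \<epsilon> * s" "64 * \<omega> * s \<le> \<epsilon>"
  shows "\<epsilon> * r / 2 \<le> 8 * M * (32 * \<omega> * w / \<kappa>) + 8 * \<epsilon>seq k * w"
proof -
  note bd = lipschitz_real_valued_bound[OF lip]
  have s: "s \<ge> 4" by (simp add: s_def)
  have w: "w \<ge> 4 * r" "w > 0" using mult_left_mono[OF s, of r] r by (simp_all add: w_def)
  have \<omega>: "\<omega> > 0" using M \<eta>(1) by (simp add: \<omega>_def)
  have \<kappa>: "\<kappa> > 0" "\<kappa> = 32 * M / s" using M by (simp_all add: \<kappa>_def s_def)
  have \<eta>w: "\<eta> * w \<le> r / 8" using mult_left_mono[OF \<eta>(2), of r] r by (simp add: w_def mult_ac)
  have rs: "r\<^sup>2 / (2 * w) = r / (2 * s)" using r s by (simp add: w_def power2_eq_square)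
  have rs4: "r / (2 * s) \<le> r / 8" using r s by (intro divide_left_mono) auto
  have eh: "\<bar>e \<bullet> h\<bar> \<le> r" using Cauchy_Schwarz_ineq2[of e h] e by (simp add: r_def)
  have v1: "norm ((q - p) - (w *\<^sub>R e + h)) \<le> 2 * (\<eta> * w)"
  proof -
    have eq: "(q - p) - (w *\<^sub>R e + h) = (q - (x + h)) - (p - (x - w *\<^sub>R e))" by (simp add: algebra_simps)
    show ?thesis using norm_triangle_ineq4[of "q - (x + h)" "p - (x - w *\<^sub>R e)"] pqu unfolding eq by linarith
  qed
  have v2: "norm ((u - q) - (w *\<^sub>R e + - h)) \<le> 2 * (\<eta> * w)"
  proof -
    have eq: "(u - q) - (w *\<^sub>R e + - h) = (u - (x + w *\<^sub>R e)) - (q - (x + h))" by (simp add: algebra_simps)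
    show ?thesis using norm_triangle_ineq4[of "u - (x + w *\<^sub>R e)" "q - (x + h)"] pqu unfolding eq by linarith
  qed
  \<comment> \<open>Stated for h' so that it covers both legs, which are close to w e + h and w e -
    h.\<close>
  have leg: "norm v > 0 \<and> norm v \<le> 2 * w \<and> \<bar>norm v - (w + e \<bullet> h')\<bar> \<le> r / (2 * s) + 2 * (\<eta> * w) \<and>
      norm ((1 / norm v) *\<^sub>R v) = 1 \<and> norm ((1 / norm v) *\<^sub>R v - e) \<le> 3 / s"
    if h': "norm h' = r" and v: "norm (v - (w *\<^sub>R e + h')) \<le> 2 * (\<eta> * w)" for v h'
  proof -
    have ax: "w + e \<bullet> h' \<le> norm (w *\<^sub>R e + h')" "norm (w *\<^sub>R e + h') \<le> w + e \<bullet> h' + r / (2 * s)"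
      using norm_axis_plus[of e w h'] e w r h' rs by simp_all
    have near: "\<bar>norm v - norm (w *\<^sub>R e + h')\<bar> \<le> 2 * (\<eta> * w)"
      using norm_triangle_ineq3[of v "w *\<^sub>R e + h'"] v by linarith
    have eh': "\<bar>e \<bullet> h'\<bar> \<le> r" using Cauchy_Schwarz_ineq2[of e h'] e h' by simp
    have 1: "norm v > 0" "norm v \<le> 2 * w" "\<bar>norm v - (w + e \<bullet> h')\<bar> \<le> r / (2 * s) + 2 * (\<eta> * w)"
      using ax near eh' w \<eta>w rs4 r by linarith+
    have "norm (v - w *\<^sub>R e) \<le> norm (v - (w *\<^sub>R e + h')) + norm h'"
      using norm_triangle_ineq[of "v - (w *\<^sub>R e + h')" h'] by (simp add: algebra_simps)
    then have "norm (v - w *\<^sub>R e) \<le> 3 / 2 * r" using v h' \<eta>w r by linarith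
    then have "2 * norm (v - w *\<^sub>R e) / w \<le> 3 * r / w" using w(2) by (intro divide_right_mono) auto
    also have "3 * r / w = 3 / s" using r s by (simp add: w_def)
    finally have "norm ((1 / norm v) *\<^sub>R v - e) \<le> 3 / s"
      using normalized_direction_close[OF e w(2), of v] 1(1) by force
    then show ?thesis using 1 by simp
  qed
  define l1 where "l1 = norm (q - p)"
  define l2 where "l2 = norm (u - q)"
  define e1 where "e1 = (1 / l1) *\<^sub>R (q - p)"
  define e2 where "e2 = (1 / l2) *\<^sub>R (u - q)"
  have l1: "l1 > 0" "l1 \<le> 2 * w" "\<bar>l1 - (w + e \<bullet> h)\<bar> \<le> r / (2 * s) + 2 * (\<eta> * w)" "norm e1 = 1" "norm (e1 - e) \<le> 3 / s"
    using leg[OF r_def[symmetric] v1] unfolding e1_def l1_def by blast+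
  have l2: "l2 > 0" "l2 \<le> 2 * w" "\<bar>l2 - (w + e \<bullet> - h)\<bar> \<le> r / (2 * s) + 2 * (\<eta> * w)" "norm e2 = 1" "norm (e2 - e) \<le> 3 / s"
    using leg[OF _ v2] unfolding e2_def l2_def r_def norm_minus_cancel by blast+
  define \<gamma> where "\<gamma> = bent_line q e1 e2"
  have \<gamma>_at: "\<gamma> (- l1) = p" "\<gamma> 0 = q" "\<gamma> l2 = u"
    using l1(1) l2(1) by (simp_all add: \<gamma>_def bent_line_def e1_def e2_def)
  have \<gamma>_lip: "norm (\<gamma> a - \<gamma> b) \<le> \<bar>a - b\<bar>" for a b
    using bent_line_lipschitz[of e1 1 e2 q a b] l1(4) l2(4) by (simp add: \<gamma>_def)
  have \<gamma>_dir: "norm (\<gamma> a - \<gamma> b - (a - b) *\<^sub>R e) \<le> 3 / s * \<bar>a - b\<bar>" for a b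
    unfolding \<gamma>_def by (rule bent_line_direction[OF l1(5) l2(5)])
  have \<gamma>_seg: "\<gamma> \<tau> \<in> closed_segment p q \<union> closed_segment q u" if "- l1 < \<tau>" "\<tau> < l2" for \<tau>
  proof (cases "\<tau> \<le> 0")
    case True
    have "\<gamma> \<tau> = q + (\<tau> / l1) *\<^sub>R (q - p)" using True by (simp add: \<gamma>_def bent_line_def e1_def)
    also have "\<dots> = (1 - (1 + \<tau> / l1)) *\<^sub>R p + (1 + \<tau> / l1) *\<^sub>R q" by (simp add: algebra_simps)
    finally have "\<gamma> \<tau> = (1 - (1 + \<tau> / l1)) *\<^sub>R p + (1 + \<tau> / l1) *\<^sub>R q" .
    moreover have "0 \<le> 1 + \<tau> / l1" "1 + \<tau> / l1 \<le> 1" using True that l1(1) by (simp_all add: field_simps)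
    ultimately show ?thesis unfolding in_segment Un_iff by blast
  next
    case False
    have "\<gamma> \<tau> = q + (\<tau> / l2) *\<^sub>R (u - q)" using False by (simp add: \<gamma>_def bent_line_def e2_def)
    also have "\<dots> = (1 - \<tau> / l2) *\<^sub>R q + (\<tau> / l2) *\<^sub>R u" by (simp add: algebra_simps)
    finally have "\<gamma> \<tau> = (1 - \<tau> / l2) *\<^sub>R q + (\<tau> / l2) *\<^sub>R u" .
    moreover have "0 \<le> \<tau> / l2" "\<tau> / l2 \<le> 1" using False that l2(1) by (simp_all add: field_simps)
    ultimately show ?thesis unfolding in_segment Un_iff by blast
  qed
  have \<gamma>_near: "norm (\<gamma> \<tau> - x) \<le> 4 * w" if "- l1 < \<tau>" "\<tau> < l2" for \<tau>
  proof -
    have "norm (\<gamma> \<tau> - x) \<le> norm (\<gamma> \<tau> - q) + norm (q - x)" using norm_triangle_ineq[of "\<gamma> \<tau> - q" "q - x"] by simp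
    moreover have "norm (\<gamma> \<tau> - q) \<le> \<bar>\<tau>\<bar>" using \<gamma>_lip[of \<tau> 0] \<gamma>_at(2) by simp
    moreover have "norm (q - x) \<le> norm (q - (x + h)) + norm h"
      using norm_triangle_ineq[of "q - (x + h)" h] by (simp add: algebra_simps)
    ultimately show ?thesis using that l1(2) l2(2) pqu(2) \<eta>w w r r_def by linarith
  qed
  \<comment> \<open>The smallest strip width that absorbs the error 4 \<omega> w at the ends of the
    wedge.\<close>
  define \<theta> where "\<theta> = 32 * \<omega> * w / \<kappa>"
  have \<theta>: "\<theta> \<ge> 0" "4 * \<omega> * w \<le> \<kappa> / 8 * \<theta>" using \<omega> w \<kappa>(1) by (simp_all add: \<theta>_def)
  have phi_lip: "M-lipschitz_on UNIV (\<lambda>\<tau>. g (\<gamma> \<tau>))"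
  proof (rule lipschitz_onI)
    fix a b :: real
    have "\<bar>g (\<gamma> a) - g (\<gamma> b)\<bar> \<le> M * norm (\<gamma> a - \<gamma> b)" by (rule bd)
    also have "\<dots> \<le> M * \<bar>a - b\<bar>" using \<gamma>_lip[of a b] M by (intro mult_left_mono) auto
    finally show "dist (g (\<gamma> a)) (g (\<gamma> b)) \<le> M * dist a b" by (simp add: dist_real_def)
  qed (use M in simp)
  have w\<rho>: "w \<le> \<rho> / 4"
  proof -
    have "32 * M * w \<le> 32 * M * (\<rho> / s)" using \<rho>(2) \<kappa>(2) by simp
    then have "w \<le> \<rho> / s" by (rule mult_left_le_imp_le) (use M in simp)
    also have "\<rho> / s \<le> \<rho> / 4" using s \<rho>(1) by (intro divide_left_mono) auto
    finally show ?thesis .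
  qed
  have gp: "\<bar>g p - (g x - D * w)\<bar> \<le> 2 * (\<omega> * w)" and gq: "\<bar>g q - g (x + h)\<bar> \<le> \<omega> * w"
    and gu: "\<bar>g u - (g x + D * w)\<bar> \<le> 2 * (\<omega> * w)"
  proof -
    have close: "\<bar>g z - g z'\<bar> \<le> \<omega> * w" if "norm (z - z') \<le> \<eta> * w" for z z'
    proof -
      have "M * norm (z - z') \<le> M * (\<eta> * w)" using that M by (intro mult_left_mono) auto
      then show ?thesis using bd[of z z'] unfolding \<omega>_def mult.assoc by linarith
    qed
    show "\<bar>g q - g (x + h)\<bar> \<le> \<omega> * w" by (rule close[OF pqu(2)])
    have "w < \<rho>" using w\<rho> \<rho>(1) by linarith
    then have "\<bar>incr g x e w - D * w\<bar> \<le> \<omega> * w" "\<bar>incr g x e (- w) - D * - w\<bar> \<le> \<omega> * w"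
      using lin[of w] lin[of "- w"] w(2) by simp_all
    then show "\<bar>g p - (g x - D * w)\<bar> \<le> 2 * (\<omega> * w)" "\<bar>g u - (g x + D * w)\<bar> \<le> 2 * (\<omega> * w)"
      using close[OF pqu(1)] close[OF pqu(3)] unfolding incr_def by simp_all
  qed
  have D_bd: "\<bar>D * l1 - D * (w + e \<bullet> h)\<bar> \<le> M * (r / (2 * s)) + 2 * (\<omega> * w)"
       "\<bar>D * l2 - D * (w + e \<bullet> - h)\<bar> \<le> M * (r / (2 * s)) + 2 * (\<omega> * w)"
  proof -
    have *: "\<bar>D * l - D * z\<bar> \<le> M * (r / (2 * s)) + 2 * (\<omega> * w)" if "\<bar>l - z\<bar> \<le> r / (2 * s) + 2 * (\<eta> * w)" for l z
    proof -
      have "\<bar>D * l - D * z\<bar> = \<bar>D\<bar> * \<bar>l - z\<bar>" by (simp add: abs_mult flip: right_diff_distrib)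
      also have "\<dots> \<le> M * (r / (2 * s) + 2 * (\<eta> * w))" using D that M by (intro mult_mono) auto
      finally show ?thesis by (simp add: \<omega>_def algebra_simps)
    qed
    show "\<bar>D * l1 - D * (w + e \<bullet> h)\<bar> \<le> M * (r / (2 * s)) + 2 * (\<omega> * w)"
       "\<bar>D * l2 - D * (w + e \<bullet> - h)\<bar> \<le> M * (r / (2 * s)) + 2 * (\<omega> * w)"
      using *[OF l1(3)] *[OF l2(3)] by blast+
  qed
  have Dw: "D * (w + e \<bullet> h) = D * w + D * (e \<bullet> h)" "D * (w + e \<bullet> - h) = D * w - D * (e \<bullet> h)"
    by (simp_all add: algebra_simps)
  have small: "M * (r / (2 * s)) \<le> \<epsilon> * r / 32" "\<omega> * w \<le> \<epsilon> * r / 64" "\<epsilon> * r > 0"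
  proof -
    have "16 * M / s \<le> \<epsilon>" using \<epsilon>(1) s by (simp add: divide_le_eq)
    then have "16 * M / s * (r / 32) \<le> \<epsilon> * (r / 32)" using r by (intro mult_right_mono) auto
    then show "M * (r / (2 * s)) \<le> \<epsilon> * r / 32" by simp
    have "64 * \<omega> * s * (r / 64) \<le> \<epsilon> * (r / 64)" using \<epsilon>(2) r by (intro mult_right_mono) auto
    then show "\<omega> * w \<le> \<epsilon> * r / 64" by (simp add: w_def mult_ac)
    have "0 < 64 * \<omega> * s" using \<omega> s by simp
    then show "\<epsilon> * r > 0" using \<epsilon>(2) r by simp
  qed
  \<comment> \<open>The exceptional set is the corner. Slopes along \<gamma> are allowed half the
    tolerance 8 M / 4^j; the other half covers \<kappa>/2, the cost of replacing \<gamma> by a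
    straight line, as j \<le> k.\<close>
  have "\<epsilon> * r / 2 \<le> 8 * M * \<theta> + 2 * \<epsilon>seq k * (l2 - - l1)"
  proof (rule lipschitz_derivative_selection[OF phi_lip D, where Z = "{0}" and c = 0 and s = "\<lambda>j. 4 * M / 4 ^ j"])
    fix \<tau> j v
    assume j: "j \<le> k" and \<tau>: "- l1 + \<theta> < \<tau>" "\<tau> < l2 - \<theta>" "\<tau> \<notin> {0}"
      and der: "((\<lambda>\<tau>. g (\<gamma> \<tau>)) has_real_derivative v) (at \<tau>)"
      and slopes: "\<And>u. u \<in> {- l1..l2} \<Longrightarrow> \<bar>g (\<gamma> u) - g (\<gamma> \<tau>) - D * (u - \<tau>)\<bar> \<le> 4 * M / 4 ^ j * \<bar>u - \<tau>\<bar>"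
    have \<tau>': "- l1 < \<tau>" "\<tau> < l2" using \<tau> \<theta>(1) by auto
    have "v \<le> D + \<epsilon>seq j"
    proof (rule sel[OF j \<gamma>_seg[OF \<tau>'] _ _ \<gamma>_near[OF \<tau>']])
      show "has_dir_deriv g (\<gamma> \<tau>) (if \<tau> \<le> 0 then e1 else e2) v"
        using der \<tau>(3) unfolding \<gamma>_def by (intro bent_line_has_dir_deriv) auto
      show "norm (if \<tau> \<le> 0 then e1 else e2) = 1" using l1(4) l2(4) by simp
      fix t :: real
      have "\<bar>incr g (\<gamma> \<tau>) e t - incr g x e t\<bar> \<le> (4 * M / 4 ^ j + \<kappa> / 2) * \<bar>t\<bar>"
      proof (rule increments_near_line[OF lip lin \<rho>(1) \<omega> \<gamma>_dir, where A = "- l1" and B = l2 and \<theta> = \<theta> and w = w and \<mu> = "\<eta> * w"])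
        show "M * (3 / s) \<le> \<kappa> / 8" using M s \<kappa>(2) by (simp add: divide_right_mono)
        show "w < \<rho> / 2" using w\<rho> \<rho>(1) by linarith
        show "M * (\<eta> * w) \<le> \<omega> * w" by (simp add: \<omega>_def)
        have "8 * M * norm (\<gamma> \<tau> - x) \<le> 8 * M * (4 * w)" using \<gamma>_near[OF \<tau>'] M by (intro mult_left_mono) auto
        then show "8 * M * norm (\<gamma> \<tau> - x) \<le> \<kappa> * \<rho>" using \<rho>(2) by linarith
      qed (use \<theta> \<omega>\<kappa> \<kappa>(1) \<tau> slopes M pqu w \<gamma>_at in auto)
      also have "\<dots> \<le> 8 * M / 4 ^ j * \<bar>t\<bar>"
      proof (rule mult_right_mono)
        have "(4::real) ^ j \<le> 4 ^ k" using j by (intro power_increasing) auto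
        then have "4 * M / 4 ^ k \<le> 4 * M / 4 ^ j" using M by (intro divide_left_mono) auto
        then show "4 * M / 4 ^ j + \<kappa> / 2 \<le> 8 * M / 4 ^ j" by (simp add: \<kappa>_def)
      qed simp
      finally show "\<bar>incr g (\<gamma> \<tau>) e t - incr g x e t\<bar> \<le> 8 * M / 4 ^ j * \<bar>t\<bar>" .
    qed
    then show "v - D \<le> \<epsilon>seq j" by simp
  next
    show "- (\<epsilon> * r / 2) \<le> g (\<gamma> l2) - g (\<gamma> (- l1)) - D * (l2 - - l1)"
    proof -
      \<comment> \<open>The first-order changes of the two lengths are opposite and cancel, so from
        end to end the wedge is almost as long as the chord, along which g grows at the rate
        D.\<close>
      have "D * (l2 - - l1) = D * l1 + D * l2" by (simp add: algebra_simps)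
      then show ?thesis unfolding \<gamma>_at using gp gu D_bd Dw small by linarith
    qed
    show "\<epsilon> * r / 2 \<le> g (\<gamma> 0) - g (\<gamma> (- l1)) - D * (0 - - l1) \<or> \<epsilon> * r / 2 \<le> g (\<gamma> l2) - g (\<gamma> 0) - D * (l2 - 0)"
    \<comment> \<open>If g is too large at the corner, the leg ascending to it gains; if too small,
      the leg leaving it does.\<close>
    proof (cases "g (x + h) - g x - D * (e \<bullet> h) > 0")
      case True
      then have "g (x + h) - g x - D * (e \<bullet> h) > \<epsilon> * r" using dev by simp
      then have "\<epsilon> * r / 2 \<le> g q - g p - D * l1" using gp gq D_bd(1) Dw(1) small by linarith
      then show ?thesis unfolding \<gamma>_at by simp
    next
      case False
      then have "g (x + h) - g x - D * (e \<bullet> h) < - (\<epsilon> * r)" using dev by simp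
      then have "\<epsilon> * r / 2 \<le> g u - g q - D * l2" using gu gq D_bd(2) Dw(2) small by linarith
      then show ?thesis unfolding \<gamma>_at by simp
    qed
    show "(\<Sum>j<k. \<epsilon>seq j / (4 * M / 4 ^ Suc j)) \<le> 1 / 30" by (rule \<epsilon>seq_sum[OF M])
    show "0 \<le> \<epsilon>seq j" for j using \<epsilon>seq_pos[of j] by simp
  qed (use l1(1) l2(1) \<theta>(1) M in auto)
  also have "2 * \<epsilon>seq k * (l2 - - l1) \<le> 2 * \<epsilon>seq k * (4 * w)"
    using l1(2) l2(2) \<epsilon>seq_pos[of k] by (intro mult_left_mono) auto
  finally show ?thesis by (simp add: \<theta>_def)
qed

text \<open>The flatness s of the wedge is fixed by \<epsilon> alone. Only the finitely many
  tolerances with j \<le> k then matter, and they share a common level and radius.\<close>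

lemma near_maximal_imp_has_derivative:
  fixes g :: "'a::euclidean_space \<Rightarrow> real" and T :: "real \<Rightarrow> 'a set"
  assumes lip: "M-lipschitz_on UNIV g" and M: "M \<ge> 1" and e: "norm e = 1" and D: "has_dir_deriv g x e D"
    and T: "mono_on {0..} T" and lam: "lam \<ge> 0"
    and rich: "\<And>l'. lam < l' \<Longrightarrow> l' \<le> 1 \<Longrightarrow> wedge_rich (T l') x"
    and max: "\<And>k. \<exists>b>lam. b \<le> 1 \<and> (\<exists>\<delta>>0. \<forall>y d v. y \<in> T b \<longrightarrow> norm d = 1 \<longrightarrow> has_dir_deriv g y d v \<longrightarrow>
       norm (y - x) \<le> \<delta> \<longrightarrow> (\<forall>t. \<bar>incr g y e t - incr g x e t\<bar> \<le> 8 * M / 4 ^ k * \<bar>t\<bar>) \<longrightarrow> v \<le> D + \<epsilon>seq k)"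
  shows "(g has_derivative (\<lambda>h. D * (e \<bullet> h))) (at x)"
  unfolding has_derivative_at_alt
proof (intro conjI allI impI)
  show "bounded_linear (\<lambda>h. D * (e \<bullet> h))"
    by (intro bounded_linear_const_mult bounded_linear_inner_right)
  have D_bd: "\<bar>D\<bar> \<le> M" using has_dir_deriv_bound[OF lip D] e by simp
  fix \<epsilon> :: real assume \<epsilon>: "\<epsilon> > 0"
  obtain k :: nat where "4 ^ k > 16 * M / \<epsilon>" using real_arch_pow[of 4 "16 * M / \<epsilon>"] by auto
  then have "16 * M < \<epsilon> * 4 ^ k" using \<epsilon> by (simp add: field_simps)
  moreover define s :: real where "s = 4 ^ Suc k"
  ultimately have \<epsilon>s: "16 * M \<le> \<epsilon> * s" using M by simp
  have s: "s \<ge> 4" by (simp add: s_def)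
  define \<kappa> where "\<kappa> = 8 * M / 4 ^ k"
  have \<kappa>: "\<kappa> = 32 * M / s" "\<kappa> > 0" using M by (simp_all add: \<kappa>_def s_def)
  \<comment> \<open>The first bound keeps the approximating polygon a wedge of the intended shape;
    the second gives 64 \<omega> s^2 \<le> \<epsilon>, which makes the loss on the end strips
    small.\<close>
  define \<eta> where "\<eta> = min (1 / (8 * s)) (\<epsilon> / (64 * M * s * s))"
  have \<eta>: "\<eta> > 0" "\<eta> \<le> 1 / (8 * s)" "\<eta> \<le> \<epsilon> / (64 * M * s * s)" using s \<epsilon> M by (simp_all add: \<eta>_def)
  have \<eta>s: "\<eta> * s \<le> 1 / 8" using \<eta>(2) s by (simp add: field_simps)
  define \<omega> where "\<omega> = M * \<eta>"
  have \<omega>: "\<omega> > 0" using M \<eta>(1) by (simp add: \<omega>_def)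
  have \<omega>ss: "64 * \<omega> * s * s \<le> \<epsilon>" using \<eta>(3) s M by (simp add: \<omega>_def field_simps)
  have \<omega>s: "64 * \<omega> * s \<le> \<epsilon>"
  proof -
    have "64 * \<omega> * s * 1 \<le> 64 * \<omega> * s * s" using \<omega> s by (intro mult_left_mono) auto
    then show ?thesis using \<omega>ss by simp
  qed
  have \<omega>\<kappa>: "\<omega> \<le> \<kappa> / 16"
  proof -
    have "\<omega> \<le> M * (1 / (8 * s))" unfolding \<omega>_def using \<eta>(2) M by (intro mult_left_mono) auto
    also have "\<dots> \<le> \<kappa> / 16" using M s by (simp add: \<kappa>(1) field_simps)
    finally show ?thesis .
  qed
  obtain \<rho> where \<rho>: "\<rho> > 0" "\<And>t. \<bar>t\<bar> < \<rho> \<Longrightarrow> \<bar>incr g x e t - D * t\<bar> \<le> \<omega> * \<bar>t\<bar>"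
    by (rule has_dir_derivD[OF D \<omega>]) (rule that)
  obtain b \<delta> where b: "\<And>j. b j > lam" "\<And>j. b j \<le> 1" "\<And>j. \<delta> j > (0::real)"
    and sel: "\<And>j y d v. y \<in> T (b j) \<Longrightarrow> norm d = 1 \<Longrightarrow> has_dir_deriv g y d v \<Longrightarrow> norm (y - x) \<le> \<delta> j \<Longrightarrow>
      (\<And>t. \<bar>incr g y e t - incr g x e t\<bar> \<le> 8 * M / 4 ^ j * \<bar>t\<bar>) \<Longrightarrow> v \<le> D + \<epsilon>seq j"
    using max by metis
  define b' where "b' = Min (b ` {..k})"
  define \<delta>' where "\<delta>' = Min (\<delta> ` {..k})"
  have b': "b' > lam" "b' \<le> 1" "\<And>j. j \<le> k \<Longrightarrow> b' \<le> b j"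
  proof -
    have "b' \<in> b ` {..k}" unfolding b'_def by (rule Min_in) auto
    then show "b' > lam" "b' \<le> 1" using b by auto
  qed (simp add: b'_def)
  have \<delta>': "\<delta>' > 0" "\<And>j. j \<le> k \<Longrightarrow> \<delta>' \<le> \<delta> j"
  proof -
    have "\<delta>' \<in> \<delta> ` {..k}" unfolding \<delta>'_def by (rule Min_in) auto
    then show "\<delta>' > 0" using b by auto
  qed (simp add: \<delta>'_def)
  have "wedge_rich (T b') x" by (rule rich[OF b'(1,2)])
  then obtain d where d: "d > 0" "\<And>r p q u. 0 < r \<Longrightarrow> r < d \<Longrightarrow> p \<in> cball x r \<Longrightarrow> q \<in> cball x r \<Longrightarrow> u \<in> cball x r \<Longrightarrow>
     (\<exists>p' q' u'. dist p p' \<le> \<eta> * r \<and> dist q q' \<le> \<eta> * r \<and> dist u u' \<le> \<eta> * r \<and>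
        closed_segment p' q' \<subseteq> T b' \<and> closed_segment q' u' \<subseteq> T b')"
    unfolding wedge_rich_def using \<eta>(1) by blast
  \<comment> \<open>The wedge has size w = r s and its points stay within 4 w of x. The three bounds
    put it in the range of the polygonal approximation, of the near-maximality, and of the linearity
    of the increments at x.\<close>
  define d0 where "d0 = min (d / s) (min (\<delta>' / (4 * s)) (\<kappa> * \<rho> / (32 * M * s)))"
  have d0: "d0 > 0" using d(1) \<delta>'(1) \<kappa>(2) \<rho>(1) s M by (simp add: d0_def)
  have "\<bar>g (x + h) - g x - D * (e \<bullet> h)\<bar> \<le> \<epsilon> * norm h" if h: "norm h < d0" for h
  proof (cases "h = 0")
    case False
    define r where "r = norm h"
    have r: "r > 0" using False by (simp add: r_def)
    define w where "w = r * s"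
    have w: "w > 0" using r s by (simp add: w_def)
    have rw: "r \<le> w" using mult_left_mono[of 1 s r] r s by (simp add: w_def)
    have bounds: "w < d" "4 * w \<le> \<delta>'" "32 * M * w \<le> \<kappa> * \<rho>"
    proof -
      have "r < d / s" "r < \<delta>' / (4 * s)" "r < \<kappa> * \<rho> / (32 * M * s)" using h by (simp_all add: r_def d0_def)
      then have "r * s < d" "r * (4 * s) < \<delta>'" "r * (32 * M * s) < \<kappa> * \<rho>" using s M by (simp_all add: pos_less_divide_eq)
      then show "w < d" "4 * w \<le> \<delta>'" "32 * M * w \<le> \<kappa> * \<rho>" by (simp_all add: w_def algebra_simps)
    qed
    have "x - w *\<^sub>R e \<in> cball x w" "x + h \<in> cball x w" "x + w *\<^sub>R e \<in> cball x w"
      using e w rw by (simp_all add: dist_norm r_def)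
    from d(2)[OF w bounds(1) this] obtain p q u where
      pqu: "dist (x - w *\<^sub>R e) p \<le> \<eta> * w" "dist (x + h) q \<le> \<eta> * w" "dist (x + w *\<^sub>R e) u \<le> \<eta> * w"
      and seg: "closed_segment p q \<subseteq> T b'" "closed_segment q u \<subseteq> T b'" by blast
    show ?thesis
    proof (rule ccontr)
      assume "\<not> ?thesis"
      then have dev: "\<bar>g (x + h) - g x - D * (e \<bullet> h)\<bar> > \<epsilon> * r" by (simp add: r_def)
      have "\<epsilon> * r / 2 \<le> 8 * M * (32 * \<omega> * w / \<kappa>) + 8 * \<epsilon>seq k * w"
      proof (rule wedge_gain_bounded[OF lip M e D_bd s_def r_def r w_def \<eta>(1) \<eta>s \<omega>_def \<kappa>_def \<rho>(2) \<rho>(1) bounds(3) \<omega>\<kappa> _ _ _ _ dev \<epsilon>s \<omega>s])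
        show "norm (p - (x - w *\<^sub>R e)) \<le> \<eta> * w" "norm (q - (x + h)) \<le> \<eta> * w" "norm (u - (x + w *\<^sub>R e)) \<le> \<eta> * w"
          using pqu by (simp_all add: dist_norm norm_minus_commute)
        fix j y d v
        assume j: "j \<le> k" and y: "y \<in> closed_segment p q \<union> closed_segment q u" "norm d = 1" "has_dir_deriv g y d v"
          "norm (y - x) \<le> 4 * w" "\<And>t. \<bar>incr g y e t - incr g x e t\<bar> \<le> 8 * M / 4 ^ j * \<bar>t\<bar>"
        have "T b' \<subseteq> T (b j)" using mono_onD[OF T, of b' "b j"] b'(1) b'(3)[OF j] lam by simp
        then have "y \<in> T (b j)" using y(1) seg by blast
        moreover have "norm (y - x) \<le> \<delta> j" using y(4) bounds(2) \<delta>'(2)[OF j] by linarith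
        ultimately show "v \<le> D + \<epsilon>seq j" using sel y(2,3,5) by blast
      qed
      also have "8 * M * (32 * \<omega> * w / \<kappa>) = 8 * \<omega> * s * s * r" using M s by (simp add: \<kappa>(1) w_def)
      also have "\<dots> \<le> \<epsilon> / 8 * r" using \<omega>ss r by (intro mult_right_mono) auto
      also have "8 * \<epsilon>seq k * w \<le> \<epsilon> / 8 * r"
      proof -
        have "(16::real) ^ k \<le> 32 ^ k" by (rule power_mono) auto
        then have "\<epsilon>seq k \<le> 1 / (64 * 16 ^ k)" by (simp add: \<epsilon>seq_def frac_le)
        also have "\<dots> = 1 / (4 * s * s)"
        proof -
          have "(16::real) ^ k = 4 ^ k * 4 ^ k" by (simp flip: power_mult_distrib)
          then show ?thesis by (simp add: s_def)
        qed
        \<comment> \<open>The precision, of order at most 1 / s^2, beats the ratio w / r = s; what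
          remains is 2 r / s, small by the choice of k.\<close>
        finally have "8 * \<epsilon>seq k * w \<le> 8 * (1 / (4 * s * s)) * w" using w by (intro mult_right_mono mult_left_mono) auto
        also have "\<dots> = 2 / s * r" using s by (simp add: w_def)
        also have "\<dots> \<le> \<epsilon> / 8 * r"
        proof (rule mult_right_mono)
          have "16 * 1 \<le> \<epsilon> * s" using \<epsilon>s M by linarith
          then show "2 / s \<le> \<epsilon> / 8" using s by (simp add: divide_le_eq)
        qed (use r in simp)
        finally show ?thesis .
      qed
      \<comment> \<open>Both losses are at most \<epsilon> r / 8, too small for a gain of \<epsilon>
        r / 2.\<close>
      finally show False using r \<epsilon> by (simp add: field_simps)
    qed
  qed simp
  then show "\<exists>d>0. \<forall>y. norm (y - x) < d \<longrightarrow> norm (g y - g x - D * (e \<bullet> (y - x))) \<le> \<epsilon> * norm (y - x)"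
    using d0 by (intro exI[of _ d0]) (metis add_diff_cancel_left' diff_add_cancel add.commute real_norm_def)
qed

section \<open>Absorbing the tilt and assembling the null set\<close>

lemma has_dir_deriv_add_linear:
  fixes f :: "'a::real_inner \<Rightarrow> real"
  shows "has_dir_deriv (\<lambda>x. f x + l \<bullet> x) x e v \<longleftrightarrow> has_dir_deriv f x e (v - l \<bullet> e)"
  unfolding has_dir_deriv_def incr_def by (simp add: inner_add_right algebra_simps)

theorem corollary5p2:
  assumes "CARD('n::finite) \<ge> 2"
  shows "\<exists>S :: (real ^ 'n) set. compact S \<and> S \<in> null_sets lebesgue \<and>
           (\<forall>g :: real ^ 'n \<Rightarrow> real.
              (\<exists>L. L-lipschitz_on UNIV g) \<longrightarrow> (\<exists>x\<in>S. g differentiable (at x)))"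
proof -
  have "DIM(real ^ 'n) \<ge> 2" using assms by simp
  then obtain T :: "real \<Rightarrow> (real ^ 'n) set" and b :: "real ^ 'n" where T:
    "\<And>l. closed (T l)" "\<And>l l'. 0 \<le> l \<Longrightarrow> l \<le> l' \<Longrightarrow> T l \<subseteq> T l'" "negligible (T 1)"
    "norm b = 1" "\<And>l. l \<ge> 0 \<Longrightarrow> closed_segment 0 b \<subseteq> T l"
    "\<And>l l' x. 0 \<le> l \<Longrightarrow> l < l' \<Longrightarrow> l' \<le> 1 \<Longrightarrow> x \<in> T l \<Longrightarrow> wedge_rich (T l') x"
    by (rule wedge_rich_family) (rule that)
  have T_mono: "mono_on {0..} T" using T(2) by (intro mono_onI) auto
  \<comment> \<open>The search starts on a segment in the unit ball and moves by at most 1, hence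
    the radius 2.\<close>
  define S where "S = T 1 \<inter> cball 0 2"
  have "\<exists>x\<in>S. f differentiable (at x)" if f: "L-lipschitz_on UNIV f" for f :: "real ^ 'n \<Rightarrow> real" and L
  proof -
    have L: "L \<ge> 0" using lipschitz_on_nonneg[OF f] .
    \<comment> \<open>The seed of the search: along the segment contained in every
      \<open>T l\<close>, f is a Lipschitz function of one variable and so differentiable somewhere
      in (0, 1).\<close>
    have "L-lipschitz_on UNIV (\<lambda>t. f (t *\<^sub>R b))"
    proof (rule lipschitz_onI)
      show "dist (f (t *\<^sub>R b)) (f (u *\<^sub>R b)) \<le> L * dist t u" for t u
        using lipschitz_real_valued_bound[OF f, of "t *\<^sub>R b" "u *\<^sub>R b"] T(4)
        by (simp add: dist_real_def flip: scaleR_diff_left)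
    qed (rule L)
    then obtain h N where hN: "negligible N" "\<And>t. t \<notin> N \<Longrightarrow> ((\<lambda>t. f (t *\<^sub>R b)) has_real_derivative h t) (at t)"
      by (rule lipschitz_real_density) (rule that)
    have "\<not> {0<..<1} \<subseteq> N"
    proof
      assume "{0<..<1} \<subseteq> N"
      then have "negligible {0<..<1::real}" using hN(1) negligible_subset by blast
      then show False using open_not_negligible[of "{0<..<1::real}"] by simp
    qed
    then obtain t0 where "t0 \<in> {0<..<1}" "t0 \<notin> N" by blast
    then have t0: "0 < t0" "t0 < 1" "t0 \<notin> N" by simp_all
    have "((\<lambda>t. f ((t + t0) *\<^sub>R b)) has_real_derivative h t0) (at 0)"
      using hN(2)[OF t0(3)] DERIV_shift[of "\<lambda>t. f (t *\<^sub>R b)" "h t0" 0 t0] by simp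
    then have x0: "has_dir_deriv f (t0 *\<^sub>R b) b (h t0)"
      unfolding has_dir_deriv_iff_has_real_derivative by (simp add: scaleR_add_left add.commute)
    have "t0 *\<^sub>R b \<in> closed_segment 0 b" using t0 unfolding in_segment by (intro exI[of _ t0]) auto
    then have x0T: "t0 *\<^sub>R b \<in> T (1/2)" using subsetD[OF T(5)[of "1/2"]] by simp
    obtain x e v l lam where x: "1/2 \<le> lam" "x \<in> T lam" "norm e = 1" "has_dir_deriv f x e v"
      "norm (x - t0 *\<^sub>R b) \<le> 1" "norm l \<le> 1"
      and max: "\<And>k. \<exists>b>lam. b \<le> 1 \<and> (\<exists>\<delta>>0. \<forall>x' e' v'. x' \<in> T b \<longrightarrow> norm e' = 1 \<longrightarrow> has_dir_deriv f x' e' v' \<longrightarrow>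
       norm (x' - x) \<le> \<delta> \<longrightarrow> (\<forall>t. \<bar>incr f x' e t - incr f x e t\<bar> \<le> \<sigma>seq L k / 4 * \<bar>t\<bar>) \<longrightarrow>
       v' + l \<bullet> e' \<le> v + l \<bullet> e + \<epsilon>seq k)"
      by (rule near_maximal_direction[OF f T(1) T_mono x0T T(4) x0 zero_less_one]) (rule that)
    \<comment> \<open>For the tilted function, near-maximality of v + l \<bullet> e becomes
      near-maximality of the slope itself. Increments along e differ as before, and the Lipschitz
      constant grows by at most norm l \<le> 1, which matches the L + 1 in
      \<open>\<sigma>seq\<close>.\<close>
    define g where "g = (\<lambda>x. f x + l \<bullet> x)"
    have g_dd: "has_dir_deriv g y d u \<longleftrightarrow> has_dir_deriv f y d (u - l \<bullet> d)" for y d u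
      unfolding g_def by (rule has_dir_deriv_add_linear)
    have g_incr: "incr g y e t - incr g x e t = incr f y e t - incr f x e t" for y t
      by (simp add: g_def incr_def inner_add_right)
    have g_lip: "(L + 1)-lipschitz_on UNIV g"
    proof (rule lipschitz_onI)
      fix y z
      have "\<bar>l \<bullet> (y - z)\<bar> \<le> norm l * norm (y - z)" by (rule Cauchy_Schwarz_ineq2)
      also have "\<dots> \<le> 1 * norm (y - z)" using x(6) by (rule mult_right_mono) simp
      finally have "\<bar>g y - g z\<bar> \<le> (L + 1) * norm (y - z)"
        using lipschitz_real_valued_bound[OF f, of y z] unfolding g_def inner_diff_right distrib_right by linarith
      then show "dist (g y) (g z) \<le> (L + 1) * dist y z" by (simp add: dist_norm)
    qed (use L in simp)
    have "(g has_derivative (\<lambda>h. (v + l \<bullet> e) * (e \<bullet> h))) (at x)"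
    proof (rule near_maximal_imp_has_derivative[OF g_lip _ x(3) _ T_mono])
      show "has_dir_deriv g x e (v + l \<bullet> e)" using x(4) by (simp add: g_dd)
      show "wedge_rich (T l') x" if "lam < l'" "l' \<le> 1" for l'
        using T(6)[OF _ that x(2)] x(1) by simp
      fix k
      have \<sigma>: "\<sigma>seq L k / 4 = 8 * (L + 1) / 4 ^ k" by (simp add: \<sigma>seq_def field_simps)
      obtain b' \<delta> where b': "b' > lam" "b' \<le> 1" "\<delta> > 0"
        and sel: "\<And>x' e' v'. x' \<in> T b' \<Longrightarrow> norm e' = 1 \<Longrightarrow> has_dir_deriv f x' e' v' \<Longrightarrow> norm (x' - x) \<le> \<delta> \<Longrightarrow>
          \<forall>t. \<bar>incr f x' e t - incr f x e t\<bar> \<le> \<sigma>seq L k / 4 * \<bar>t\<bar> \<Longrightarrow> v' + l \<bullet> e' \<le> v + l \<bullet> e + \<epsilon>seq k"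
        using max[of k] by blast
      have "u \<le> v + l \<bullet> e + \<epsilon>seq k"
        if "y \<in> T b'" "norm d = 1" "has_dir_deriv g y d u" "norm (y - x) \<le> \<delta>"
          "\<forall>t. \<bar>incr g y e t - incr g x e t\<bar> \<le> 8 * (L + 1) / 4 ^ k * \<bar>t\<bar>" for y d u
        using sel[OF that(1,2) that(3)[unfolded g_dd] that(4)] that(5) unfolding g_incr \<sigma> by simp
      then show "\<exists>b>lam. b \<le> 1 \<and> (\<exists>\<delta>>0. \<forall>y d u. y \<in> T b \<longrightarrow> norm d = 1 \<longrightarrow> has_dir_deriv g y d u \<longrightarrow>
         norm (y - x) \<le> \<delta> \<longrightarrow> (\<forall>t. \<bar>incr g y e t - incr g x e t\<bar> \<le> 8 * (L + 1) / 4 ^ k * \<bar>t\<bar>) \<longrightarrow>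
         u \<le> v + l \<bullet> e + \<epsilon>seq k)"
        using b' by blast
    qed (use L x(1) in auto)
    then have "((\<lambda>y. g y - l \<bullet> y) has_derivative (\<lambda>h. (v + l \<bullet> e) * (e \<bullet> h) - l \<bullet> h)) (at x)"
      by (intro has_derivative_diff has_derivative_inner_right has_derivative_ident)
    then have "(f has_derivative (\<lambda>h. (v + l \<bullet> e) * (e \<bullet> h) - l \<bullet> h)) (at x)" by (simp add: g_def)
    then have "f differentiable (at x)" unfolding differentiable_def by blast
    moreover have "x \<in> S"
    proof -
      obtain b' where "b' > lam" "b' \<le> 1" using max[of 0] by blast
      then have "lam \<le> 1" by simp
      then have "x \<in> T 1" using subsetD[OF T(2)[of lam 1] x(2)] x(1) by simp
      moreover have "norm x \<le> 2"
      proof -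
        have "norm x \<le> norm (x - t0 *\<^sub>R b) + norm (t0 *\<^sub>R b)" using norm_triangle_ineq[of "x - t0 *\<^sub>R b" "t0 *\<^sub>R b"] by simp
        then show ?thesis using x(5) t0 T(4) by simp
      qed
      ultimately show ?thesis by (simp add: S_def)
    qed
    ultimately show ?thesis by blast
  qed
  moreover have "compact S" unfolding S_def by (rule closed_Int_compact[OF T(1) compact_cball])
  moreover have "S \<in> null_sets lebesgue"
    using negligible_subset[OF T(3), of S] by (simp add: S_def negligible_iff_null_sets)
  ultimately show ?thesis by blast
qed

end
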